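(* Let $\mathcal{X}$ be a semiabelian variety, let $\mathcal{R}$ be a full and replete subcategory of the abelian core $\mathsf{Ab}(\mathcal{X})$ which is reflective in $\mathcal{X}$ with reflector $T\colon\mathcal{X}\to\mathcal{R}$, where $\mathcal{R}$ is an abelian category and both $T$ and the inclusion $\mathcal{R}\to\mathcal{X}$ are sequentially right exact. Let $n\geq0$. Then an object $X$ of $\mathcal{X}$ is $n$-acyclic with respect to $T$, i.e. $\mathrm{L}_0T(X)=\mathrm{L}_1T(X)=\cdots=\mathrm{L}_nT(X)=0$, if and only if $$\mathrm{Ext}^0(X,M)=\cdots=\mathrm{Ext}^n(X,M)=0\quad\text{for each }M\text{ in }\mathcal{R}.$$
   Context: A semiabelian category is a pointed, Barr exact, Bourn protomodular category with binary coproducts; a semiabelian variety is a variety of universal algebras which is a semiabelian category (it has enough projectives with respect to regular epimorphisms). A sequence $U\xrightarrow{u}V\xrightarrow{v}W$ is exact at $V$ if $\mathrm{Ker}(v)=\mathrm{Im}(u)$. A functor between semiabelian categories is sequentially right exact if it sends every exact sequence $U\to X\to Y\to0$ to an exact sequence. $\mathsf{Ab}(\mathcal{X})$ is the full subcategory of objects admitting an (automatically unique) internal abelian group structure. A simplicial projective resolution $P(X)\to X$ is an augmented simplicial object with every $P_n$ projective, $P_0\to X$ a regular epimorphism, and the canonical map from $P_{n+1}$ to the simplicial kernel of the faces of $P_n$ a regular epimorphism for each $n\geq0$. Define $\mathrm{L}_nT(X):=\mathrm{H}_nT(P(X))$ (Moore homology) and, for $A$ in $\mathsf{Ab}(\mathcal{X})$,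 $\mathrm{Ext}^n(X,A):=\mathrm{H}^n\mathrm{Hom}_{\mathcal{X}}(P(X),A)$. *)

theory Defs
  imports "HOL-Algebra.Elementary_Groups" "HOL-Algebra.FiniteProduct" "HOL-Library.Equipollence" "HOL-Library.FuncSet"
begin

section \<open>Categories and functors\<close>

record ('o, 'm) cat =
  Ob :: "'o set"
  Ar :: "'m set"
  Dom :: "'m \<Rightarrow> 'o"
  Cod :: "'m \<Rightarrow> 'o"
  Idt :: "'o \<Rightarrow> 'm"
  Cmp :: "'m \<Rightarrow> 'm \<Rightarrow> 'm"  (infixl "\<cdot>\<index>" 70)

definition Hom :: "('o, 'm) cat \<Rightarrow> 'o \<Rightarrow> 'o \<Rightarrow> 'm set" where
  "Hom C A B = {f \<in> Ar C. Dom C f = A \<and> Cod C f = B}"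

definition category :: "('o, 'm) cat \<Rightarrow> bool" where
  "category C \<longleftrightarrow>
     (\<forall>f \<in> Ar C. Dom C f \<in> Ob C \<and> Cod C f \<in> Ob C) \<and>
     (\<forall>A \<in> Ob C. Idt C A \<in> Hom C A A) \<and>
     (\<forall>f \<in> Ar C. \<forall>g \<in> Ar C. Cod C f = Dom C g \<longrightarrow>
        g \<cdot>\<^bsub>C\<^esub> f \<in> Hom C (Dom C f) (Cod C g)) \<and>
     (\<forall>f \<in> Ar C. f \<cdot>\<^bsub>C\<^esub> Idt C (Dom C f) = f \<and> Idt C (Cod C f) \<cdot>\<^bsub>C\<^esub> f = f) \<and>
     (\<forall>f \<in> Ar C. \<forall>g \<in> Ar C. \<forall>h \<in> Ar C. Cod C f = Dom C g \<longrightarrow> Cod C g = Dom C h \<longrightarrow>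
        h \<cdot>\<^bsub>C\<^esub> (g \<cdot>\<^bsub>C\<^esub> f) = (h \<cdot>\<^bsub>C\<^esub> g) \<cdot>\<^bsub>C\<^esub> f)"

definition full_subcategory :: "('o, 'm) cat \<Rightarrow> 'o set \<Rightarrow> ('o, 'm) cat" where
  "full_subcategory C R = C\<lparr>Ob := R, Ar := {f \<in> Ar C. Dom C f \<in> R \<and> Cod C f \<in> R}\<rparr>"

record ('o, 'm, 'p, 'q) ftor =
  FOb :: "'o \<Rightarrow> 'p"
  FAr :: "'m \<Rightarrow> 'q"

definition is_functor ::
  "('o, 'm) cat \<Rightarrow> ('p, 'q) cat \<Rightarrow> ('o, 'm, 'p, 'q) ftor \<Rightarrow> bool" where
  "is_functor C D F \<longleftrightarrow>
     (\<forall>A \<in> Ob C. FOb F A \<in> Ob D) \<and>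
     (\<forall>f \<in> Ar C. FAr F f \<in> Hom D (FOb F (Dom C f)) (FOb F (Cod C f))) \<and>
     (\<forall>A \<in> Ob C. FAr F (Idt C A) = Idt D (FOb F A)) \<and>
     (\<forall>f \<in> Ar C. \<forall>g \<in> Ar C. Cod C f = Dom C g \<longrightarrow>
        FAr F (g \<cdot>\<^bsub>C\<^esub> f) = FAr F g \<cdot>\<^bsub>D\<^esub> FAr F f)"

definition inclusion_functor :: "('o, 'm, 'o, 'm) ftor" where
  "inclusion_functor = \<lparr>FOb = (\<lambda>A. A), FAr = (\<lambda>f. f)\<rparr>"


section \<open>Special objects and arrows, limits and colimits\<close>

definition is_iso :: "('o, 'm) cat \<Rightarrow> 'm \<Rightarrow> bool" where
  "is_iso C f \<longleftrightarrow> f \<in> Ar C \<and>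
     (\<exists>g \<in> Hom C (Cod C f) (Dom C f).
        g \<cdot>\<^bsub>C\<^esub> f = Idt C (Dom C f) \<and> f \<cdot>\<^bsub>C\<^esub> g = Idt C (Cod C f))"

definition monic :: "('o, 'm) cat \<Rightarrow> 'm \<Rightarrow> bool" where
  "monic C f \<longleftrightarrow> f \<in> Ar C \<and>
     (\<forall>a \<in> Ar C. \<forall>b \<in> Ar C. Cod C a = Dom C f \<longrightarrow> Cod C b = Dom C f \<longrightarrow> Dom C a = Dom C b \<longrightarrow>
        f \<cdot>\<^bsub>C\<^esub> a = f \<cdot>\<^bsub>C\<^esub> b \<longrightarrow> a = b)"

definition epic :: "('o, 'm) cat \<Rightarrow> 'm \<Rightarrow> bool" where
  "epic C f \<longleftrightarrow> f \<in> Ar C \<and>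
     (\<forall>a \<in> Ar C. \<forall>b \<in> Ar C. Dom C a = Cod C f \<longrightarrow> Dom C b = Cod C f \<longrightarrow> Cod C a = Cod C b \<longrightarrow>
        a \<cdot>\<^bsub>C\<^esub> f = b \<cdot>\<^bsub>C\<^esub> f \<longrightarrow> a = b)"

definition terminal :: "('o, 'm) cat \<Rightarrow> 'o \<Rightarrow> bool" where
  "terminal C Z \<longleftrightarrow> Z \<in> Ob C \<and> (\<forall>A \<in> Ob C. \<exists>!f. f \<in> Hom C A Z)"

definition initial :: "('o, 'm) cat \<Rightarrow> 'o \<Rightarrow> bool" where
  "initial C Z \<longleftrightarrow> Z \<in> Ob C \<and> (\<forall>A \<in> Ob C. \<exists>!f. f \<in> Hom C Z A)"

definition zero_object :: "('o, 'm) cat \<Rightarrow> 'o \<Rightarrow> bool" where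
  "zero_object C Z \<longleftrightarrow> initial C Z \<and> terminal C Z"

definition pointed :: "('o, 'm) cat \<Rightarrow> bool" where
  "pointed C \<longleftrightarrow> (\<exists>Z. zero_object C Z)"

definition zero_arrow :: "('o, 'm) cat \<Rightarrow> 'm \<Rightarrow> bool" where
  "zero_arrow C f \<longleftrightarrow> f \<in> Ar C \<and>
     (\<exists>Z a b. zero_object C Z \<and> a \<in> Hom C (Dom C f) Z \<and> b \<in> Hom C Z (Cod C f) \<and> f = b \<cdot>\<^bsub>C\<^esub> a)"

definition is_product :: "('o, 'm) cat \<Rightarrow> 'o \<Rightarrow> 'o \<Rightarrow> 'm \<Rightarrow> 'm \<Rightarrow> bool" where
  "is_product C A B p q \<longleftrightarrow>
     p \<in> Ar C \<and> q \<in> Ar C \<and> Dom C p = Dom C q \<and> Cod C p = A \<and> Cod C q = B \<and>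
     (\<forall>f \<in> Ar C. \<forall>g \<in> Ar C. Dom C f = Dom C g \<longrightarrow> Cod C f = A \<longrightarrow> Cod C g = B \<longrightarrow>
        (\<exists>!h. h \<in> Hom C (Dom C f) (Dom C p) \<and> p \<cdot>\<^bsub>C\<^esub> h = f \<and> q \<cdot>\<^bsub>C\<^esub> h = g))"

definition pairing :: "('o, 'm) cat \<Rightarrow> 'm \<Rightarrow> 'm \<Rightarrow> 'm \<Rightarrow> 'm \<Rightarrow> 'm" where
  "pairing C p q f g =
     (THE h. h \<in> Hom C (Dom C f) (Dom C p) \<and> p \<cdot>\<^bsub>C\<^esub> h = f \<and> q \<cdot>\<^bsub>C\<^esub> h = g)"

definition is_coproduct :: "('o, 'm) cat \<Rightarrow> 'o \<Rightarrow> 'o \<Rightarrow> 'm \<Rightarrow> 'm \<Rightarrow> bool" where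
  "is_coproduct C A B i j \<longleftrightarrow>
     i \<in> Ar C \<and> j \<in> Ar C \<and> Cod C i = Cod C j \<and> Dom C i = A \<and> Dom C j = B \<and>
     (\<forall>f \<in> Ar C. \<forall>g \<in> Ar C. Cod C f = Cod C g \<longrightarrow> Dom C f = A \<longrightarrow> Dom C g = B \<longrightarrow>
        (\<exists>!h. h \<in> Hom C (Cod C i) (Cod C f) \<and> h \<cdot>\<^bsub>C\<^esub> i = f \<and> h \<cdot>\<^bsub>C\<^esub> j = g))"

definition is_pullback :: "('o, 'm) cat \<Rightarrow> 'm \<Rightarrow> 'm \<Rightarrow> 'm \<Rightarrow> 'm \<Rightarrow> bool" where
  "is_pullback C f g a b \<longleftrightarrow>
     f \<in> Ar C \<and> g \<in> Ar C \<and> Cod C f = Cod C g \<and>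
     a \<in> Ar C \<and> b \<in> Ar C \<and> Dom C a = Dom C b \<and> Cod C a = Dom C f \<and> Cod C b = Dom C g \<and>
     f \<cdot>\<^bsub>C\<^esub> a = g \<cdot>\<^bsub>C\<^esub> b \<and>
     (\<forall>x \<in> Ar C. \<forall>y \<in> Ar C. Dom C x = Dom C y \<longrightarrow> Cod C x = Dom C f \<longrightarrow> Cod C y = Dom C g \<longrightarrow>
        f \<cdot>\<^bsub>C\<^esub> x = g \<cdot>\<^bsub>C\<^esub> y \<longrightarrow>
        (\<exists>!h. h \<in> Hom C (Dom C x) (Dom C a) \<and> a \<cdot>\<^bsub>C\<^esub> h = x \<and> b \<cdot>\<^bsub>C\<^esub> h = y))"

definition is_coequalizer :: "('o, 'm) cat \<Rightarrow> 'm \<Rightarrow> 'm \<Rightarrow> 'm \<Rightarrow> bool" where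
  "is_coequalizer C a b e \<longleftrightarrow>
     a \<in> Ar C \<and> b \<in> Ar C \<and> Dom C a = Dom C b \<and> Cod C a = Cod C b \<and>
     e \<in> Ar C \<and> Dom C e = Cod C a \<and> e \<cdot>\<^bsub>C\<^esub> a = e \<cdot>\<^bsub>C\<^esub> b \<and>
     (\<forall>f \<in> Ar C. Dom C f = Cod C a \<longrightarrow> f \<cdot>\<^bsub>C\<^esub> a = f \<cdot>\<^bsub>C\<^esub> b \<longrightarrow>
        (\<exists>!h. h \<in> Hom C (Cod C e) (Cod C f) \<and> h \<cdot>\<^bsub>C\<^esub> e = f))"

definition regular_epi :: "('o, 'm) cat \<Rightarrow> 'm \<Rightarrow> bool" where
  "regular_epi C e \<longleftrightarrow> (\<exists>a b. is_coequalizer C a b e)"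

text \<open>The intersection of the kernels of a family of arrows with domain \<open>A\<close>;
  for the empty family this is \<open>A\<close> itself (up to isomorphism).\<close>

definition joint_kernel :: "('o, 'm) cat \<Rightarrow> 'o \<Rightarrow> 'm set \<Rightarrow> 'm \<Rightarrow> bool" where
  "joint_kernel C A F k \<longleftrightarrow>
     k \<in> Ar C \<and> Cod C k = A \<and> (\<forall>f \<in> F. zero_arrow C (f \<cdot>\<^bsub>C\<^esub> k)) \<and>
     (\<forall>g \<in> Ar C. Cod C g = A \<longrightarrow> (\<forall>f \<in> F. zero_arrow C (f \<cdot>\<^bsub>C\<^esub> g)) \<longrightarrow>
        (\<exists>!h. h \<in> Hom C (Dom C g) (Dom C k) \<and> k \<cdot>\<^bsub>C\<^esub> h = g))"

definition is_kernel :: "('o, 'm) cat \<Rightarrow> 'm \<Rightarrow> 'm \<Rightarrow> bool" where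
  "is_kernel C f k \<longleftrightarrow> f \<in> Ar C \<and> joint_kernel C (Dom C f) {f} k"

definition is_cokernel :: "('o, 'm) cat \<Rightarrow> 'm \<Rightarrow> 'm \<Rightarrow> bool" where
  "is_cokernel C f q \<longleftrightarrow>
     f \<in> Ar C \<and> q \<in> Ar C \<and> Dom C q = Cod C f \<and> zero_arrow C (q \<cdot>\<^bsub>C\<^esub> f) \<and>
     (\<forall>g \<in> Ar C. Dom C g = Cod C f \<longrightarrow> zero_arrow C (g \<cdot>\<^bsub>C\<^esub> f) \<longrightarrow>
        (\<exists>!h. h \<in> Hom C (Cod C q) (Cod C g) \<and> h \<cdot>\<^bsub>C\<^esub> q = g))"

definition has_binary_products :: "('o, 'm) cat \<Rightarrow> bool" where
  "has_binary_products C \<longleftrightarrow> (\<forall>A \<in> Ob C. \<forall>B \<in> Ob C. \<exists>p q. is_product C A B p q)"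

definition has_binary_coproducts :: "('o, 'm) cat \<Rightarrow> bool" where
  "has_binary_coproducts C \<longleftrightarrow> (\<forall>A \<in> Ob C. \<forall>B \<in> Ob C. \<exists>i j. is_coproduct C A B i j)"

text \<open>Finite limits, given by a terminal object and pullbacks.\<close>

definition has_finite_limits :: "('o, 'm) cat \<Rightarrow> bool" where
  "has_finite_limits C \<longleftrightarrow> (\<exists>Z. terminal C Z) \<and>
     (\<forall>f \<in> Ar C. \<forall>g \<in> Ar C. Cod C f = Cod C g \<longrightarrow> (\<exists>a b. is_pullback C f g a b))"

definition projective :: "('o, 'm) cat \<Rightarrow> 'o \<Rightarrow> bool" where
  "projective C P \<longleftrightarrow> P \<in> Ob C \<and>
     (\<forall>e f. regular_epi C e \<longrightarrow> f \<in> Hom C P (Cod C e) \<longrightarrow>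
        (\<exists>g \<in> Hom C P (Dom C e). e \<cdot>\<^bsub>C\<^esub> g = f))"


section \<open>Semiabelian and abelian categories\<close>

definition regular_category :: "('o, 'm) cat \<Rightarrow> bool" where
  "regular_category C \<longleftrightarrow> category C \<and> has_finite_limits C \<and>
     (\<forall>f r s. is_pullback C f f r s \<longrightarrow> (\<exists>e. is_coequalizer C r s e)) \<and>
     (\<forall>f e a b. is_pullback C f e a b \<longrightarrow> regular_epi C e \<longrightarrow> regular_epi C a)"

text \<open>An internal equivalence relation on the common codomain of \<open>r\<close> and \<open>s\<close>.\<close>

definition equivalence_relation :: "('o, 'm) cat \<Rightarrow> 'm \<Rightarrow> 'm \<Rightarrow> bool" where
  "equivalence_relation C r s \<longleftrightarrow>
     r \<in> Ar C \<and> s \<in> Ar C \<and> Dom C r = Dom C s \<and> Cod C r = Cod C s \<and>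
     (\<forall>a \<in> Ar C. \<forall>b \<in> Ar C. Cod C a = Dom C r \<longrightarrow> Cod C b = Dom C r \<longrightarrow> Dom C a = Dom C b \<longrightarrow>
        r \<cdot>\<^bsub>C\<^esub> a = r \<cdot>\<^bsub>C\<^esub> b \<longrightarrow> s \<cdot>\<^bsub>C\<^esub> a = s \<cdot>\<^bsub>C\<^esub> b \<longrightarrow> a = b) \<and>
     (\<exists>d \<in> Hom C (Cod C r) (Dom C r).
        r \<cdot>\<^bsub>C\<^esub> d = Idt C (Cod C r) \<and> s \<cdot>\<^bsub>C\<^esub> d = Idt C (Cod C r)) \<and>
     (\<exists>t \<in> Hom C (Dom C r) (Dom C r). r \<cdot>\<^bsub>C\<^esub> t = s \<and> s \<cdot>\<^bsub>C\<^esub> t = r) \<and>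
     (\<forall>x y. is_pullback C s r x y \<longrightarrow>
        (\<exists>t \<in> Hom C (Dom C x) (Dom C r). r \<cdot>\<^bsub>C\<^esub> t = r \<cdot>\<^bsub>C\<^esub> x \<and> s \<cdot>\<^bsub>C\<^esub> t = s \<cdot>\<^bsub>C\<^esub> y))"

definition Barr_exact :: "('o, 'm) cat \<Rightarrow> bool" where
  "Barr_exact C \<longleftrightarrow> regular_category C \<and>
     (\<forall>r s. equivalence_relation C r s \<longrightarrow> (\<exists>f. is_pullback C f f r s))"

text \<open>A point over \<open>B\<close> is a split epimorphism with codomain \<open>B\<close> together with a chosen splitting.\<close>

definition is_point :: "('o, 'm) cat \<Rightarrow> 'm \<Rightarrow> 'm \<Rightarrow> bool" where
  "is_point C p s \<longleftrightarrow> p \<in> Ar C \<and> s \<in> Hom C (Cod C p) (Dom C p) \<and> p \<cdot>\<^bsub>C\<^esub> s = Idt C (Cod C p)"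

text \<open>The change-of-base functor along every \<open>v\<close>, from points over \<open>Cod v\<close> to points over
  \<open>Dom v\<close>, reflects isomorphisms; \<open>c\<close> is the pullback along \<open>v\<close> of the morphism of
  points \<open>h\<close>.\<close>

definition protomodular :: "('o, 'm) cat \<Rightarrow> bool" where
  "protomodular C \<longleftrightarrow>
     (\<forall>v p s p' s' h a b a' b' c.
        is_point C p s \<longrightarrow> is_point C p' s' \<longrightarrow> Cod C p = Cod C p' \<longrightarrow>
        h \<in> Hom C (Dom C p) (Dom C p') \<longrightarrow> p' \<cdot>\<^bsub>C\<^esub> h = p \<longrightarrow> h \<cdot>\<^bsub>C\<^esub> s = s' \<longrightarrow>
        is_pullback C p v a b \<longrightarrow> is_pullback C p' v a' b' \<longrightarrow>
        c \<in> Hom C (Dom C a) (Dom C a') \<longrightarrow> a' \<cdot>\<^bsub>C\<^esub> c = h \<cdot>\<^bsub>C\<^esub> a \<longrightarrow> b' \<cdot>\<^bsub>C\<^esub> c = b \<longrightarrow>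
        is_iso C c \<longrightarrow> is_iso C h)"

definition semiabelian :: "('o, 'm) cat \<Rightarrow> bool" where
  "semiabelian C \<longleftrightarrow> pointed C \<and> Barr_exact C \<and> protomodular C \<and> has_binary_coproducts C"

definition abelian_category :: "('o, 'm) cat \<Rightarrow> bool" where
  "abelian_category C \<longleftrightarrow> category C \<and> pointed C \<and>
     has_binary_products C \<and> has_binary_coproducts C \<and>
     (\<forall>f \<in> Ar C. \<exists>k. is_kernel C f k) \<and> (\<forall>f \<in> Ar C. \<exists>q. is_cokernel C f q) \<and>
     (\<forall>m. monic C m \<longrightarrow> (\<exists>f. is_kernel C f m)) \<and>
     (\<forall>e. epic C e \<longrightarrow> (\<exists>f. is_cokernel C f e))"


section \<open>Exact sequences\<close>

definition is_image :: "('o, 'm) cat \<Rightarrow> 'm \<Rightarrow> 'm \<Rightarrow> bool" where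
  "is_image C u m \<longleftrightarrow> monic C m \<and>
     (\<exists>e. regular_epi C e \<and> Cod C e = Dom C m \<and> u = m \<cdot>\<^bsub>C\<^esub> e)"

definition exact_at :: "('o, 'm) cat \<Rightarrow> 'm \<Rightarrow> 'm \<Rightarrow> bool" where
  "exact_at C u v \<longleftrightarrow> u \<in> Ar C \<and> v \<in> Ar C \<and> Cod C u = Dom C v \<and>
     (\<exists>m. is_image C u m \<and> is_kernel C v m)"

text \<open>Exactness of \<open>U \<rightarrow> X \<rightarrow> Y \<rightarrow> 0\<close>.\<close>

definition right_exact_sequence :: "('o, 'm) cat \<Rightarrow> 'm \<Rightarrow> 'm \<Rightarrow> bool" where
  "right_exact_sequence C u v \<longleftrightarrow> exact_at C u v \<and>
     (\<exists>Z z. zero_object C Z \<and> z \<in> Hom C (Cod C v) Z \<and> exact_at C v z)"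

definition sequentially_right_exact ::
  "('o, 'm) cat \<Rightarrow> ('p, 'q) cat \<Rightarrow> ('o, 'm, 'p, 'q) ftor \<Rightarrow> bool" where
  "sequentially_right_exact C D F \<longleftrightarrow> is_functor C D F \<and>
     (\<forall>u v. right_exact_sequence C u v \<longrightarrow> right_exact_sequence D (FAr F u) (FAr F v))"


section \<open>The abelian core and reflective subcategories\<close>

text \<open>An internal abelian group structure on \<open>A\<close>, where \<open>p\<close> and \<open>q\<close> are the projections of a
  product \<open>A \<times> A\<close>, \<open>m\<close> is the multiplication, \<open>e\<close> the unit (with domain a terminal object)
  and \<open>i\<close> the inversion. In the associativity axiom, \<open>r\<close> and \<open>x\<close> are the projections of a product
  \<open>(A \<times> A) \<times> A\<close>.\<close>

definition internal_abelian_group ::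
  "('o, 'm) cat \<Rightarrow> 'o \<Rightarrow> 'm \<times> 'm \<times> 'm \<times> 'm \<times> 'm \<Rightarrow> bool" where
  "internal_abelian_group C A = (\<lambda>(p, q, m, e, i).
     is_product C A A p q \<and> m \<in> Hom C (Dom C p) A \<and>
     e \<in> Ar C \<and> terminal C (Dom C e) \<and> Cod C e = A \<and> i \<in> Hom C A A \<and>
     (\<forall>r x. is_product C (Dom C p) A r x \<longrightarrow>
        m \<cdot>\<^bsub>C\<^esub> pairing C p q (m \<cdot>\<^bsub>C\<^esub> r) x =
        m \<cdot>\<^bsub>C\<^esub> pairing C p q (p \<cdot>\<^bsub>C\<^esub> r) (m \<cdot>\<^bsub>C\<^esub> pairing C p q (q \<cdot>\<^bsub>C\<^esub> r) x)) \<and>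
     (\<forall>t \<in> Hom C A (Dom C e).
        m \<cdot>\<^bsub>C\<^esub> pairing C p q (e \<cdot>\<^bsub>C\<^esub> t) (Idt C A) = Idt C A \<and>
        m \<cdot>\<^bsub>C\<^esub> pairing C p q i (Idt C A) = e \<cdot>\<^bsub>C\<^esub> t) \<and>
     m \<cdot>\<^bsub>C\<^esub> pairing C p q q p = m)"

definition abelian_core :: "('o, 'm) cat \<Rightarrow> 'o set" where
  "abelian_core C = {A \<in> Ob C. \<exists>G. internal_abelian_group C A G}"

definition replete :: "('o, 'm) cat \<Rightarrow> 'o set \<Rightarrow> bool" where
  "replete C R \<longleftrightarrow> (\<forall>f. is_iso C f \<longrightarrow> Dom C f \<in> R \<longrightarrow> Cod C f \<in> R)"

text \<open>\<open>T\<close> is left adjoint to the inclusion of the full subcategory on \<open>R\<close>; \<open>\<eta>\<close> is the unit.\<close>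

definition reflector :: "('o, 'm) cat \<Rightarrow> 'o set \<Rightarrow> ('o, 'm, 'o, 'm) ftor \<Rightarrow> bool" where
  "reflector C R T \<longleftrightarrow> is_functor C (full_subcategory C R) T \<and>
     (\<exists>\<eta>. (\<forall>A \<in> Ob C. \<eta> A \<in> Hom C A (FOb T A)) \<and>
        (\<forall>f \<in> Ar C. \<eta> (Cod C f) \<cdot>\<^bsub>C\<^esub> f = FAr T f \<cdot>\<^bsub>C\<^esub> \<eta> (Dom C f)) \<and>
        (\<forall>A \<in> Ob C. \<forall>M \<in> R. \<forall>f \<in> Hom C A M.
           \<exists>!g. g \<in> Hom C (FOb T A) M \<and> g \<cdot>\<^bsub>C\<^esub> \<eta> A = f))"


section \<open>Simplicial objects and projective resolutions\<close>

text \<open>\<open>face S n i\<close> is the face \<open>S\<^sub>n\<^sub>+\<^sub>1 \<rightarrow> S\<^sub>n\<close> for \<open>i \<le> n + 1\<close> and \<open>degen S n i\<close> is the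
  degeneracy \<open>S\<^sub>n \<rightarrow> S\<^sub>n\<^sub>+\<^sub>1\<close> for \<open>i \<le> n\<close>.\<close>

record ('o, 'm) simplicial =
  sob :: "nat \<Rightarrow> 'o"
  face :: "nat \<Rightarrow> nat \<Rightarrow> 'm"
  degen :: "nat \<Rightarrow> nat \<Rightarrow> 'm"

record ('o, 'm) aug_simplicial = "('o, 'm) simplicial" +
  aug :: 'm

definition simplicial_object :: "('o, 'm) cat \<Rightarrow> ('o, 'm, 'z) simplicial_scheme \<Rightarrow> bool" where
  "simplicial_object C S \<longleftrightarrow>
     (\<forall>n. sob S n \<in> Ob C) \<and>
     (\<forall>n. \<forall>i \<le> Suc n. face S n i \<in> Hom C (sob S (Suc n)) (sob S n)) \<and>
     (\<forall>n. \<forall>i \<le> n. degen S n i \<in> Hom C (sob S n) (sob S (Suc n))) \<and>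
     (\<forall>n i j. i < j \<longrightarrow> j \<le> n + 2 \<longrightarrow>
        face S n i \<cdot>\<^bsub>C\<^esub> face S (Suc n) j = face S n (j - 1) \<cdot>\<^bsub>C\<^esub> face S (Suc n) i) \<and>
     (\<forall>n i j. i \<le> j \<longrightarrow> j \<le> n \<longrightarrow>
        degen S (Suc n) i \<cdot>\<^bsub>C\<^esub> degen S n j = degen S (Suc n) (Suc j) \<cdot>\<^bsub>C\<^esub> degen S n i) \<and>
     (\<forall>n i j. i < j \<longrightarrow> j \<le> Suc n \<longrightarrow>
        face S (Suc n) i \<cdot>\<^bsub>C\<^esub> degen S (Suc n) j = degen S n (j - 1) \<cdot>\<^bsub>C\<^esub> face S n i) \<and>
     (\<forall>n j. j \<le> n \<longrightarrow>
        face S n j \<cdot>\<^bsub>C\<^esub> degen S n j = Idt C (sob S n) \<and>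
        face S n (Suc j) \<cdot>\<^bsub>C\<^esub> degen S n j = Idt C (sob S n)) \<and>
     (\<forall>n i j. Suc j < i \<longrightarrow> i \<le> n + 2 \<longrightarrow>
        face S (Suc n) i \<cdot>\<^bsub>C\<^esub> degen S (Suc n) j = degen S n j \<cdot>\<^bsub>C\<^esub> face S n (i - 1))"

definition aug_simplicial_object ::
  "('o, 'm) cat \<Rightarrow> ('o, 'm) aug_simplicial \<Rightarrow> 'o \<Rightarrow> bool" where
  "aug_simplicial_object C P X \<longleftrightarrow> simplicial_object C P \<and>
     aug P \<in> Hom C (sob P 0) X \<and> aug P \<cdot>\<^bsub>C\<^esub> face P 0 0 = aug P \<cdot>\<^bsub>C\<^esub> face P 0 1"

definition map_simplicial ::
  "('o, 'm, 'p, 'q) ftor \<Rightarrow> ('o, 'm, 'z) simplicial_scheme \<Rightarrow> ('p, 'q) simplicial" where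
  "map_simplicial F S =
     \<lparr>sob = (\<lambda>n. FOb F (sob S n)), face = (\<lambda>n i. FAr F (face S n i)),
      degen = (\<lambda>n i. FAr F (degen S n i))\<rparr>"

text \<open>\<open>k 0, \<dots>, k (n + 1)\<close> is the simplicial kernel of the parallel arrows \<open>f 0, \<dots>, f n\<close>
  from \<open>A\<close> to \<open>B\<close>.\<close>

definition simplicial_kernel ::
  "('o, 'm) cat \<Rightarrow> nat \<Rightarrow> 'o \<Rightarrow> (nat \<Rightarrow> 'm) \<Rightarrow> 'o \<Rightarrow> (nat \<Rightarrow> 'm) \<Rightarrow> bool" where
  "simplicial_kernel C n A f K k \<longleftrightarrow> K \<in> Ob C \<and>
     (\<forall>j \<le> Suc n. k j \<in> Hom C K A) \<and>
     (\<forall>i j. i < j \<longrightarrow> j \<le> Suc n \<longrightarrow> f i \<cdot>\<^bsub>C\<^esub> k j = f (j - 1) \<cdot>\<^bsub>C\<^esub> k i) \<and>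
     (\<forall>Y \<in> Ob C. \<forall>y. (\<forall>j \<le> Suc n. y j \<in> Hom C Y A) \<longrightarrow>
        (\<forall>i j. i < j \<longrightarrow> j \<le> Suc n \<longrightarrow> f i \<cdot>\<^bsub>C\<^esub> y j = f (j - 1) \<cdot>\<^bsub>C\<^esub> y i) \<longrightarrow>
        (\<exists>!h. h \<in> Hom C Y K \<and> (\<forall>j \<le> Suc n. k j \<cdot>\<^bsub>C\<^esub> h = y j)))"

text \<open>The faces of \<open>P\<^sub>n\<close>, the only face of \<open>P\<^sub>0\<close> being the augmentation.\<close>

definition aug_face :: "('o, 'm) aug_simplicial \<Rightarrow> nat \<Rightarrow> nat \<Rightarrow> 'm" where
  "aug_face P n i = (case n of 0 \<Rightarrow> aug P | Suc m \<Rightarrow> face P m i)"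

definition simplicial_projective_resolution ::
  "('o, 'm) cat \<Rightarrow> ('o, 'm) aug_simplicial \<Rightarrow> 'o \<Rightarrow> bool" where
  "simplicial_projective_resolution C P X \<longleftrightarrow>
     aug_simplicial_object C P X \<and> (\<forall>n. projective C (sob P n)) \<and> regular_epi C (aug P) \<and>
     (\<forall>n. \<exists>K k c. simplicial_kernel C n (sob P n) (aug_face P n) K k \<and>
        c \<in> Hom C (sob P (Suc n)) K \<and> (\<forall>i \<le> Suc n. k i \<cdot>\<^bsub>C\<^esub> c = face P n i) \<and>
        regular_epi C c)"


section \<open>Moore homology and derived functors\<close>

text \<open>The inclusion of \<open>N\<^sub>n S\<close>, the intersection of the kernels of all faces of \<open>S\<^sub>n\<close> except the last
  one, into \<open>S\<^sub>n\<close>. Kernels, cokernels and zero objects are chosen arbitrarily.\<close>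

definition moore_incl :: "('o, 'm) cat \<Rightarrow> ('o, 'm) simplicial \<Rightarrow> nat \<Rightarrow> 'm" where
  "moore_incl C S n = (SOME k. joint_kernel C (sob S n) (face S (n - 1) ` {..<n}) k)"

definition moore_ob :: "('o, 'm) cat \<Rightarrow> ('o, 'm) simplicial \<Rightarrow> nat \<Rightarrow> 'o" where
  "moore_ob C S n = Dom C (moore_incl C S n)"

text \<open>The differential on \<open>N\<^sub>n S\<close>: for \<open>n > 0\<close> it is induced by the last face, and for \<open>n = 0\<close> it is
  the arrow to a zero object.\<close>

primrec moore_diff :: "('o, 'm) cat \<Rightarrow> ('o, 'm) simplicial \<Rightarrow> nat \<Rightarrow> 'm" where
  "moore_diff C S 0 =
     (SOME z. z \<in> Ar C \<and> Dom C z = moore_ob C S 0 \<and> zero_object C (Cod C z))"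
| "moore_diff C S (Suc n) =
     (THE d. d \<in> Hom C (moore_ob C S (Suc n)) (moore_ob C S n) \<and>
        moore_incl C S n \<cdot>\<^bsub>C\<^esub> d = face S n (Suc n) \<cdot>\<^bsub>C\<^esub> moore_incl C S (Suc n))"

definition moore_cycles :: "('o, 'm) cat \<Rightarrow> ('o, 'm) simplicial \<Rightarrow> nat \<Rightarrow> 'm" where
  "moore_cycles C S n = (SOME k. is_kernel C (moore_diff C S n) k)"

definition moore_boundary :: "('o, 'm) cat \<Rightarrow> ('o, 'm) simplicial \<Rightarrow> nat \<Rightarrow> 'm" where
  "moore_boundary C S n =
     (THE b. b \<in> Hom C (moore_ob C S (Suc n)) (Dom C (moore_cycles C S n)) \<and>
        moore_cycles C S n \<cdot>\<^bsub>C\<^esub> b = moore_diff C S (Suc n))"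

definition moore_homology :: "('o, 'm) cat \<Rightarrow> nat \<Rightarrow> ('o, 'm) simplicial \<Rightarrow> 'o" where
  "moore_homology C n S = Cod C (SOME q. is_cokernel C (moore_boundary C S n) q)"

text \<open>\<open>L\<^sub>n T(X)\<close>, for a functor \<open>T\<close> with target \<open>D\<close>, computed from a resolution \<open>P\<close> of \<open>X\<close>.\<close>

definition left_derived ::
  "('p, 'q) cat \<Rightarrow> ('o, 'm, 'p, 'q) ftor \<Rightarrow> nat \<Rightarrow> ('o, 'm) aug_simplicial \<Rightarrow> 'p" where
  "left_derived D T n P = moore_homology D n (map_simplicial T P)"


section \<open>Cohomology\<close>

text \<open>The abelian group of arrows from \<open>Y\<close> to an object \<open>A\<close> of the abelian core.\<close>

definition hom_group :: "('o, 'm) cat \<Rightarrow> 'o \<Rightarrow> 'o \<Rightarrow> 'm monoid" where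
  "hom_group C Y A =
     (case (SOME G. internal_abelian_group C A G) of (p, q, m, e, i) \<Rightarrow>
        \<lparr>carrier = Hom C Y A,
         mult = (\<lambda>f g. m \<cdot>\<^bsub>C\<^esub> pairing C p q f g),
         one = e \<cdot>\<^bsub>C\<^esub> (THE t. t \<in> Hom C Y (Dom C e))\<rparr>)"

text \<open>The alternating sum of the cofaces of the cosimplicial abelian group \<open>Hom(P, A)\<close>, written
  multiplicatively.\<close>

definition coboundary ::
  "('o, 'm) cat \<Rightarrow> ('o, 'm) aug_simplicial \<Rightarrow> 'o \<Rightarrow> nat \<Rightarrow> 'm \<Rightarrow> 'm" where
  "coboundary C P A n f =
     (let G = hom_group C (sob P (Suc n)) A in
      finprod G (\<lambda>i. (f \<cdot>\<^bsub>C\<^esub> face P n i) [^]\<^bsub>G\<^esub> ((-1) ^ i :: int)) {..Suc n})"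

definition cocycles :: "('o, 'm) cat \<Rightarrow> ('o, 'm) aug_simplicial \<Rightarrow> 'o \<Rightarrow> nat \<Rightarrow> 'm set" where
  "cocycles C P A n =
     kernel (hom_group C (sob P n) A) (hom_group C (sob P (Suc n)) A) (coboundary C P A n)"

definition coboundaries :: "('o, 'm) cat \<Rightarrow> ('o, 'm) aug_simplicial \<Rightarrow> 'o \<Rightarrow> nat \<Rightarrow> 'm set" where
  "coboundaries C P A n =
     (case n of
        0 \<Rightarrow> {\<one>\<^bsub>hom_group C (sob P 0) A\<^esub>}
      | Suc k \<Rightarrow> coboundary C P A k ` carrier (hom_group C (sob P k) A))"

text \<open>\<open>Ext\<^sup>n(X, A)\<close>, computed from a resolution \<open>P\<close> of \<open>X\<close>.\<close>

definition Ext_group ::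
  "('o, 'm) cat \<Rightarrow> nat \<Rightarrow> ('o, 'm) aug_simplicial \<Rightarrow> 'o \<Rightarrow> 'm set monoid" where
  "Ext_group C n P A =
     (hom_group C (sob P n) A)\<lparr>carrier := cocycles C P A n\<rparr> Mod coboundaries C P A n"


section \<open>Varieties of universal algebras\<close>

text \<open>The operation symbols are all elements of the type \<open>'f\<close>.\<close>

datatype 'f trm = Var nat | App 'f "'f trm list"

primrec wf_trm :: "('f \<Rightarrow> nat) \<Rightarrow> 'f trm \<Rightarrow> bool" where
  "wf_trm ar (Var x) \<longleftrightarrow> True"
| "wf_trm ar (App g ts) \<longleftrightarrow> length ts = ar g \<and> list_all (wf_trm ar) ts"

text \<open>Algebras have a subset of \<open>'u\<close> as their carrier. The values of the interpretation outside of
  the carrier, or on lists whose length is not the arity, are irrelevant.\<close>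

record ('f, 'u) algebra = "'u partial_object" +
  interp :: "'f \<Rightarrow> 'u list \<Rightarrow> 'u"

primrec trm_eval :: "('f, 'u) algebra \<Rightarrow> (nat \<Rightarrow> 'u) \<Rightarrow> 'f trm \<Rightarrow> 'u" where
  "trm_eval A v (Var x) = v x"
| "trm_eval A v (App g ts) = interp A g (map (trm_eval A v) ts)"

definition is_algebra :: "('f \<Rightarrow> nat) \<Rightarrow> ('f, 'u) algebra \<Rightarrow> bool" where
  "is_algebra ar A \<longleftrightarrow>
     (\<forall>g xs. xs \<in> lists (carrier A) \<longrightarrow> length xs = ar g \<longrightarrow> interp A g xs \<in> carrier A)"

definition satisfies :: "('f, 'u) algebra \<Rightarrow> 'f trm \<times> 'f trm \<Rightarrow> bool" where
  "satisfies A = (\<lambda>(s, t). \<forall>v. range v \<subseteq> carrier A \<longrightarrow> trm_eval A v s = trm_eval A v t)"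

definition algebra_hom ::
  "('f \<Rightarrow> nat) \<Rightarrow> ('f, 'u) algebra \<Rightarrow> ('f, 'u) algebra \<Rightarrow> ('u \<Rightarrow> 'u) set" where
  "algebra_hom ar A B = {\<phi> \<in> carrier A \<rightarrow>\<^sub>E carrier B.
     \<forall>g xs. xs \<in> lists (carrier A) \<longrightarrow> length xs = ar g \<longrightarrow>
       \<phi> (interp A g xs) = interp B g (map \<phi> xs)}"

text \<open>A family of small sets, large enough for small algebras with operation symbols \<open>F\<close> to be closed
  under the usual constructions (finite limits, quotients, coproducts, free algebras).
  The family of all subsets of an infinite type is an example if it is at least as large
  as \<open>F\<close>, and so are the sets of a Grothendieck universe that has \<open>F\<close> and an infinite set as
  members, provided that they are coded as subsets of one type.\<close>

definition universe :: "'u set set \<Rightarrow> 'f set \<Rightarrow> bool" where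
  "universe \<U> F \<longleftrightarrow>
     (\<exists>A \<in> \<U>. infinite A \<and> F \<lesssim> A) \<and>
     (\<forall>A \<in> \<U>. \<forall>B. B \<lesssim> A \<longrightarrow> B \<in> \<U>) \<and>
     (\<forall>A \<in> \<U>. \<forall>B \<in> \<U>. \<exists>D \<in> \<U>. A \<times> B \<lesssim> D)"

text \<open>The category of all small algebras satisfying the equations in \<open>E\<close>, with all homomorphisms.\<close>

definition variety ::
  "'u set set \<Rightarrow> ('f \<Rightarrow> nat) \<Rightarrow> ('f trm \<times> 'f trm) set \<Rightarrow>
   (('f, 'u) algebra, ('f, 'u) algebra \<times> ('u \<Rightarrow> 'u) \<times> ('f, 'u) algebra) cat" where
  "variety \<U> ar E =
     (let Obs = {A. carrier A \<in> \<U> \<and> is_algebra ar A \<and> (\<forall>eq \<in> E. satisfies A eq)} in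
      \<lparr>Ob = Obs,
       Ar = {(A, \<phi>, B). A \<in> Obs \<and> B \<in> Obs \<and> \<phi> \<in> algebra_hom ar A B},
       Dom = (\<lambda>(A, \<phi>, B). A),
       Cod = (\<lambda>(A, \<phi>, B). B),
       Idt = (\<lambda>A. (A, restrict (\<lambda>x. x) (carrier A), A)),
       Cmp = (\<lambda>(B', \<psi>, D) (A, \<phi>, B). (A, compose (carrier A) \<psi> \<phi>, D))\<rparr>)"

end

theory Submission
  imports Defs
begin

text \<open>Let \<open>C\<^sub>k = T(P\<^sub>k)\<close>, a simplicial object of \<open>R\<close>. By protomodularity every arrow between objects
  of the abelian core is a homomorphism, so the given group structures make \<open>R\<close> an additive
  category; the reflection identifies \<open>Hom(P\<^sub>k, M)\<close> with \<open>Hom(C\<^sub>k, M)\<close> for \<open>M\<close> in \<open>R\<close>; and \<open>C\<^sub>k\<close> is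
  projective in \<open>R\<close>, since the inclusion of \<open>R\<close>, being sequentially right exact, takes epimorphisms
  to regular epimorphisms up to isomorphism. Both conditions of the theorem are then equivalent to
  the existence of a contraction of the unnormalized complex of \<open>C\<close> in degrees \<open>\<le> n\<close>. The passage
  to the Moore complex is made on generalized elements: \<open>y \<mapsto> y - s\<^sub>j d\<^sub>j y\<close> for \<open>j = 0, 1, \<dots>\<close> moves a
  chain into it. From the cohomology side, one tests against \<open>M = coker(C\<^sub>k\<^sub>+\<^sub>1 \<rightarrow> C\<^sub>k)\<close>.\<close>


section \<open>Alternating sums in abelian groups\<close>

text \<open>The obstacle is projectivity. A generalized element with domain \<open>Q\<close> lifts
  along an epimorphism only if \<open>Q\<close> is projective, whereas the vanishing of Moore
  homology must be tested at the object of Moore cycles, which has no reason to be projective. A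
  contraction bridges this gap: constructing it requires exactness only at the projective test
  objects \<open>C\<^sub>k\<close>, yet once it exists it solves the lifting problem for every
  \<open>Q\<close> and, composed on the other side, the extension problem for every
  \<open>M\<close>. It is built degree by degree, so it can be truncated at \<open>n\<close>. The
  two sides of the equivalence are also defined by different complexes: \<open>coboundary\<close>
  uses the alternating sum of all cofaces, derived functors use joint kernels of faces. The
  unnormalized complex is taken as the common ground, because composition with any arrow respects
  its differential. Groups of arrows are written multiplicatively and signs are exponents, so that
  \<open>altsum\<close> has literally the shape of the product in \<open>coboundary\<close>.\<close>

definition altsum :: "('a, 'b) monoid_scheme \<Rightarrow> (nat \<Rightarrow> 'a) \<Rightarrow> nat \<Rightarrow> 'a" where
  "altsum G a n = finprod G (\<lambda>i. a i [^]\<^bsub>G\<^esub> ((-1) ^ i :: int)) {..n}"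

context comm_group
begin

lemma altsum_0:
  assumes "a 0 \<in> carrier G"
  shows "altsum G a 0 = a 0"
  using assms by (simp add: altsum_def)

lemma altsum_Suc:
  assumes "\<And>i. i \<le> Suc n \<Longrightarrow> a i \<in> carrier G"
  shows "altsum G a (Suc n) = altsum G a n \<otimes> a (Suc n) [^] ((-1) ^ Suc n :: int)"
proof -
  have "altsum G a (Suc n) = a (Suc n) [^] ((-1) ^ Suc n :: int) \<otimes> altsum G a n"
    unfolding altsum_def using assms by (subst finprod_Suc) auto
  then show ?thesis
    using assms by (simp add: altsum_def m_comm)
qed

lemma altsum_closed:
  assumes "\<And>i. i \<le> n \<Longrightarrow> a i \<in> carrier G"
  shows "altsum G a n \<in> carrier G"
  unfolding altsum_def using assms by (intro finprod_closed) auto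

lemma altsum_cong:
  assumes "\<And>i. i \<le> n \<Longrightarrow> a i = b i" and "\<And>i. i \<le> n \<Longrightarrow> b i \<in> carrier G"
  shows "altsum G a n = altsum G b n"
  unfolding altsum_def using assms by (intro finprod_cong') auto

lemma altsum_one:
  assumes "\<And>i. i \<le> n \<Longrightarrow> a i = \<one>"
  shows "altsum G a n = \<one>"
  unfolding altsum_def using assms by (intro finprod_one_eqI) (simp add: int_pow_one)

lemma altsum_mult:
  assumes "\<And>i. i \<le> n \<Longrightarrow> a i \<in> carrier G" "\<And>i. i \<le> n \<Longrightarrow> b i \<in> carrier G"
  shows "altsum G (\<lambda>i. a i \<otimes> b i) n = altsum G a n \<otimes> altsum G b n"
proof -
  have "altsum G (\<lambda>i. a i \<otimes> b i) n =
      finprod G (\<lambda>i. a i [^] ((-1) ^ i :: int) \<otimes> b i [^] ((-1) ^ i :: int)) {..n}"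
    unfolding altsum_def using assms by (intro finprod_cong') (auto simp: int_pow_distrib)
  also have "\<dots> = altsum G a n \<otimes> altsum G b n"
    unfolding altsum_def using assms by (intro finprod_multf) auto
  finally show ?thesis .
qed

text \<open>Composition with a fixed arrow, on either side, is such an \<open>h\<close>; this is how
  alternating sums of faces are evaluated on generalized elements.\<close>

lemma hom_altsum:
  assumes h: "h \<in> hom G K" and K: "comm_group K" and a: "\<And>i. i \<le> n \<Longrightarrow> a i \<in> carrier G"
  shows "h (altsum G a n) = altsum K (\<lambda>i. h (a i)) n"
proof -
  interpret K: comm_group K by (rule K)
  interpret h: group_hom G K h by unfold_locales (rule h)
  show ?thesis
    using a
  proof (induction n)
    case 0
    then show ?case by (simp add: altsum_0 K.altsum_0)
  next
    case (Suc n)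
    have "h (altsum G a (Suc n)) =
        h (altsum G a n) \<otimes>\<^bsub>K\<^esub> h (a (Suc n)) [^]\<^bsub>K\<^esub> ((-1) ^ Suc n :: int)"
      using Suc.prems by (simp add: altsum_Suc altsum_closed h.hom_int_pow del: power_Suc)
    also have "\<dots> = altsum K (\<lambda>i. h (a i)) (Suc n)"
      using Suc by (simp add: K.altsum_Suc del: power_Suc)
    finally show ?case .
  qed
qed

lemma altsum_int_pow:
  assumes "\<And>i. i \<le> n \<Longrightarrow> a i \<in> carrier G"
  shows "altsum G (\<lambda>i. a i [^] (c :: int)) n = altsum G a n [^] c"
proof -
  have "(\<lambda>x. x [^] c) \<in> hom G G"
    by (rule homI) (auto simp: int_pow_distrib)
  from hom_altsum[OF this comm_group_axioms, of n a] assms show ?thesis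
    by simp
qed

lemma sign_cancel:
  assumes "x \<in> carrier G"
  shows "x [^] ((-1) ^ n :: int) \<otimes> x [^] ((-1) ^ Suc n :: int) = \<one>"
  using assms by (simp add: int_pow_neg)

text \<open>This is \<open>d d = 0\<close>, with \<open>g i j\<close> standing for
  \<open>d\<^sub>i d\<^sub>j\<close>. Passing from \<open>n\<close> to \<open>Suc n\<close> adds the
  column \<open>n + 2\<close> and the row \<open>n + 1\<close>. By the symmetry, the new column over
  the rows up to \<open>n\<close> repeats the first \<open>n + 1\<close> entries of the new row with
  opposite signs, and the last two entries of that row are equal and cancel.\<close>

lemma altsum_altsum:
  assumes "\<And>i j. i \<le> n \<Longrightarrow> j \<le> Suc n \<Longrightarrow> g i j \<in> carrier G"
    and "\<And>i j. i < j \<Longrightarrow> j \<le> Suc n \<Longrightarrow> g i j = g (j - 1) i"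
  shows "altsum G (\<lambda>i. altsum G (g i) (Suc n)) n = \<one>"
  using assms
proof (induction n)
  case 0
  then show ?case
    using sign_cancel[of "g 0 0" 0] by (simp add: altsum_0 altsum_Suc altsum_closed)
next
  case (Suc n)
  let ?s = "\<lambda>i. (-1) ^ i :: int"
  let ?A = "altsum G (g (Suc n)) n"
  have A: "?A \<in> carrier G"
    using Suc.prems(1) by (intro altsum_closed) auto
  have IH: "altsum G (\<lambda>i. altsum G (g i) (Suc n)) n = \<one>"
    using Suc.prems by (intro Suc.IH) auto
  have "altsum G (\<lambda>i. altsum G (g i) (Suc (Suc n))) (Suc n) =
      altsum G (\<lambda>i. altsum G (g i) (Suc (Suc n))) n \<otimes>
      altsum G (g (Suc n)) (Suc (Suc n)) [^] ?s (Suc n)"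
    using Suc.prems(1) by (intro altsum_Suc altsum_closed)
  also have "altsum G (\<lambda>i. altsum G (g i) (Suc (Suc n))) n =
      altsum G (\<lambda>i. altsum G (g i) (Suc n) \<otimes> g i (Suc (Suc n)) [^] ?s (Suc (Suc n))) n"
    using Suc.prems(1) by (intro altsum_cong altsum_Suc m_closed int_pow_closed altsum_closed) auto
  also have "\<dots> = altsum G (\<lambda>i. altsum G (g i) (Suc n)) n \<otimes>
      altsum G (\<lambda>i. g i (Suc (Suc n)) [^] ?s (Suc (Suc n))) n"
    using Suc.prems(1) by (intro altsum_mult altsum_closed int_pow_closed) auto
  also have "\<dots> = altsum G (\<lambda>i. g i (Suc (Suc n)) [^] ?s (Suc (Suc n))) n"
    using Suc.prems(1) by (simp add: IH altsum_closed del: power_Suc)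
  also have "\<dots> = altsum G (\<lambda>i. g i (Suc (Suc n))) n [^] ?s (Suc (Suc n))"
    using Suc.prems(1) by (intro altsum_int_pow) auto
  also have "altsum G (\<lambda>i. g i (Suc (Suc n))) n = ?A"
    using Suc.prems by (intro altsum_cong) auto
  also have "altsum G (g (Suc n)) (Suc (Suc n)) =
      ?A \<otimes> g (Suc n) (Suc n) [^] ?s (Suc n) \<otimes> g (Suc n) (Suc (Suc n)) [^] ?s (Suc (Suc n))"
    using Suc.prems(1) by (simp add: altsum_Suc del: power_Suc)
  also have "g (Suc n) (Suc (Suc n)) = g (Suc n) (Suc n)"
    using Suc.prems(2)[of "Suc n" "Suc (Suc n)"] by simp
  also have "?A \<otimes> g (Suc n) (Suc n) [^] ?s (Suc n) \<otimes> g (Suc n) (Suc n) [^] ?s (Suc (Suc n)) = ?A"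
    using Suc.prems(1) A by (simp add: m_assoc sign_cancel del: power_Suc)
  also have "?A [^] ?s (Suc (Suc n)) \<otimes> ?A [^] ?s (Suc n) = \<one>"
    using A by (simp add: m_comm[of _ "?A [^] ?s (Suc n)"] sign_cancel del: power_Suc)
  finally show ?case .
qed

text \<open>In the application, \<open>a i = d\<^sub>i (s\<^sub>j x)\<close> and \<open>b i = s\<^sub>j (d\<^sub>i x)\<close>, and the lemma says
  that \<open>s\<^sub>j\<close> is, up to sign, a homotopy from the identity to \<open>1 - s\<^sub>j d\<^sub>j\<close>.\<close>

lemma altsum_homotopy:
  assumes "\<And>i. i \<le> Suc k \<Longrightarrow> a i \<in> carrier G" "\<And>i. i \<le> k \<Longrightarrow> b i \<in> carrier G"
    and "\<And>i. i < j \<Longrightarrow> a i = \<one>" "\<And>i. i < j \<Longrightarrow> b i = \<one>"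
    and "a (Suc j) = a j" and "\<And>i. j < i \<Longrightarrow> i \<le> k \<Longrightarrow> a (Suc i) = b i"
    and "j \<le> k"
  shows "altsum G a (Suc k) \<otimes> altsum G b k = b j [^] ((-1) ^ j :: int)"
  using assms(7) assms(1-6)
proof (induction k rule: dec_induct)
  case base
  \<comment> \<open>Only the last term of such a sum survives. For \<open>a\<close> the terms at
    \<open>j\<close> and \<open>j + 1\<close> then cancel, which leaves the sum of
    \<open>b\<close>.\<close>
  have *: "altsum G c j = c j [^] ((-1) ^ j :: int)"
    if "\<And>i. i < j \<Longrightarrow> c i = \<one>" "c j \<in> carrier G" for c
  proof (cases j)
    case 0
    then show ?thesis using that by (simp add: altsum_0)
  next
    case (Suc l)
    then show ?thesis
      using that altsum_one[of l c]
      by (subst Suc, subst altsum_Suc) (auto simp del: power_Suc simp: le_Suc_eq less_Suc_eq_le)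
  qed
  have "altsum G a (Suc j) = \<one>"
    using base by (simp add: altsum_Suc * sign_cancel del: power_Suc)
  then show ?case
    using base by (simp add: * del: power_Suc)
next
  case (step k)
  let ?s = "\<lambda>i. (-1) ^ i :: int"
  have a: "altsum G a (Suc k) \<in> carrier G" and b: "altsum G b k \<in> carrier G"
    using step.prems by (auto intro!: altsum_closed)
  have c: "b (Suc k) [^] ?s (Suc k) \<in> carrier G" "b (Suc k) [^] ?s (Suc (Suc k)) \<in> carrier G"
    using step.prems(2)[of "Suc k"] by auto
  have IH: "altsum G a (Suc k) \<otimes> altsum G b k = b j [^] ?s j"
    using step.prems by (intro step.IH) auto
  \<comment> \<open>The new term of \<open>a\<close> equals the new term of \<open>b\<close>, but
    its index is one higher, so the signs are opposite.\<close>
  have eq: "a (Suc (Suc k)) = b (Suc k)"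
    using step.hyps step.prems(6)[of "Suc k"] by simp
  have "altsum G a (Suc (Suc k)) \<otimes> altsum G b (Suc k) =
      (altsum G a (Suc k) \<otimes> b (Suc k) [^] ?s (Suc (Suc k))) \<otimes>
      (altsum G b k \<otimes> b (Suc k) [^] ?s (Suc k))"
    using step.prems altsum_Suc[of "Suc k" a] altsum_Suc[of k b] eq by simp
  also have "\<dots> = (altsum G a (Suc k) \<otimes> altsum G b k) \<otimes>
      (b (Suc k) [^] ?s (Suc k) \<otimes> b (Suc k) [^] ?s (Suc (Suc k)))"
    using a b c by (simp only: m_ac m_closed)
  also have "\<dots> = b j [^] ?s j"
    using step.prems(2)[of "Suc k"] step.prems(2)[of j] step.hyps IH sign_cancel[of "b (Suc k)" "Suc k"]
    by simp
  finally show ?case .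
qed

end


section \<open>Categories with zero arrows and finite limits\<close>

locale cat_axioms =
  fixes C :: "('o, 'm) cat" (structure)
  assumes category: "category C"
begin

lemma HomD:
  assumes "f \<in> Hom C A B"
  shows "f \<in> Ar C" "Dom C f = A" "Cod C f = B" "A \<in> Ob C" "B \<in> Ob C"
  using assms category by (auto simp: Hom_def category_def)

lemma HomI: "f \<in> Ar C \<Longrightarrow> f \<in> Hom C (Dom C f) (Cod C f)"
  by (simp add: Hom_def)

lemma comp_Hom: "f \<in> Hom C A B \<Longrightarrow> g \<in> Hom C B D \<Longrightarrow> g \<cdot> f \<in> Hom C A D"
  using category by (auto simp: Hom_def category_def)

lemma Idt_Hom: "A \<in> Ob C \<Longrightarrow> Idt C A \<in> Hom C A A"
  using category by (auto simp: category_def)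

lemma Idt_right: "f \<in> Hom C A B \<Longrightarrow> f \<cdot> Idt C A = f"
  using category by (auto simp: Hom_def category_def)

lemma Idt_left: "f \<in> Hom C A B \<Longrightarrow> Idt C B \<cdot> f = f"
  using category by (auto simp: Hom_def category_def)

lemma comp_assoc:
  "f \<in> Hom C A B \<Longrightarrow> g \<in> Hom C B D \<Longrightarrow> h \<in> Hom C D E \<Longrightarrow> (h \<cdot> g) \<cdot> f = h \<cdot> (g \<cdot> f)"
  using category by (auto simp: Hom_def category_def)

lemma monicD:
  "monic C f \<Longrightarrow> f \<in> Hom C B D \<Longrightarrow> a \<in> Hom C A B \<Longrightarrow> b \<in> Hom C A B \<Longrightarrow>
    f \<cdot> a = f \<cdot> b \<Longrightarrow> a = b"
  by (auto simp: monic_def Hom_def)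

lemma product_Hom:
  assumes "is_product C A B p q"
  shows "p \<in> Hom C (Dom C p) A" "q \<in> Hom C (Dom C p) B"
  using assms by (auto simp: is_product_def Hom_def)

lemma product_ex1:
  assumes "is_product C A B p q" "f \<in> Hom C Y A" "g \<in> Hom C Y B"
  shows "\<exists>!h. h \<in> Hom C Y (Dom C p) \<and> p \<cdot> h = f \<and> q \<cdot> h = g"
proof -
  have "\<forall>f \<in> Ar C. \<forall>g \<in> Ar C. Dom C f = Dom C g \<longrightarrow> Cod C f = A \<longrightarrow> Cod C g = B \<longrightarrow>
      (\<exists>!h. h \<in> Hom C (Dom C f) (Dom C p) \<and> p \<cdot> h = f \<and> q \<cdot> h = g)"
    using assms(1) unfolding is_product_def by (elim conjE)
  from this[rule_format, of f g] show ?thesis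
    using HomD[OF assms(2)] HomD[OF assms(3)] by simp
qed

lemma pairing:
  assumes "is_product C A B p q" "f \<in> Hom C Y A" "g \<in> Hom C Y B"
  shows pairing_Hom: "pairing C p q f g \<in> Hom C Y (Dom C p)"
    and pairing_fst: "p \<cdot> pairing C p q f g = f"
    and pairing_snd: "q \<cdot> pairing C p q f g = g"
proof -
  have "Dom C f = Y" using HomD assms(2) by blast
  then have "pairing C p q f g = (THE h. h \<in> Hom C Y (Dom C p) \<and> p \<cdot> h = f \<and> q \<cdot> h = g)"
    by (simp add: pairing_def)
  with theI'[OF product_ex1[OF assms]]
  show "pairing C p q f g \<in> Hom C Y (Dom C p)" "p \<cdot> pairing C p q f g = f"
    "q \<cdot> pairing C p q f g = g" by simp_all
qed

lemma product_eqI: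
  assumes "is_product C A B p q" "h \<in> Hom C Y (Dom C p)" "k \<in> Hom C Y (Dom C p)"
    "p \<cdot> h = p \<cdot> k" "q \<cdot> h = q \<cdot> k"
  shows "h = k"
  using product_ex1[OF assms(1) comp_Hom[OF assms(2) product_Hom(1)[OF assms(1)]]
      comp_Hom[OF assms(2) product_Hom(2)[OF assms(1)]]] assms(2-5) by auto

lemma pairing_comp:
  assumes P: "is_product C A B p q" and f: "f \<in> Hom C Y A" "g \<in> Hom C Y B" and h: "h \<in> Hom C W Y"
  shows "pairing C p q f g \<cdot> h = pairing C p q (f \<cdot> h) (g \<cdot> h)"
proof (rule product_eqI[OF P])
  note fg = pairing[OF P f] and fgh = pairing[OF P comp_Hom[OF h f(1)] comp_Hom[OF h f(2)]]
  show "pairing C p q f g \<cdot> h \<in> Hom C W (Dom C p)" using comp_Hom[OF h fg(1)] .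
  show "pairing C p q (f \<cdot> h) (g \<cdot> h) \<in> Hom C W (Dom C p)" using fgh(1) .
  show "p \<cdot> (pairing C p q f g \<cdot> h) = p \<cdot> pairing C p q (f \<cdot> h) (g \<cdot> h)"
    using comp_assoc[OF h fg(1) product_Hom(1)[OF P]] fg fgh by simp
  show "q \<cdot> (pairing C p q f g \<cdot> h) = q \<cdot> pairing C p q (f \<cdot> h) (g \<cdot> h)"
    using comp_assoc[OF h fg(1) product_Hom(2)[OF P]] fg fgh by simp
qed

lemma pullback_Hom:
  assumes "is_pullback C f g a b"
  shows "a \<in> Hom C (Dom C a) (Dom C f)" "b \<in> Hom C (Dom C a) (Dom C g)" "f \<cdot> a = g \<cdot> b"
  using assms by (auto simp: is_pullback_def Hom_def)

lemma pullback_ex1: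
  assumes "is_pullback C f g a b" "x \<in> Hom C Y (Dom C f)" "y \<in> Hom C Y (Dom C g)" "f \<cdot> x = g \<cdot> y"
  shows "\<exists>!h. h \<in> Hom C Y (Dom C a) \<and> a \<cdot> h = x \<and> b \<cdot> h = y"
proof -
  have "\<forall>x \<in> Ar C. \<forall>y \<in> Ar C. Dom C x = Dom C y \<longrightarrow> Cod C x = Dom C f \<longrightarrow> Cod C y = Dom C g \<longrightarrow>
      f \<cdot> x = g \<cdot> y \<longrightarrow> (\<exists>!h. h \<in> Hom C (Dom C x) (Dom C a) \<and> a \<cdot> h = x \<and> b \<cdot> h = y)"
    using assms(1) unfolding is_pullback_def by (elim conjE)
  from this[rule_format, of x y] show ?thesis
    using HomD[OF assms(2)] HomD[OF assms(3)] assms(4) by simp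
qed

lemma pullbackI:
  assumes "f \<in> Hom C A D" "g \<in> Hom C B D" "a \<in> Hom C K A" "b \<in> Hom C K B" "f \<cdot> a = g \<cdot> b"
    and "\<And>Y x y. x \<in> Hom C Y A \<Longrightarrow> y \<in> Hom C Y B \<Longrightarrow> f \<cdot> x = g \<cdot> y \<Longrightarrow>
      \<exists>!h. h \<in> Hom C Y K \<and> a \<cdot> h = x \<and> b \<cdot> h = y"
  shows "is_pullback C f g a b"
  unfolding is_pullback_def
proof (intro conjI ballI impI)
  fix x y assume "x \<in> Ar C" "y \<in> Ar C" "Dom C x = Dom C y" "Cod C x = Dom C f" "Cod C y = Dom C g"
    and "f \<cdot> x = g \<cdot> y"
  then show "\<exists>!h. h \<in> Hom C (Dom C x) (Dom C a) \<and> a \<cdot> h = x \<and> b \<cdot> h = y"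
    using assms(6)[of x "Dom C x" y] HomD[OF assms(1)] HomD[OF assms(2)] HomD[OF assms(3)]
    by (simp add: Hom_def)
qed (use assms(5) HomD[OF assms(1)] HomD[OF assms(2)] HomD[OF assms(3)] HomD[OF assms(4)] in auto)

lemma productI:
  assumes "p \<in> Hom C K A" "q \<in> Hom C K B"
    and "\<And>Y f g. f \<in> Hom C Y A \<Longrightarrow> g \<in> Hom C Y B \<Longrightarrow>
      \<exists>!h. h \<in> Hom C Y K \<and> p \<cdot> h = f \<and> q \<cdot> h = g"
  shows "is_product C A B p q"
  unfolding is_product_def
proof (intro conjI ballI impI)
  fix f g assume "f \<in> Ar C" "g \<in> Ar C" "Dom C f = Dom C g" "Cod C f = A" "Cod C g = B"
  then show "\<exists>!h. h \<in> Hom C (Dom C f) (Dom C p) \<and> p \<cdot> h = f \<and> q \<cdot> h = g"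
    using assms(3)[of f "Dom C f" g] HomD[OF assms(1)] by (simp add: Hom_def)
qed (use HomD[OF assms(1)] HomD[OF assms(2)] in auto)

lemma terminal_unique:
  assumes "terminal C Z" "f \<in> Hom C A Z" "g \<in> Hom C A Z"
  shows "f = g"
  using assms HomD(4) by (metis terminal_def)

lemma initial_unique:
  assumes "initial C Z" "f \<in> Hom C Z A" "g \<in> Hom C Z A"
  shows "f = g"
  using assms HomD(5) by (metis initial_def)

section \<open>Zero arrows\<close>

lemma zero_arrowE:
  assumes "zero_arrow C f" "f \<in> Hom C A B"
  obtains Z a b where "zero_object C Z" "a \<in> Hom C A Z" "b \<in> Hom C Z B" "f = b \<cdot> a"
  using assms HomD(2,3)[OF assms(2)] unfolding zero_arrow_def by auto

lemma zero_arrowI: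
  assumes "zero_object C Z" "a \<in> Hom C A Z" "b \<in> Hom C Z B"
  shows "zero_arrow C (b \<cdot> a)"
  unfolding zero_arrow_def using assms HomD[OF comp_Hom[OF assms(2,3)]] by auto

lemma zero_arrow_comp_left:
  assumes "zero_arrow C f" "f \<in> Hom C A B" "g \<in> Hom C B D"
  shows "zero_arrow C (g \<cdot> f)"
proof -
  obtain Z a b where Z: "zero_object C Z" "a \<in> Hom C A Z" "b \<in> Hom C Z B" "f = b \<cdot> a"
    using zero_arrowE[OF assms(1,2)] .
  then have "g \<cdot> f = (g \<cdot> b) \<cdot> a" using assms(3) by (simp add: comp_assoc)
  then show ?thesis using zero_arrowI[OF Z(1,2) comp_Hom[OF Z(3) assms(3)]] by simp
qed

lemma zero_arrow_comp_right:
  assumes "zero_arrow C f" "f \<in> Hom C A B" "g \<in> Hom C D A"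
  shows "zero_arrow C (f \<cdot> g)"
proof -
  obtain Z a b where Z: "zero_object C Z" "a \<in> Hom C A Z" "b \<in> Hom C Z B" "f = b \<cdot> a"
    using zero_arrowE[OF assms(1,2)] .
  then have "f \<cdot> g = b \<cdot> (a \<cdot> g)" using assms(3) by (simp add: comp_assoc)
  then show ?thesis using zero_arrowI[OF Z(1) comp_Hom[OF assms(3) Z(2)] Z(3)] by simp
qed

text \<open>The two arrows may factor through different zero objects; an arrow \<open>j\<close>
  between these compares the factorizations.\<close>

lemma zero_arrow_unique:
  assumes "zero_arrow C f" "zero_arrow C g" "f \<in> Hom C A B" "g \<in> Hom C A B"
  shows "f = g"
proof -
  obtain Z a b where Z: "zero_object C Z" "a \<in> Hom C A Z" "b \<in> Hom C Z B" "f = b \<cdot> a"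
    using zero_arrowE[OF assms(1,3)] .
  obtain W c d where W: "zero_object C W" "c \<in> Hom C A W" "d \<in> Hom C W B" "g = d \<cdot> c"
    using zero_arrowE[OF assms(2,4)] .
  obtain j where j: "j \<in> Hom C Z W"
    using Z(1) W(1) by (auto simp: zero_object_def initial_def terminal_def)
  have "b = d \<cdot> j"
    using Z(1) initial_unique[OF _ Z(3) comp_Hom[OF j W(3)]] by (simp add: zero_object_def)
  moreover have "c = j \<cdot> a"
    using W(1) terminal_unique[OF _ W(2) comp_Hom[OF Z(2) j]] by (simp add: zero_object_def)
  ultimately show ?thesis using Z(4) W(4) comp_assoc[OF Z(2) j W(3)] by simp
qed

end

locale pointed_cat = cat_axioms +
  assumes pointed: "pointed C"
begin

text \<open>The unit of an internal group starts at an arbitrary terminal object, which has to be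
  recognized as a zero object. It is a retract of the given zero object \<open>Z\<close>, so an
  arrow out of it is determined by its restriction to \<open>Z\<close>.\<close>

lemma terminal_imp_zero_object:
  assumes t: "terminal C T"
  shows "zero_object C T"
proof -
  obtain Z where Z: "zero_object C Z" using pointed by (auto simp: pointed_def)
  have ob: "T \<in> Ob C" "Z \<in> Ob C" using t Z by (auto simp: terminal_def zero_object_def)
  obtain u where u: "u \<in> Hom C T Z" using Z ob by (auto simp: zero_object_def terminal_def)
  obtain v where v: "v \<in> Hom C Z T" using t ob by (auto simp: terminal_def)
  have vu: "v \<cdot> u = Idt C T" using terminal_unique[OF t comp_Hom[OF u v] Idt_Hom[OF ob(1)]] .
  have "\<exists>!f. f \<in> Hom C T A" if A: "A \<in> Ob C" for A
  proof -
    obtain w where w: "w \<in> Hom C Z A" using Z A by (auto simp: zero_object_def initial_def)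
    have "f = w \<cdot> u" if f: "f \<in> Hom C T A" for f
    proof -
      have "f = (f \<cdot> v) \<cdot> u" using f u v vu by (simp add: comp_assoc Idt_right)
      also have "f \<cdot> v = w" using f v w Z initial_unique comp_Hom unfolding zero_object_def by blast
      finally show ?thesis .
    qed
    then show ?thesis using u w comp_Hom by blast
  qed
  then show ?thesis using t ob by (auto simp: zero_object_def initial_def)
qed

lemma zero_arrow_exists:
  assumes "A \<in> Ob C" "B \<in> Ob C"
  obtains z where "z \<in> Hom C A B" "zero_arrow C z"
proof -
  obtain Z where Z: "zero_object C Z" using pointed by (auto simp: pointed_def)
  obtain u where u: "u \<in> Hom C A Z" using Z assms by (auto simp: zero_object_def terminal_def)
  obtain v where v: "v \<in> Hom C Z B" using Z assms by (auto simp: zero_object_def initial_def)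
  show ?thesis using that[OF comp_Hom[OF u v] zero_arrowI[OF Z u v]] .
qed

lemma zero_arrow_to: "zero_object C Z \<Longrightarrow> f \<in> Hom C A Z \<Longrightarrow> zero_arrow C f"
  by (metis HomD(4,5) terminal_unique zero_arrow_exists zero_object_def)

end

locale lex_cat = pointed_cat +
  assumes lex: "has_finite_limits C"
begin

lemma product_exists:
  assumes "A \<in> Ob C" "B \<in> Ob C"
  obtains p q where "is_product C A B p q"
proof -
  obtain Z where Z: "terminal C Z" using lex by (auto simp: has_finite_limits_def)
  obtain u v where u: "u \<in> Hom C A Z" "v \<in> Hom C B Z" using Z assms by (meson terminal_def)
  obtain a b where pb: "is_pullback C u v a b"
    using lex u HomD unfolding has_finite_limits_def by metis
  have ab: "a \<in> Hom C (Dom C a) A" "b \<in> Hom C (Dom C a) B"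
    using pullback_Hom(1,2)[OF pb] HomD(2)[OF u(1)] HomD(2)[OF u(2)] by simp_all
  have "\<exists>!h. h \<in> Hom C Y (Dom C a) \<and> a \<cdot> h = f \<and> b \<cdot> h = g"
    if f: "f \<in> Hom C Y A" "g \<in> Hom C Y B" for Y f g
    using pullback_ex1[OF pb, of f Y g] f HomD(2)[OF u(1)] HomD(2)[OF u(2)]
      terminal_unique[OF Z comp_Hom[OF f(1) u(1)] comp_Hom[OF f(2) u(2)]] by simp
  then show ?thesis by (rule that[OF productI[OF ab]])
qed

text \<open>The equalizer is the pullback of the graphs \<open>(1, a)\<close> and
  \<open>(1, b)\<close>: the first coordinates force the two projections \<open>k\<close> and
  \<open>l\<close> of the pullback to coincide, the second ones give
  \<open>a k = b k\<close>.\<close>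

lemma equalizer_exists:
  assumes a: "a \<in> Hom C A B" and b: "b \<in> Hom C A B"
  obtains k where "k \<in> Hom C (Dom C k) A" "a \<cdot> k = b \<cdot> k" "monic C k"
    "\<And>Y x. x \<in> Hom C Y A \<Longrightarrow> a \<cdot> x = b \<cdot> x \<Longrightarrow> \<exists>h \<in> Hom C Y (Dom C k). k \<cdot> h = x"
proof -
  have ob: "A \<in> Ob C" "B \<in> Ob C" using a HomD by auto
  obtain p q where P: "is_product C A B p q" using product_exists[OF ob] .
  let ?a = "pairing C p q (Idt C A) a" and ?b = "pairing C p q (Idt C A) b"
  note I = Idt_Hom[OF ob(1)]
  have h: "?a \<in> Hom C A (Dom C p)" "?b \<in> Hom C A (Dom C p)"
    using pairing_Hom[OF P I] a b by auto
  obtain k l where pb: "is_pullback C ?a ?b k l"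
    using lex h HomD unfolding has_finite_limits_def by metis
  have k: "k \<in> Hom C (Dom C k) A" "l \<in> Hom C (Dom C k) A" and eq: "?a \<cdot> k = ?b \<cdot> l"
    using pullback_Hom[OF pb] HomD(2)[OF h(1)] HomD(2)[OF h(2)] by simp_all
  have comp: "?a \<cdot> x = pairing C p q x (a \<cdot> x)" "?b \<cdot> x = pairing C p q x (b \<cdot> x)"
    if "x \<in> Hom C Y A" for x Y
    using pairing_comp[OF P I] a b that by (auto simp: Idt_left)
  have kl: "k = l" "a \<cdot> k = b \<cdot> l"
    using eq comp[OF k(1)] comp[OF k(2)] pairing_fst[OF P] pairing_snd[OF P] k a b comp_Hom
    by metis+
  have ex1: "\<exists>!h. h \<in> Hom C Y (Dom C k) \<and> k \<cdot> h = x"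
    if x: "x \<in> Hom C Y A" "a \<cdot> x = b \<cdot> x" for x Y
    using pullback_ex1[OF pb, of x Y x] comp[OF x(1)] x h HomD(2) kl(1) by metis
  have "monic C k"
    unfolding monic_def
  proof (intro conjI ballI impI)
    show "k \<in> Ar C" using k HomD by blast
    fix x y assume xy: "x \<in> Ar C" "y \<in> Ar C" "Cod C x = Dom C k" "Cod C y = Dom C k"
      "Dom C x = Dom C y" "k \<cdot> x = k \<cdot> y"
    then have x: "x \<in> Hom C (Dom C x) (Dom C k)" "y \<in> Hom C (Dom C x) (Dom C k)"
      by (auto simp: Hom_def)
    then have "a \<cdot> (k \<cdot> x) = b \<cdot> (k \<cdot> x)"
      using kl comp_assoc[OF x(1) k(1) a] comp_assoc[OF x(1) k(1) b] by simp
    from ex1[OF comp_Hom[OF x(1) k(1)] this] show "x = y" using x xy(6) by auto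
  qed
  then show ?thesis using that[of k] k kl ex1 by blast
qed

end


section \<open>Hom groups of objects of the abelian core\<close>

context cat_axioms
begin

text \<open>One structure is chosen for \<open>A\<close> before \<open>Y\<close> varies. All groups
  of arrows into \<open>A\<close> thus share the same \<open>m\<close>, which is what makes
  precomposition additive.\<close>

lemma hom_group_cases:
  assumes "A \<in> abelian_core C"
  obtains p q m e i where "internal_abelian_group C A (p, q, m, e, i)"
    "\<And>Y. hom_group C Y A = \<lparr>carrier = Hom C Y A,
         mult = (\<lambda>f g. m \<cdot> pairing C p q f g),
         one = e \<cdot> (THE t. t \<in> Hom C Y (Dom C e))\<rparr>"
proof -
  obtain p q m e i where G: "(SOME G. internal_abelian_group C A G) = (p, q, m, e, i)"
    by (metis prod.exhaust)
  have "\<exists>G. internal_abelian_group C A G" using assms by (simp add: abelian_core_def)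
  then have "internal_abelian_group C A (p, q, m, e, i)"
    unfolding G[symmetric] by (rule someI_ex)
  then show ?thesis using that by (simp add: hom_group_def G)
qed

lemma carrier_hom_group [simp]: "carrier (hom_group C Y A) = Hom C Y A"
  by (simp add: hom_group_def split: prod.split)

lemma hom_group_precomp:
  assumes A: "A \<in> abelian_core C" and f: "f \<in> Hom C Y A" "g \<in> Hom C Y A" and h: "h \<in> Hom C W Y"
  shows "(f \<otimes>\<^bsub>hom_group C Y A\<^esub> g) \<cdot> h = (f \<cdot> h) \<otimes>\<^bsub>hom_group C W A\<^esub> (g \<cdot> h)"
proof -
  obtain p q m e i where G: "internal_abelian_group C A (p, q, m, e, i)"
    and H: "\<And>Y. hom_group C Y A = \<lparr>carrier = Hom C Y A,
         mult = (\<lambda>f g. m \<cdot> pairing C p q f g),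
         one = e \<cdot> (THE t. t \<in> Hom C Y (Dom C e))\<rparr>"
    by (rule hom_group_cases[OF A]) (rule that)
  have P: "is_product C A A p q" and m: "m \<in> Hom C (Dom C p) A"
    using G by (auto simp: internal_abelian_group_def)
  show ?thesis
    using comp_assoc[OF h pairing_Hom[OF P f] m] pairing_comp[OF P f h] by (simp add: H)
qed

end

context lex_cat
begin

text \<open>The domain of \<open>e\<close> is terminal, hence a zero object here. So the neutral
  element of a group of arrows is the zero arrow, whichever structure has been chosen.\<close>

lemma internal_unit:
  assumes "internal_abelian_group C A (p, q, m, e, i)" "Y \<in> Ob C"
  shows "e \<cdot> (THE t. t \<in> Hom C Y (Dom C e)) \<in> Hom C Y A"
    and "zero_arrow C (e \<cdot> (THE t. t \<in> Hom C Y (Dom C e)))"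
    and "t \<in> Hom C Y (Dom C e) \<Longrightarrow> (THE t. t \<in> Hom C Y (Dom C e)) = t"
proof -
  let ?t = "THE t. t \<in> Hom C Y (Dom C e)"
  have e: "terminal C (Dom C e)" "e \<in> Hom C (Dom C e) A"
    using assms by (auto simp: internal_abelian_group_def Hom_def)
  then have "\<exists>!t. t \<in> Hom C Y (Dom C e)" using assms by (simp add: terminal_def)
  from theI'[OF this] have t: "?t \<in> Hom C Y (Dom C e)" .
  show "t \<in> Hom C Y (Dom C e) \<Longrightarrow> ?t = t" using t e terminal_unique by blast
  show "e \<cdot> ?t \<in> Hom C Y A" using t e comp_Hom by blast
  show "zero_arrow C (e \<cdot> ?t)"
    using t e zero_arrow_comp_left zero_arrow_to terminal_imp_zero_object by blast
qed

lemma zero_arrow_one_hom_group: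
  assumes A: "A \<in> abelian_core C" and Y: "Y \<in> Ob C"
  shows "zero_arrow C \<one>\<^bsub>hom_group C Y A\<^esub>"
  using hom_group_cases[OF A] internal_unit(2)[OF _ Y]
  by (metis monoid.select_convs(2))

text \<open>The axioms on \<open>A\<close> are equations between arrows out of powers of
  \<open>A\<close>; precomposing them with tuples of generalized elements
  \<open>Y \<rightarrow> A\<close> yields the axioms for the group of arrows.\<close>

lemma comm_group_hom_group:
  assumes A: "A \<in> abelian_core C" and Y: "Y \<in> Ob C"
  shows "comm_group (hom_group C Y A)"
proof -
  obtain p q m e i where G: "internal_abelian_group C A (p, q, m, e, i)"
    and H: "\<And>Y. hom_group C Y A = \<lparr>carrier = Hom C Y A,
         mult = (\<lambda>f g. m \<cdot> pairing C p q f g),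
         one = e \<cdot> (THE t. t \<in> Hom C Y (Dom C e))\<rparr>"
    by (rule hom_group_cases[OF A]) (rule that)
  have P: "is_product C A A p q" and m: "m \<in> Hom C (Dom C p) A" and i: "i \<in> Hom C A A"
    and e: "e \<in> Hom C (Dom C e) A" "terminal C (Dom C e)"
    and asc: "\<And>r x. is_product C (Dom C p) A r x \<Longrightarrow>
        m \<cdot> pairing C p q (m \<cdot> r) x =
        m \<cdot> pairing C p q (p \<cdot> r) (m \<cdot> pairing C p q (q \<cdot> r) x)"
    and unit: "\<And>t. t \<in> Hom C A (Dom C e) \<Longrightarrow> m \<cdot> pairing C p q (e \<cdot> t) (Idt C A) = Idt C A"
    and inv: "\<And>t. t \<in> Hom C A (Dom C e) \<Longrightarrow> m \<cdot> pairing C p q i (Idt C A) = e \<cdot> t"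
    and comm: "m \<cdot> pairing C p q q p = m"
    using G unfolding internal_abelian_group_def by (auto simp: Hom_def)
  have obA: "A \<in> Ob C" using A by (simp add: abelian_core_def)
  have I: "Idt C A \<in> Hom C A A" using Idt_Hom[OF obA] .
  let ?m = "\<lambda>f g. m \<cdot> pairing C p q f g"
  have mH: "?m f g \<in> Hom C W A" if "f \<in> Hom C W A" "g \<in> Hom C W A" for f g W
    using comp_Hom[OF pairing_Hom[OF P that] m] .
  have mc: "?m f g \<cdot> h = ?m (f \<cdot> h) (g \<cdot> h)"
    if "f \<in> Hom C W A" "g \<in> Hom C W A" "h \<in> Hom C V W" for f g h W V
    using comp_assoc[OF that(3) pairing_Hom[OF P that(1,2)] m] pairing_comp[OF P that] by simp
  obtain t where t: "t \<in> Hom C A (Dom C e)" using e(2) obA by (auto simp: terminal_def)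
  have one: "e \<cdot> (THE t. t \<in> Hom C Y (Dom C e)) = (e \<cdot> t) \<cdot> f" if f: "f \<in> Hom C Y A" for f
    using internal_unit(3)[OF G Y comp_Hom[OF f t]] comp_assoc[OF f t e(1)] by simp
  show ?thesis
  proof (rule comm_groupI)
    fix x y assume "x \<in> carrier (hom_group C Y A)" "y \<in> carrier (hom_group C Y A)"
    then have x: "x \<in> Hom C Y A" and y: "y \<in> Hom C Y A" by auto
    show "x \<otimes>\<^bsub>hom_group C Y A\<^esub> y \<in> carrier (hom_group C Y A)"
      using mH[OF x y] by (simp add: H)
    have "pairing C p q q p \<cdot> pairing C p q x y = pairing C p q y x"
      using pairing_comp[OF P product_Hom(2,1)[OF P] pairing_Hom[OF P x y]] pairing[OF P x y] by simp
    then show "x \<otimes>\<^bsub>hom_group C Y A\<^esub> y = y \<otimes>\<^bsub>hom_group C Y A\<^esub> x"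
      using comp_assoc[OF pairing_Hom[OF P x y] pairing_Hom[OF P product_Hom(2,1)[OF P]] m] comm
      by (simp add: H)
  next
    show "\<one>\<^bsub>hom_group C Y A\<^esub> \<in> carrier (hom_group C Y A)"
      using internal_unit[OF G Y] by (simp add: H)
  next
    fix x y z
    assume "x \<in> carrier (hom_group C Y A)" "y \<in> carrier (hom_group C Y A)"
      "z \<in> carrier (hom_group C Y A)"
    then have x: "x \<in> Hom C Y A" and y: "y \<in> Hom C Y A" and z: "z \<in> Hom C Y A" by auto
    have obP: "Dom C p \<in> Ob C" using product_Hom[OF P] HomD by blast
    obtain r s where R: "is_product C (Dom C p) A r s" using product_exists[OF obP obA] .
    note r = product_Hom[OF R]
    note xy = pairing_Hom[OF P x y]
    \<comment> \<open>Associativity is an equation on the triple product; \<open>?k\<close> is its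
      generalized element \<open>((x, y), z)\<close>.\<close>
    let ?k = "pairing C r s (pairing C p q x y) z"
    have k: "?k \<in> Hom C Y (Dom C r)" using pairing_Hom[OF R xy z] .
    have rs: "r \<cdot> ?k = pairing C p q x y" "s \<cdot> ?k = z"
      using pairing[OF R xy z] by auto
    have pr: "p \<cdot> r \<in> Hom C (Dom C r) A" "q \<cdot> r \<in> Hom C (Dom C r) A" "m \<cdot> r \<in> Hom C (Dom C r) A"
      using r(1) product_Hom[OF P] m comp_Hom by auto
    have prk: "(p \<cdot> r) \<cdot> ?k = x" "(q \<cdot> r) \<cdot> ?k = y" "(m \<cdot> r) \<cdot> ?k = ?m x y"
      using comp_assoc[OF k r(1)] product_Hom[OF P] m rs pairing[OF P x y] by auto
    have "?m (m \<cdot> r) s \<cdot> ?k = ?m (?m x y) z"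
      using mc[OF pr(3) r(2) k] prk rs by simp
    moreover have "?m (p \<cdot> r) (?m (q \<cdot> r) s) \<cdot> ?k = ?m x (?m y z)"
      using mc[OF pr(1) mH[OF pr(2) r(2)] k] mc[OF pr(2) r(2) k] prk rs by simp
    ultimately have "?m (?m x y) z = ?m x (?m y z)" using asc[OF R] by simp
    then show "x \<otimes>\<^bsub>hom_group C Y A\<^esub> y \<otimes>\<^bsub>hom_group C Y A\<^esub> z =
        x \<otimes>\<^bsub>hom_group C Y A\<^esub> (y \<otimes>\<^bsub>hom_group C Y A\<^esub> z)"
      by (simp add: H)
  next
    fix x assume "x \<in> carrier (hom_group C Y A)"
    then have x: "x \<in> Hom C Y A" by auto
    show "\<one>\<^bsub>hom_group C Y A\<^esub> \<otimes>\<^bsub>hom_group C Y A\<^esub> x = x"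
      using mc[OF comp_Hom[OF t e(1)] I x] unit[OF t] one[OF x] x by (simp add: H Idt_left)
    have "?m (i \<cdot> x) x = \<one>\<^bsub>hom_group C Y A\<^esub>"
      using mc[OF i I x] inv[OF t] one[OF x] x by (simp add: H Idt_left)
    then show "\<exists>y\<in>carrier (hom_group C Y A). y \<otimes>\<^bsub>hom_group C Y A\<^esub> x = \<one>\<^bsub>hom_group C Y A\<^esub>"
      using comp_Hom[OF x i] by (auto simp: H)
  qed
qed

lemma one_hom_group_Hom:
  assumes "A \<in> abelian_core C" "Y \<in> Ob C"
  shows "\<one>\<^bsub>hom_group C Y A\<^esub> \<in> Hom C Y A"
  using comm_groupE(2)[OF comm_group_hom_group[OF assms]] by simp

lemma zero_arrow_iff_one:
  assumes "A \<in> abelian_core C" "f \<in> Hom C Y A"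
  shows "zero_arrow C f \<longleftrightarrow> f = \<one>\<^bsub>hom_group C Y A\<^esub>"
  using assms HomD(4)[OF assms(2)] zero_arrow_unique one_hom_group_Hom zero_arrow_one_hom_group
  by metis

end

locale protomodular_cat = lex_cat +
  assumes protomodular: "protomodular C"
begin

text \<open>The equalizer of \<open>f\<close> and \<open>g\<close> is a morphism of points over \<open>B\<close> that induces an isomorphism
  of the kernels, so it is an isomorphism.\<close>

lemma product_injections_jointly_epic:
  assumes P: "is_product C A B p q" and ob: "A \<in> Ob C" "B \<in> Ob C"
    and y: "y \<in> Hom C A B" "zero_arrow C y" and z: "z \<in> Hom C B A"
    and f: "f \<in> Hom C (Dom C p) D" and g: "g \<in> Hom C (Dom C p) D"
    and eq1: "f \<cdot> pairing C p q (Idt C A) y = g \<cdot> pairing C p q (Idt C A) y"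
    and eq2: "f \<cdot> pairing C p q z (Idt C B) = g \<cdot> pairing C p q z (Idt C B)"
  shows "f = g"
proof -
  note p = product_Hom(1)[OF P] and q = product_Hom(2)[OF P]
  define i where "i = pairing C p q (Idt C A) y"
  define i' where "i' = pairing C p q z (Idt C B)"
  have i: "i \<in> Hom C A (Dom C p)" "p \<cdot> i = Idt C A" "q \<cdot> i = y"
    unfolding i_def using pairing[OF P Idt_Hom[OF ob(1)] y(1)] .
  have i': "i' \<in> Hom C B (Dom C p)" "q \<cdot> i' = Idt C B"
    unfolding i'_def using pairing[OF P z Idt_Hom[OF ob(2)]] by simp_all
  obtain k where k: "k \<in> Hom C (Dom C k) (Dom C p)" and fk: "f \<cdot> k = g \<cdot> k"
    and km: "monic C k" and ku: "\<And>Y x. x \<in> Hom C Y (Dom C p) \<Longrightarrow> f \<cdot> x = g \<cdot> x \<Longrightarrow>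
      \<exists>h \<in> Hom C Y (Dom C k). k \<cdot> h = x"
    using equalizer_exists[OF f g] by metis
  obtain j where j: "j \<in> Hom C A (Dom C k)" "k \<cdot> j = i"
    using ku[OF i(1)] eq1 by (auto simp: i_def)
  obtain j' where j': "j' \<in> Hom C B (Dom C k)" "k \<cdot> j' = i'"
    using ku[OF i'(1)] eq2 by (auto simp: i'_def)
  obtain Z where Z: "zero_object C Z" using pointed by (auto simp: pointed_def)
  obtain v where v: "v \<in> Hom C Z B" using Z ob by (auto simp: zero_object_def initial_def)
  obtain t where t: "t \<in> Hom C A Z" using Z ob by (auto simp: zero_object_def terminal_def)
  have tu: "terminal C Z" using Z by (simp add: zero_object_def)
  note qk = comp_Hom[OF k q]
  have vt: "v \<cdot> t = y"
    using zero_arrow_unique[OF zero_arrowI[OF Z t v] y(2) comp_Hom[OF t v] y(1)] .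
  \<comment> \<open>Kernels appear as pullbacks of points along the arrow \<open>v\<close> out of a
    zero object, the form in which \<open>protomodular\<close> applies. The kernel of
    \<open>q\<close> is \<open>A\<close>, included by \<open>i\<close>.\<close>
  have pb: "is_pullback C q v i t"
  proof (rule pullbackI[OF q v i(1) t])
    show "q \<cdot> i = v \<cdot> t" using vt i by simp
    fix W x w assume x: "x \<in> Hom C W (Dom C p)" and w: "w \<in> Hom C W Z" and eq: "q \<cdot> x = v \<cdot> w"
    have px: "p \<cdot> x \<in> Hom C W A" using comp_Hom[OF x p] .
    have "q \<cdot> x = y \<cdot> (p \<cdot> x)"
      using zero_arrow_unique[OF zero_arrowI[OF Z w v] zero_arrow_comp_right[OF y(2,1) px]
          comp_Hom[OF w v] comp_Hom[OF px y(1)]] eq by simp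
    then have "i \<cdot> (p \<cdot> x) = x"
      using comp_assoc[OF px i(1) p] comp_assoc[OF px i(1) q] i Idt_left[OF px]
      by (intro product_eqI[OF P comp_Hom[OF px i(1)] x]) auto
    moreover have "t \<cdot> (p \<cdot> x) = w" using terminal_unique[OF tu comp_Hom[OF px t] w] .
    moreover have "h = p \<cdot> x" if "h \<in> Hom C W A" "i \<cdot> h = x" for h
      using comp_assoc[OF that(1) i(1) p] i(2) that(2) Idt_left[OF that(1)] by simp
    ultimately show "\<exists>!h. h \<in> Hom C W A \<and> i \<cdot> h = x \<and> t \<cdot> h = w" using px by blast
  qed
  \<comment> \<open>The kernel of the restriction of \<open>q\<close> to the equalizer is again
    \<open>A\<close>, because \<open>i\<close> factors through \<open>k\<close> by
    \<open>j\<close>.\<close>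
  have pb': "is_pullback C (q \<cdot> k) v j t"
  proof (rule pullbackI[OF qk v j(1) t])
    show "q \<cdot> k \<cdot> j = v \<cdot> t" using vt i(3) j comp_assoc[OF j(1) k q] by simp
    fix W x w assume x: "x \<in> Hom C W (Dom C k)" and w: "w \<in> Hom C W Z" and eq: "q \<cdot> k \<cdot> x = v \<cdot> w"
    have "\<exists>!h. h \<in> Hom C W A \<and> i \<cdot> h = k \<cdot> x \<and> t \<cdot> h = w"
      using pullback_ex1[OF pb, of "k \<cdot> x" W w] eq comp_assoc[OF x k q] comp_Hom[OF x k] w
        HomD(2)[OF i(1)] HomD(2)[OF q] HomD(2)[OF v] by simp
    moreover have "i \<cdot> h = k \<cdot> x \<longleftrightarrow> j \<cdot> h = x" if h: "h \<in> Hom C W A" for h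
      using comp_assoc[OF h j(1) k] j(2) monicD[OF km k comp_Hom[OF h j(1)] x] by auto
    ultimately show "\<exists>!h. h \<in> Hom C W A \<and> j \<cdot> h = x \<and> t \<cdot> h = w" by metis
  qed
  have pt: "is_point C (q \<cdot> k) j'" "is_point C q i'"
    using qk q j' i' comp_assoc[OF j'(1) k q] HomD[OF qk] HomD[OF q] by (auto simp: is_point_def)
  have I: "Idt C A \<in> Hom C A A" using Idt_Hom[OF ob(1)] .
  have iso: "is_iso C (Idt C A)"
    unfolding is_iso_def using I Idt_left[OF I] HomD[OF I] by auto
  have "is_iso C k"
  proof (rule protomodular[unfolded protomodular_def, rule_format, OF pt _ _ refl j'(2) pb' pb _ _ _ iso])
    show "Cod C (q \<cdot> k) = Cod C q" "k \<in> Hom C (Dom C (q \<cdot> k)) (Dom C q)"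
      "Idt C A \<in> Hom C (Dom C j) (Dom C i)"
      using k I HomD(2,3)[OF qk] HomD(2,3)[OF q] HomD(2)[OF j(1)] HomD(2)[OF i(1)] by simp_all
    show "i \<cdot> Idt C A = k \<cdot> j" "t \<cdot> Idt C A = t"
      using Idt_right[OF i(1)] Idt_right[OF t] j(2) by simp_all
  qed
  then obtain l where l: "l \<in> Hom C (Dom C p) (Dom C k)" "k \<cdot> l = Idt C (Dom C p)"
    unfolding is_iso_def using HomD[OF k] by auto
  show "f = g"
    using comp_assoc[OF l(1) k f] comp_assoc[OF l(1) k g] Idt_right[OF f] Idt_right[OF g]
    unfolding fk l(2) by simp
qed

text \<open>Both sides are values at \<open>(f, g)\<close> of arrows
  \<open>A \<times> A \<rightarrow> B\<close>, namely \<open>u m\<close> and the product of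
  \<open>u p\<close> and \<open>u q\<close>. By the unit laws each of them restricts to
  \<open>u\<close> along \<open>(1, 0)\<close> and along \<open>(0, 1)\<close>, and these two
  injections are jointly epic.\<close>

lemma hom_group_postcomp:
  assumes A: "A \<in> abelian_core C" and B: "B \<in> abelian_core C" and u: "u \<in> Hom C A B"
    and f: "f \<in> Hom C Y A" "g \<in> Hom C Y A"
  shows "u \<cdot> (f \<otimes>\<^bsub>hom_group C Y A\<^esub> g) = (u \<cdot> f) \<otimes>\<^bsub>hom_group C Y B\<^esub> (u \<cdot> g)"
proof -
  obtain p q m e i where G: "internal_abelian_group C A (p, q, m, e, i)"
    and H: "\<And>Y. hom_group C Y A = \<lparr>carrier = Hom C Y A,
         mult = (\<lambda>f g. m \<cdot> pairing C p q f g),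
         one = e \<cdot> (THE t. t \<in> Hom C Y (Dom C e))\<rparr>"
    by (rule hom_group_cases[OF A]) (rule that)
  have P: "is_product C A A p q" and m: "m \<in> Hom C (Dom C p) A"
    using G by (auto simp: internal_abelian_group_def)
  note p = product_Hom(1)[OF P] and q = product_Hom(2)[OF P]
  have mult: "x \<otimes>\<^bsub>hom_group C W A\<^esub> y = m \<cdot> pairing C p q x y" for W x y
    by (simp add: H)
  have ob: "A \<in> Ob C" "B \<in> Ob C" using A B by (auto simp: abelian_core_def)
  interpret AA: comm_group "hom_group C A A" using comm_group_hom_group[OF A ob(1)] .
  interpret AB: comm_group "hom_group C A B" using comm_group_hom_group[OF B ob(1)] .
  note I = Idt_Hom[OF ob(1)]
  let ?z = "\<one>\<^bsub>hom_group C A A\<^esub>"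
  have z: "?z \<in> Hom C A A" "zero_arrow C ?z"
    using one_hom_group_Hom[OF A ob(1)] zero_arrow_one_hom_group[OF A ob(1)] .
  have uz: "u \<cdot> ?z = \<one>\<^bsub>hom_group C A B\<^esub>"
    using zero_arrow_iff_one[OF B comp_Hom[OF z(1) u]] zero_arrow_comp_left[OF z(2,1) u] by simp
  define \<phi> where "\<phi> = u \<cdot> m"
  define \<psi> where "\<psi> = (u \<cdot> p) \<otimes>\<^bsub>hom_group C (Dom C p) B\<^esub> (u \<cdot> q)"
  have \<phi>: "\<phi> \<in> Hom C (Dom C p) B" using comp_Hom[OF m u] by (simp add: \<phi>_def)
  interpret PB: comm_group "hom_group C (Dom C p) B"
    using comm_group_hom_group[OF B] HomD(4)[OF p] by blast
  note up = comp_Hom[OF p u] and uq = comp_Hom[OF q u]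
  have \<psi>: "\<psi> \<in> Hom C (Dom C p) B"
    unfolding \<psi>_def using PB.m_closed up uq by simp
  have \<phi>c: "\<phi> \<cdot> pairing C p q x y = u \<cdot> (x \<otimes>\<^bsub>hom_group C W A\<^esub> y)"
    if "x \<in> Hom C W A" "y \<in> Hom C W A" for x y W
    using comp_assoc[OF pairing_Hom[OF P that] m u] by (simp add: \<phi>_def mult)
  have \<psi>c: "\<psi> \<cdot> pairing C p q x y = (u \<cdot> x) \<otimes>\<^bsub>hom_group C W B\<^esub> (u \<cdot> y)"
    if "x \<in> Hom C W A" "y \<in> Hom C W A" for x y W
    using hom_group_precomp[OF B up uq pairing_Hom[OF P that]] pairing[OF P that]
      comp_assoc[OF pairing_Hom[OF P that] p u] comp_assoc[OF pairing_Hom[OF P that] q u]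
    by (simp add: \<psi>_def)
  have "\<phi> = \<psi>"
  proof (rule product_injections_jointly_epic[OF P ob(1) ob(1) z z(1) \<phi> \<psi>])
    show "\<phi> \<cdot> pairing C p q (Idt C A) ?z = \<psi> \<cdot> pairing C p q (Idt C A) ?z"
      using \<phi>c[OF I z(1)] \<psi>c[OF I z(1)] uz I u AA.r_one AB.r_one Idt_right[OF u] by simp
    show "\<phi> \<cdot> pairing C p q ?z (Idt C A) = \<psi> \<cdot> pairing C p q ?z (Idt C A)"
      using \<phi>c[OF z(1) I] \<psi>c[OF z(1) I] uz I u AA.l_one AB.l_one Idt_right[OF u] by simp
  qed
  then show ?thesis using \<phi>c[OF f] \<psi>c[OF f] by simp
qed

end


section \<open>Additive categories with kernels and cokernels\<close>

text \<open>The addition of arrows is part of the data instead of being derived from biproducts, so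
  that the groups \<open>hom_group\<close> which define \<open>Ext_group\<close> can be inserted
  directly.\<close>

locale abelian_cat = pointed_cat +
  fixes H :: "'o \<Rightarrow> 'o \<Rightarrow> 'm monoid"
  assumes comm_group_H: "A \<in> Ob C \<Longrightarrow> B \<in> Ob C \<Longrightarrow> comm_group (H A B)"
    and carrier_H [simp]: "carrier (H A B) = Hom C A B"
    and precomp: "f \<in> Hom C B D \<Longrightarrow> g \<in> Hom C B D \<Longrightarrow> h \<in> Hom C A B \<Longrightarrow>
      (f \<otimes>\<^bsub>H B D\<^esub> g) \<cdot> h = (f \<cdot> h) \<otimes>\<^bsub>H A D\<^esub> (g \<cdot> h)"
    and postcomp: "u \<in> Hom C B D \<Longrightarrow> f \<in> Hom C A B \<Longrightarrow> g \<in> Hom C A B \<Longrightarrow>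
      u \<cdot> (f \<otimes>\<^bsub>H A B\<^esub> g) = (u \<cdot> f) \<otimes>\<^bsub>H A D\<^esub> (u \<cdot> g)"
    and kernels: "f \<in> Ar C \<Longrightarrow> \<exists>k. is_kernel C f k"
    and cokernels: "f \<in> Ar C \<Longrightarrow> \<exists>q. is_cokernel C f q"
    and monic_normal: "monic C m \<Longrightarrow> \<exists>f. is_kernel C f m"
    and epic_normal: "epic C e \<Longrightarrow> \<exists>f. is_cokernel C f e"
begin

abbreviation zr :: "'o \<Rightarrow> 'o \<Rightarrow> 'm" where "zr A B \<equiv> \<one>\<^bsub>H A B\<^esub>"

text \<open>Lifting is required along all epimorphisms, not only regular ones as in
  \<open>projective\<close>: the epimorphisms to be lifted along arise from image factorizations and
  from vanishing cokernels.\<close>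

definition epi_projective :: "'o \<Rightarrow> bool" where
  "epi_projective Q \<longleftrightarrow> (\<forall>A B e f. epic C e \<longrightarrow> e \<in> Hom C A B \<longrightarrow> f \<in> Hom C Q B \<longrightarrow>
     (\<exists>g \<in> Hom C Q A. e \<cdot> g = f))"

lemma group_H: "f \<in> Hom C A B \<Longrightarrow> comm_group (H A B)"
  using comm_group_H HomD(4,5) by blast

lemma zr_Hom: "A \<in> Ob C \<Longrightarrow> B \<in> Ob C \<Longrightarrow> zr A B \<in> Hom C A B"
  using comm_groupE(2)[OF comm_group_H] by simp

lemma mult_Hom: "f \<in> Hom C A B \<Longrightarrow> g \<in> Hom C A B \<Longrightarrow> f \<otimes>\<^bsub>H A B\<^esub> g \<in> Hom C A B"
  using comm_groupE(1)[OF group_H] by simp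

lemma inv_Hom: "f \<in> Hom C A B \<Longrightarrow> inv\<^bsub>H A B\<^esub> f \<in> Hom C A B"
  using group.inv_closed[OF comm_group.axioms(2)[OF group_H]] by simp

lemma int_pow_Hom: "f \<in> Hom C A B \<Longrightarrow> f [^]\<^bsub>H A B\<^esub> (c :: int) \<in> Hom C A B"
  using group.int_pow_closed[OF comm_group.axioms(2)[OF group_H]] by simp

lemma precomp_hom:
  assumes "h \<in> Hom C A B" "D \<in> Ob C"
  shows "group_hom (H B D) (H A D) (\<lambda>f. f \<cdot> h)"
  using comm_group_H HomD(4,5)[OF assms(1)] assms comp_Hom precomp
  by (auto simp: group_hom_def group_hom_axioms_def comm_group.axioms(2) intro!: homI)

lemma postcomp_hom:
  assumes "u \<in> Hom C B D" "A \<in> Ob C"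
  shows "group_hom (H A B) (H A D) (\<lambda>f. u \<cdot> f)"
  using comm_group_H HomD(4,5)[OF assms(1)] assms comp_Hom postcomp
  by (auto simp: group_hom_def group_hom_axioms_def comm_group.axioms(2) intro!: homI)

lemma zr_comp: "h \<in> Hom C A B \<Longrightarrow> D \<in> Ob C \<Longrightarrow> zr B D \<cdot> h = zr A D"
  using group_hom.hom_one[OF precomp_hom] .

lemma comp_zr: "u \<in> Hom C B D \<Longrightarrow> A \<in> Ob C \<Longrightarrow> u \<cdot> zr A B = zr A D"
  using group_hom.hom_one[OF postcomp_hom] .

lemma inv_comp: "h \<in> Hom C A B \<Longrightarrow> f \<in> Hom C B D \<Longrightarrow> (inv\<^bsub>H B D\<^esub> f) \<cdot> h = inv\<^bsub>H A D\<^esub> (f \<cdot> h)"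
  using group_hom.hom_inv[OF precomp_hom] HomD(5) by simp

lemma comp_inv: "u \<in> Hom C B D \<Longrightarrow> f \<in> Hom C A B \<Longrightarrow> u \<cdot> (inv\<^bsub>H A B\<^esub> f) = inv\<^bsub>H A D\<^esub> (u \<cdot> f)"
  using group_hom.hom_inv[OF postcomp_hom] HomD(4) by simp

lemma comp_int_pow:
  "u \<in> Hom C B D \<Longrightarrow> f \<in> Hom C A B \<Longrightarrow> u \<cdot> (f [^]\<^bsub>H A B\<^esub> (c :: int)) = (u \<cdot> f) [^]\<^bsub>H A D\<^esub> c"
  using group_hom.hom_int_pow[OF postcomp_hom] HomD(4) by simp

lemma comp_altsum:
  assumes "u \<in> Hom C B D" "A \<in> Ob C" "\<And>i. i \<le> n \<Longrightarrow> f i \<in> Hom C A B"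
  shows "u \<cdot> altsum (H A B) f n = altsum (H A D) (\<lambda>i. u \<cdot> f i) n"
  using comm_group.hom_altsum[OF comm_group_H group_hom.homh[OF postcomp_hom[OF assms(1,2)]]
      comm_group_H] HomD[OF assms(1)] assms(2,3) by simp

lemma altsum_comp:
  assumes "h \<in> Hom C A B" "D \<in> Ob C" "\<And>i. i \<le> n \<Longrightarrow> f i \<in> Hom C B D"
  shows "altsum (H B D) f n \<cdot> h = altsum (H A D) (\<lambda>i. f i \<cdot> h) n"
  using comm_group.hom_altsum[OF comm_group_H group_hom.homh[OF precomp_hom[OF assms(1,2)]]
      comm_group_H] HomD[OF assms(1)] assms(2,3) by simp

text \<open>Composition with an arrow out of a zero object preserves neutral elements, so the
  neutral element factors through that object.\<close>

lemma zero_arrow_iff_zr: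
  assumes f: "f \<in> Hom C A B"
  shows "zero_arrow C f \<longleftrightarrow> f = zr A B"
proof -
  have ob: "A \<in> Ob C" "B \<in> Ob C" using HomD[OF f] by auto
  obtain Z where Z: "zero_object C Z" using pointed by (auto simp: pointed_def)
  obtain a where a: "a \<in> Hom C A Z" using Z ob by (auto simp: zero_object_def terminal_def)
  obtain b where b: "b \<in> Hom C Z B" using Z ob by (auto simp: zero_object_def initial_def)
  have "zero_arrow C (zr A B)"
    using zero_arrowI[OF Z zr_Hom[OF ob(1) HomD(5)[OF a]] b] comp_zr[OF b ob(1)] by simp
  then show ?thesis using zero_arrow_unique zr_Hom[OF ob] f by blast
qed

section \<open>Epimorphisms, kernels and images\<close>

lemma epicI:
  assumes e: "e \<in> Hom C A B" and z: "\<And>D a. a \<in> Hom C B D \<Longrightarrow> a \<cdot> e = zr A D \<Longrightarrow> a = zr B D"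
  shows "epic C e"
  unfolding epic_def
proof (intro conjI ballI impI)
  show "e \<in> Ar C" using HomD[OF e] by simp
  fix a b assume "a \<in> Ar C" "b \<in> Ar C" "Dom C a = Cod C e" "Dom C b = Cod C e" "Cod C a = Cod C b"
    and eq: "a \<cdot> e = b \<cdot> e"
  then have a: "a \<in> Hom C B (Cod C b)" and b: "b \<in> Hom C B (Cod C b)"
    using HomD[OF e] by (auto simp: Hom_def)
  interpret B: comm_group "H B (Cod C b)" using group_H[OF b] .
  interpret A: comm_group "H A (Cod C b)" using group_H[OF comp_Hom[OF e b]] .
  have "(a \<otimes>\<^bsub>H B (Cod C b)\<^esub> inv\<^bsub>H B (Cod C b)\<^esub> b) \<cdot> e = zr A (Cod C b)"
    using precomp[OF a inv_Hom[OF b] e] inv_comp[OF e b] eq A.r_inv comp_Hom[OF e b] by simp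
  then have "a \<otimes>\<^bsub>H B (Cod C b)\<^esub> inv\<^bsub>H B (Cod C b)\<^esub> b = zr B (Cod C b)"
    using z mult_Hom[OF a inv_Hom[OF b]] by simp
  then show "a = b"
    using a b by (metis B.inv_closed B.inv_equality B.inv_inv carrier_H)
qed

lemma kernel:
  assumes k: "is_kernel C f k" and f: "f \<in> Hom C A B"
  shows kernel_Hom: "k \<in> Hom C (Dom C k) A"
    and kernel_comp: "f \<cdot> k = zr (Dom C k) B"
    and kernel_lift: "g \<in> Hom C Y A \<Longrightarrow> f \<cdot> g = zr Y B \<Longrightarrow> \<exists>h \<in> Hom C Y (Dom C k). k \<cdot> h = g"
    and kernel_monic: "monic C k"
proof -
  have *: "k \<in> Ar C" "Cod C k = A" "zero_arrow C (f \<cdot> k)"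
    "\<And>g. g \<in> Ar C \<Longrightarrow> Cod C g = A \<Longrightarrow> zero_arrow C (f \<cdot> g) \<Longrightarrow>
      \<exists>!h. h \<in> Hom C (Dom C g) (Dom C k) \<and> k \<cdot> h = g"
    using k HomD(2)[OF f] by (auto simp: is_kernel_def joint_kernel_def)
  show kH: "k \<in> Hom C (Dom C k) A" using * by (simp add: Hom_def)
  show fk: "f \<cdot> k = zr (Dom C k) B" using * zero_arrow_iff_zr[OF comp_Hom[OF kH f]] by simp
  show "\<exists>h \<in> Hom C Y (Dom C k). k \<cdot> h = g" if g: "g \<in> Hom C Y A" "f \<cdot> g = zr Y B"
    using *(4)[of g] HomD[OF g(1)] zero_arrow_iff_zr[OF comp_Hom[OF g(1) f]] g(2) by auto
  show "monic C k"
    unfolding monic_def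
  proof (intro conjI ballI impI)
    fix a b assume "a \<in> Ar C" "b \<in> Ar C" "Cod C a = Dom C k" "Cod C b = Dom C k" "Dom C a = Dom C b"
      and eq: "k \<cdot> a = k \<cdot> b"
    then have a: "a \<in> Hom C (Dom C a) (Dom C k)" and b: "b \<in> Hom C (Dom C a) (Dom C k)"
      by (auto simp: Hom_def)
    have "f \<cdot> (k \<cdot> a) = zr (Dom C a) B"
      using comp_assoc[OF a kH f] fk zr_comp[OF a] HomD(5)[OF f] by simp
    then have "\<exists>!h. h \<in> Hom C (Dom C a) (Dom C k) \<and> k \<cdot> h = k \<cdot> a"
      using *(4)[of "k \<cdot> a"] HomD[OF comp_Hom[OF a kH]] zero_arrow_iff_zr[OF comp_Hom[OF comp_Hom[OF a kH] f]]
      by simp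
    then show "a = b" using a b eq by auto
  qed (use * in simp)
qed

lemma
  assumes q: "is_cokernel C f q" and f: "f \<in> Hom C A B"
  shows cokernel_Hom: "q \<in> Hom C B (Cod C q)"
    and cokernel_comp: "q \<cdot> f = zr A (Cod C q)"
    and cokernel_ex1: "g \<in> Hom C B D \<Longrightarrow> g \<cdot> f = zr A D \<Longrightarrow> \<exists>!h. h \<in> Hom C (Cod C q) D \<and> h \<cdot> q = g"
proof -
  have *: "q \<in> Ar C" "Dom C q = B" "zero_arrow C (q \<cdot> f)"
    "\<And>g. g \<in> Ar C \<Longrightarrow> Dom C g = B \<Longrightarrow> zero_arrow C (g \<cdot> f) \<Longrightarrow>
      \<exists>!h. h \<in> Hom C (Cod C q) (Cod C g) \<and> h \<cdot> q = g"
    using q HomD(3)[OF f] by (auto simp: is_cokernel_def)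
  show qH: "q \<in> Hom C B (Cod C q)" using * by (simp add: Hom_def)
  show "q \<cdot> f = zr A (Cod C q)" using * zero_arrow_iff_zr[OF comp_Hom[OF f qH]] by simp
  show "\<exists>!h. h \<in> Hom C (Cod C q) D \<and> h \<cdot> q = g" if g: "g \<in> Hom C B D" "g \<cdot> f = zr A D"
    using *(4)[of g] HomD[OF g(1)] zero_arrow_iff_zr[OF comp_Hom[OF f g(1)]] g(2) by auto
qed

lemma epic_if_zero_cokernel:
  assumes f: "f \<in> Hom C A B" and q: "is_cokernel C f q" and z: "zero_object C (Cod C q)"
  shows "epic C f"
proof (rule epicI[OF f])
  fix D a assume a: "a \<in> Hom C B D" "a \<cdot> f = zr A D"
  obtain h where h: "h \<in> Hom C (Cod C q) D" "h \<cdot> q = a"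
    using cokernel_ex1[OF q f a] by blast
  have "zero_arrow C (h \<cdot> q)"
    using zero_arrow_comp_left[OF zero_arrow_to[OF z cokernel_Hom[OF q f]] cokernel_Hom[OF q f] h(1)] .
  then show "a = zr B D" using h(2) zero_arrow_iff_zr[OF a(1)] by simp
qed

text \<open>Since \<open>q f = 0\<close> and \<open>f\<close> is split,
  \<open>q = q f g = 0\<close>. Then the identity and the zero arrow of the cokernel object agree
  after \<open>q\<close>, hence are equal.\<close>

lemma zero_cokernel_if_split:
  assumes f: "f \<in> Hom C A B" and q: "is_cokernel C f q" and g: "g \<in> Hom C B A" "f \<cdot> g = Idt C B"
  shows "zero_object C (Cod C q)"
proof -
  let ?Q = "Cod C q"
  note qH = cokernel_Hom[OF q f]
  have ob: "A \<in> Ob C" "B \<in> Ob C" "?Q \<in> Ob C" using HomD[OF f] HomD[OF qH] by auto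
  have q0: "q = zr B ?Q"
    using comp_assoc[OF g(1) f qH] cokernel_comp[OF q f] g(2) Idt_right[OF qH] zr_comp[OF g(1) ob(3)]
    by simp
  have "zr B ?Q \<cdot> f = zr A ?Q" using zr_comp[OF f ob(3)] .
  from cokernel_ex1[OF q f qH this[folded q0]]
  have id0: "Idt C ?Q = zr ?Q ?Q"
    using Idt_Hom[OF ob(3)] zr_Hom[OF ob(3) ob(3)] Idt_left[OF qH] zr_comp[OF qH ob(3)] q0 by auto
  have "f = zr ?Q D" if "f \<in> Hom C ?Q D" for f D
    using comp_zr[OF that ob(3)] Idt_right[OF that] id0 by simp
  moreover have "f = zr D ?Q" if "f \<in> Hom C D ?Q" for f D
    using zr_comp[OF that ob(3)] Idt_left[OF that] id0 by simp
  ultimately show ?thesis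
    using zr_Hom ob(3) unfolding zero_object_def initial_def terminal_def by metis
qed

text \<open>To see that \<open>e\<close> is epic, let \<open>a e = 0\<close> and \<open>j\<close> be
  the kernel of \<open>a\<close>. Then \<open>f\<close> factors through the monomorphism
  \<open>m j\<close>, which is the kernel of some \<open>t\<close>. As \<open>t f = 0\<close>,
  \<open>t\<close> factors through \<open>q\<close>, so \<open>t m = 0\<close> and \<open>m\<close>
  factors through \<open>m j\<close>. Therefore \<open>j\<close> is split epic, and
  \<open>a j = 0\<close> gives \<open>a = 0\<close>.\<close>

lemma image_factorization:
  assumes f: "f \<in> Hom C A B" and q: "is_cokernel C f q" and m: "is_kernel C q m"
  obtains e where "e \<in> Hom C A (Dom C m)" "f = m \<cdot> e" "epic C e"
proof -
  note qH = cokernel_Hom[OF q f]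
  note mH = kernel_Hom[OF m qH] and qm = kernel_comp[OF m qH] and mm = kernel_monic[OF m qH]
  obtain e where e: "e \<in> Hom C A (Dom C m)" "m \<cdot> e = f"
    using kernel_lift[OF m qH f cokernel_comp[OF q f]] by blast
  have "epic C e"
  proof (rule epicI[OF e(1)])
    fix D a assume a: "a \<in> Hom C (Dom C m) D" "a \<cdot> e = zr A D"
    obtain j where j: "is_kernel C a j" using kernels HomD(1)[OF a(1)] by blast
    note jH = kernel_Hom[OF j a(1)]
    obtain e' where e': "e' \<in> Hom C A (Dom C j)" "j \<cdot> e' = e"
      using kernel_lift[OF j a(1) e(1) a(2)] by blast
    note mj = comp_Hom[OF jH mH]
    have "monic C (m \<cdot> j)"
      unfolding monic_def
    proof (intro conjI ballI impI)
      show "m \<cdot> j \<in> Ar C" using HomD(1)[OF mj] .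
      fix x y assume "x \<in> Ar C" "y \<in> Ar C" "Cod C x = Dom C (m \<cdot> j)" "Cod C y = Dom C (m \<cdot> j)"
        "Dom C x = Dom C y" and eq: "m \<cdot> j \<cdot> x = m \<cdot> j \<cdot> y"
      then have x: "x \<in> Hom C (Dom C x) (Dom C j)" and y: "y \<in> Hom C (Dom C x) (Dom C j)"
        using HomD(2)[OF mj] by (auto simp: Hom_def)
      have "j \<cdot> x = j \<cdot> y"
        using monicD[OF mm mH comp_Hom[OF x jH] comp_Hom[OF y jH]] comp_assoc[OF x jH mH]
          comp_assoc[OF y jH mH] eq by simp
      then show "x = y" using monicD[OF kernel_monic[OF j a(1)] jH x y] by simp
    qed
    then obtain t where t: "is_kernel C t (m \<cdot> j)" using monic_normal by blast
    then have "t \<in> Ar C" "Dom C t = B"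
      using HomD(3)[OF mj] by (auto simp: is_kernel_def joint_kernel_def)
    then have tH: "t \<in> Hom C B (Cod C t)" by (simp add: Hom_def)
    have "t \<cdot> (m \<cdot> j) = zr (Dom C j) (Cod C t)"
      using kernel_comp[OF t tH] HomD(2)[OF mj] by simp
    then have "t \<cdot> f = zr A (Cod C t)"
      using comp_assoc[OF e'(1) mj tH] comp_assoc[OF e'(1) jH mH] e'(2) e(2) zr_comp[OF e'(1)]
        HomD(5)[OF tH] by simp
    then obtain t' where t': "t' \<in> Hom C (Cod C q) (Cod C t)" "t' \<cdot> q = t"
      using cokernel_ex1[OF q f tH] by blast
    have "t \<cdot> m = zr (Dom C m) (Cod C t)"
      using comp_assoc[OF mH qH t'(1)] t'(2) qm comp_zr[OF t'(1)] HomD(4)[OF mH] by simp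
    then obtain s where s: "s \<in> Hom C (Dom C m) (Dom C j)" "m \<cdot> j \<cdot> s = m"
      using kernel_lift[OF t tH mH] HomD(2)[OF mj] by auto
    have "j \<cdot> s = Idt C (Dom C m)"
      using monicD[OF mm mH comp_Hom[OF s(1) jH] Idt_Hom[OF HomD(4)[OF mH]]]
        comp_assoc[OF s(1) jH mH] s(2) Idt_right[OF mH] by simp
    then show "a = zr (Dom C m) D"
      using comp_assoc[OF s(1) jH a(1)] kernel_comp[OF j a(1)] Idt_right[OF a(1)]
        zr_comp[OF s(1) HomD(5)[OF a(1)]] by simp
  qed
  then show ?thesis using that e by blast
qed

text \<open>This allows arguing as if with elements: an element of \<open>B\<close> killed by the
  cokernel of \<open>f\<close> comes from \<open>A\<close>, provided its domain is projective. The
  image factorization supplies the epimorphism along which to lift.\<close>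

lemma lift_into_image:
  assumes "epi_projective Q" and f: "f \<in> Hom C A B" and q: "is_cokernel C f q"
    and x: "x \<in> Hom C Q B" "q \<cdot> x = zr Q (Cod C q)"
  obtains y where "y \<in> Hom C Q A" "f \<cdot> y = x"
proof -
  note qH = cokernel_Hom[OF q f]
  obtain m where m: "is_kernel C q m" using kernels HomD(1)[OF qH] by blast
  note mH = kernel_Hom[OF m qH]
  obtain e where e: "e \<in> Hom C A (Dom C m)" "f = m \<cdot> e" "epic C e"
    by (rule image_factorization[OF f q m])
  obtain h where h: "h \<in> Hom C Q (Dom C m)" "m \<cdot> h = x"
    using kernel_lift[OF m qH x] by blast
  obtain y where y: "y \<in> Hom C Q A" "e \<cdot> y = h"
    using assms(1) e h unfolding epi_projective_def by blast
  show ?thesis using that[OF y(1)] comp_assoc[OF y(1) e(1) mH] y(2) e(2) h(2) by simp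
qed

lemma regular_epi_if_cokernel:
  assumes q: "is_cokernel C f q"
  shows "regular_epi C q"
proof -
  have f: "f \<in> Hom C (Dom C f) (Cod C f)" using q by (simp add: is_cokernel_def Hom_def)
  note qH = cokernel_Hom[OF q f] and qf = cokernel_comp[OF q f]
  let ?z = "zr (Dom C f) (Cod C f)"
  have z: "?z \<in> Hom C (Dom C f) (Cod C f)" using zr_Hom HomD(4,5)[OF f] .
  have "is_coequalizer C f ?z q"
    unfolding is_coequalizer_def
  proof (intro conjI ballI impI)
    show "q \<cdot> f = q \<cdot> ?z" using qf comp_zr[OF qH HomD(4)[OF f]] by simp
    fix g assume "g \<in> Ar C" "Dom C g = Cod C f" and eq: "g \<cdot> f = g \<cdot> ?z"
    then have g: "g \<in> Hom C (Cod C f) (Cod C g)" by (simp add: Hom_def)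
    show "\<exists>!h. h \<in> Hom C (Cod C q) (Cod C g) \<and> h \<cdot> q = g"
      using cokernel_ex1[OF q f g] eq comp_zr[OF g HomD(4)[OF f]] by simp
  qed (use HomD[OF f] HomD[OF z] HomD[OF qH] in simp_all)
  then show ?thesis unfolding regular_epi_def by blast
qed

lemma Idt_monic: "A \<in> Ob C \<Longrightarrow> monic C (Idt C A)"
  unfolding monic_def using HomD[OF Idt_Hom] Idt_left HomI by metis

lemma Idt_cokernel_zr:
  assumes A: "A \<in> Ob C"
  shows "is_cokernel C (zr A A) (Idt C A)"
  unfolding is_cokernel_def
proof (intro conjI ballI impI)
  note I = Idt_Hom[OF A] and z = zr_Hom[OF A A]
  show "zero_arrow C (Idt C A \<cdot> zr A A)" using zero_arrow_iff_zr[OF z] Idt_left[OF z] by simp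
  fix g assume "g \<in> Ar C" "Dom C g = Cod C (zr A A)"
  then have "g \<in> Hom C A (Cod C g)" using HomD(3)[OF z] by (simp add: Hom_def)
  then show "\<exists>!h. h \<in> Hom C (Cod C (Idt C A)) (Cod C g) \<and> h \<cdot> Idt C A = g"
    using Idt_right HomD(3)[OF I] by auto
qed (use HomD[OF Idt_Hom[OF A]] HomD[OF zr_Hom[OF A A]] in simp_all)

text \<open>It puts an epimorphism of an abelian category into the form to which right exactness of
  a functor applies. The image of \<open>k\<close> is \<open>k\<close> itself; the image of
  \<open>e\<close> is the identity, as \<open>e\<close> is a cokernel and so a regular
  epimorphism.\<close>

lemma right_exact_sequence_kernel:
  assumes ep: "epic C e" and k: "is_kernel C e k"
  shows "right_exact_sequence C k e"
proof -
  have e: "e \<in> Hom C (Dom C e) (Cod C e)" using ep by (simp add: epic_def Hom_def)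
  note kH = kernel_Hom[OF k e]
  have ob: "Dom C k \<in> Ob C" "Cod C e \<in> Ob C" using HomD(4)[OF kH] HomD(5)[OF e] by auto
  note J = Idt_Hom[OF ob(1)] and I = Idt_Hom[OF ob(2)]
  obtain Z where Z: "zero_object C Z" using pointed by (auto simp: pointed_def)
  obtain t where t: "t \<in> Hom C (Cod C e) Z"
    using Z ob unfolding zero_object_def terminal_def by blast
  have "is_image C k k"
    unfolding is_image_def
    using kernel_monic[OF k e] regular_epi_if_cokernel[OF Idt_cokernel_zr[OF ob(1)]] HomD(3)[OF J]
      Idt_right[OF kH] by metis
  then have ex1: "exact_at C k e"
    unfolding exact_at_def using k HomD[OF kH] HomD[OF e] by auto
  have "is_image C e (Idt C (Cod C e))"
    unfolding is_image_def
    using Idt_monic[OF ob(2)] regular_epi_if_cokernel epic_normal[OF ep] Idt_left[OF e] HomD(2)[OF I]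
    by metis
  moreover have "is_kernel C t (Idt C (Cod C e))"
    unfolding is_kernel_def joint_kernel_def
  proof (intro conjI ballI impI)
    fix f assume "f \<in> {t}"
    then show "zero_arrow C (f \<cdot> Idt C (Cod C e))" using Idt_right[OF t] zero_arrow_to[OF Z t] by simp
  next
    fix g assume "g \<in> Ar C" "Cod C g = Dom C t"
    then have "g \<in> Hom C (Dom C g) (Cod C e)" using HomD(2)[OF t] by (simp add: Hom_def)
    then show "\<exists>!h. h \<in> Hom C (Dom C g) (Dom C (Idt C (Cod C e))) \<and> Idt C (Cod C e) \<cdot> h = g"
      using HomD(2)[OF I] Idt_left by auto
  qed (use HomD[OF t] HomD[OF I] in simp_all)
  ultimately have "exact_at C e t"
    unfolding exact_at_def using HomD[OF t] HomD[OF e] by auto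
  with ex1 show ?thesis
    unfolding right_exact_sequence_def using Z t by blast
qed

text \<open>Kernels are intersected one at a time: given the joint kernel \<open>k\<close> of the
  others, compose it with the kernel of \<open>f k\<close>.\<close>

lemma joint_kernel_exists:
  assumes "finite F" and A: "A \<in> Ob C" and F: "\<And>f. f \<in> F \<Longrightarrow> f \<in> Ar C \<and> Dom C f = A"
  shows "\<exists>k. joint_kernel C A F k"
  using assms(1) F
proof (induction F)
  case empty
  have "joint_kernel C A {} (Idt C A)"
    unfolding joint_kernel_def
  proof (intro conjI ballI impI)
    fix g assume "g \<in> Ar C" "Cod C g = A"
    then have "g \<in> Hom C (Dom C g) A" by (simp add: Hom_def)
    then show "\<exists>!h. h \<in> Hom C (Dom C g) (Dom C (Idt C A)) \<and> Idt C A \<cdot> h = g"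
      using HomD(2)[OF Idt_Hom[OF A]] Idt_left by auto
  qed (use HomD[OF Idt_Hom[OF A]] in auto)
  then show ?case by blast
next
  case (insert f F)
  obtain k where k: "joint_kernel C A F k" using insert by blast
  have f: "f \<in> Hom C A (Cod C f)" using insert.prems[of f] by (simp add: Hom_def)
  have kH: "k \<in> Hom C (Dom C k) A" using k by (auto simp: joint_kernel_def Hom_def)
  note fk = comp_Hom[OF kH f]
  obtain l where l: "is_kernel C (f \<cdot> k) l" using kernels HomD(1)[OF fk] by blast
  note lH = kernel_Hom[OF l fk]
  note kl = comp_Hom[OF lH kH]
  have "joint_kernel C A (insert f F) (k \<cdot> l)"
    unfolding joint_kernel_def
  proof (intro conjI ballI impI)
    show "k \<cdot> l \<in> Ar C" "Cod C (k \<cdot> l) = A" using HomD[OF kl] by auto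
    fix g assume g: "g \<in> insert f F"
    then have gH: "g \<in> Hom C A (Cod C g)" using insert.prems[of g] by (simp add: Hom_def)
    show "zero_arrow C (g \<cdot> (k \<cdot> l))"
    proof (cases "g = f")
      case True
      then show ?thesis
        using kernel_comp[OF l fk] comp_assoc[OF lH kH f] zero_arrow_iff_zr[OF comp_Hom[OF kl f]] by simp
    next
      case False
      then have "zero_arrow C (g \<cdot> k)" using k g by (auto simp: joint_kernel_def)
      then show ?thesis
        using zero_arrow_comp_right[OF _ comp_Hom[OF kH gH] lH] comp_assoc[OF lH kH gH] by simp
    qed
  next
    fix g assume "g \<in> Ar C" "Cod C g = A" and z: "\<forall>f \<in> insert f F. zero_arrow C (f \<cdot> g)"
    then have g: "g \<in> Hom C (Dom C g) A" by (simp add: Hom_def)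
    have "\<exists>!h. h \<in> Hom C (Dom C g) (Dom C k) \<and> k \<cdot> h = g"
      using k z HomD[OF g] by (auto simp: joint_kernel_def)
    then obtain h where h: "h \<in> Hom C (Dom C g) (Dom C k)" "k \<cdot> h = g"
      and hu: "\<And>h'. h' \<in> Hom C (Dom C g) (Dom C k) \<Longrightarrow> k \<cdot> h' = g \<Longrightarrow> h' = h" by auto
    have "(f \<cdot> k) \<cdot> h = zr (Dom C g) (Cod C f)"
      using z h zero_arrow_iff_zr[OF comp_Hom[OF g f]] comp_assoc[OF h(1) kH f] by simp
    then obtain h' where h': "h' \<in> Hom C (Dom C g) (Dom C l)" "l \<cdot> h' = h"
      using kernel_lift[OF l fk h(1)] by blast
    have "k \<cdot> l \<cdot> h' = g" using comp_assoc[OF h'(1) lH kH] h(2) h'(2) by simp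
    moreover have "h'' = h'" if "h'' \<in> Hom C (Dom C g) (Dom C l)" "k \<cdot> l \<cdot> h'' = g" for h''
    proof (rule monicD[OF kernel_monic[OF l fk] lH that(1) h'(1)])
      have "k \<cdot> (l \<cdot> h'') = g" using comp_assoc[OF that(1) lH kH] that(2) by simp
      then show "l \<cdot> h'' = l \<cdot> h'" using hu[OF comp_Hom[OF that(1) lH]] h'(2) by simp
    qed
    ultimately show "\<exists>!h. h \<in> Hom C (Dom C g) (Dom C (k \<cdot> l)) \<and> k \<cdot> l \<cdot> h = g"
      unfolding HomD(2)[OF kl] using h'(1) by blast
  qed
  then show ?case by blast
qed

end


section \<open>Simplicial objects of an abelian category\<close>

lemma simplicial_objectD:
  assumes "simplicial_object C S"
  shows "sob S n \<in> Ob C"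
    and "i \<le> Suc n \<Longrightarrow> face S n i \<in> Hom C (sob S (Suc n)) (sob S n)"
    and "i \<le> n \<Longrightarrow> degen S n i \<in> Hom C (sob S n) (sob S (Suc n))"
    and "i < j \<Longrightarrow> j \<le> n + 2 \<Longrightarrow>
      face S n i \<cdot>\<^bsub>C\<^esub> face S (Suc n) j = face S n (j - 1) \<cdot>\<^bsub>C\<^esub> face S (Suc n) i"
    and "i \<le> j \<Longrightarrow> j \<le> n \<Longrightarrow>
      degen S (Suc n) i \<cdot>\<^bsub>C\<^esub> degen S n j = degen S (Suc n) (Suc j) \<cdot>\<^bsub>C\<^esub> degen S n i"
    and "i < j \<Longrightarrow> j \<le> Suc n \<Longrightarrow>
      face S (Suc n) i \<cdot>\<^bsub>C\<^esub> degen S (Suc n) j = degen S n (j - 1) \<cdot>\<^bsub>C\<^esub> face S n i"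
    and "j \<le> n \<Longrightarrow> face S n j \<cdot>\<^bsub>C\<^esub> degen S n j = Idt C (sob S n)"
    and "j \<le> n \<Longrightarrow> face S n (Suc j) \<cdot>\<^bsub>C\<^esub> degen S n j = Idt C (sob S n)"
    and "Suc j < i \<Longrightarrow> i \<le> n + 2 \<Longrightarrow>
      face S (Suc n) i \<cdot>\<^bsub>C\<^esub> degen S (Suc n) j = degen S n j \<cdot>\<^bsub>C\<^esub> face S n (i - 1)"
  using assms unfolding simplicial_object_def by (simp, simp, simp, simp, simp, simp, simp, simp, blast)

locale simplicial_abelian = abelian_cat C H
  for C :: "('o, 'm) cat" (structure) and H :: "'o \<Rightarrow> 'o \<Rightarrow> 'm monoid" +
  fixes S :: "('o, 'm) simplicial"
  assumes simplicial: "simplicial_object C S"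
begin

abbreviation sgn_pow :: "'o \<Rightarrow> 'o \<Rightarrow> nat \<Rightarrow> 'm \<Rightarrow> 'm" where
  "sgn_pow A B i f \<equiv> f [^]\<^bsub>H A B\<^esub> ((-1) ^ i :: int)"

lemma sgn_pow_sgn_pow:
  assumes "f \<in> Hom C A B"
  shows "sgn_pow A B i (sgn_pow A B i f) = f"
proof -
  interpret comm_group "H A B" using group_H[OF assms] .
  have "((-1) ^ i :: int) * (-1) ^ i = 1" by (simp flip: power_add mult_2)
  then show ?thesis using int_pow_pow[of f "(-1) ^ i" "(-1) ^ i"] assms by simp
qed

lemma sgn_pow_zr:
  assumes "A \<in> Ob C" "B \<in> Ob C"
  shows "sgn_pow A B i (zr A B) = zr A B"
proof -
  interpret comm_group "H A B" using comm_group_H[OF assms] .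
  show ?thesis by simp
qed

lemma sgn_pow_eq_zr:
  assumes "f \<in> Hom C A B" "sgn_pow A B i f = zr A B"
  shows "f = zr A B"
  using sgn_pow_sgn_pow[OF assms(1), of i] sgn_pow_zr[OF HomD(4,5)[OF assms(1)], of i] assms(2) by simp

lemmas sob_Ob = simplicial_objectD(1)[OF simplicial]
  and face_Hom = simplicial_objectD(2)[OF simplicial]
  and degen_Hom = simplicial_objectD(3)[OF simplicial]
  and face_face = simplicial_objectD(4)[OF simplicial]
  and face_degen_less = simplicial_objectD(6)[OF simplicial]
  and face_degen_eq = simplicial_objectD(7,8)[OF simplicial]
  and face_degen_greater = simplicial_objectD(9)[OF simplicial]

section \<open>The unnormalized complex and its degeneracies\<close>

definition bd :: "nat \<Rightarrow> 'm" where
  "bd n = altsum (H (sob S (Suc n)) (sob S n)) (face S n) (Suc n)"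

lemma bd_Hom: "bd n \<in> Hom C (sob S (Suc n)) (sob S n)"
  using comm_group.altsum_closed[OF comm_group_H[OF sob_Ob sob_Ob]] face_Hom by (simp add: bd_def)

lemma bd_comp:
  "y \<in> Hom C Q (sob S (Suc n)) \<Longrightarrow> bd n \<cdot> y = altsum (H Q (sob S n)) (\<lambda>i. face S n i \<cdot> y) (Suc n)"
  unfolding bd_def by (rule altsum_comp) (auto intro: sob_Ob face_Hom)

lemma comp_bd:
  "f \<in> Hom C (sob S n) M \<Longrightarrow> f \<cdot> bd n = altsum (H (sob S (Suc n)) M) (\<lambda>i. f \<cdot> face S n i) (Suc n)"
  unfolding bd_def by (rule comp_altsum) (auto intro: sob_Ob face_Hom)

lemma face_comp: "i \<le> Suc n \<Longrightarrow> y \<in> Hom C Q (sob S (Suc n)) \<Longrightarrow> face S n i \<cdot> y \<in> Hom C Q (sob S n)"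
  using comp_Hom face_Hom by blast

lemma degen_comp: "i \<le> n \<Longrightarrow> y \<in> Hom C Q (sob S n) \<Longrightarrow> degen S n i \<cdot> y \<in> Hom C Q (sob S (Suc n))"
  using comp_Hom degen_Hom by blast

lemma bd_bd: "bd n \<cdot> bd (Suc n) = zr (sob S (Suc (Suc n))) (sob S n)"
proof -
  let ?G = "H (sob S (Suc (Suc n))) (sob S n)"
  interpret comm_group ?G using comm_group_H[OF sob_Ob sob_Ob] .
  have "bd n \<cdot> bd (Suc n) = altsum ?G (\<lambda>i. face S n i \<cdot> bd (Suc n)) (Suc n)"
    by (rule bd_comp[OF bd_Hom])
  also have "\<dots> = altsum ?G (\<lambda>i. altsum ?G (\<lambda>j. face S n i \<cdot> face S (Suc n) j) (Suc (Suc n))) (Suc n)"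
    using face_comp[OF _ face_Hom] by (intro altsum_cong altsum_closed comp_bd face_Hom) auto
  also have "\<dots> = zr (sob S (Suc (Suc n))) (sob S n)"
    using face_comp[OF _ face_Hom] face_face by (intro altsum_altsum) auto
  finally show ?thesis .
qed

lemma bd_bd_comp:
  assumes "y \<in> Hom C Q (sob S (Suc (Suc n)))"
  shows "bd n \<cdot> (bd (Suc n) \<cdot> y) = zr Q (sob S n)"
  using comp_assoc[OF assms bd_Hom bd_Hom] zr_comp[OF assms sob_Ob] by (simp add: bd_bd)

text \<open>On the Moore complex the unnormalized differential agrees with the last face only up to
  the sign \<open>(-1) ^ Suc n\<close>, which has to be corrected whenever the two complexes are
  compared.\<close>

lemma bd_comp_last:
  assumes y: "y \<in> Hom C Q (sob S (Suc n))" and z: "\<And>i. i \<le> n \<Longrightarrow> face S n i \<cdot> y = zr Q (sob S n)"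
  shows "bd n \<cdot> y = sgn_pow Q (sob S n) (Suc n) (face S n (Suc n) \<cdot> y)"
proof -
  interpret comm_group "H Q (sob S n)" using comm_group_H[OF HomD(4)[OF y] sob_Ob] .
  have "bd n \<cdot> y = altsum (H Q (sob S n)) (\<lambda>i. face S n i \<cdot> y) n \<otimes>\<^bsub>H Q (sob S n)\<^esub>
      sgn_pow Q (sob S n) (Suc n) (face S n (Suc n) \<cdot> y)"
    unfolding bd_comp[OF y] using face_comp[OF _ y] by (intro altsum_Suc) simp
  also have "altsum (H Q (sob S n)) (\<lambda>i. face S n i \<cdot> y) n = zr Q (sob S n)"
    by (rule altsum_one) (rule z)
  finally show ?thesis
    using face_comp[OF _ y, of "Suc n"] int_pow_Hom by simp
qed

text \<open>The faces \<open>d\<^sub>j\<close> and \<open>d\<^sub>j\<^sub>+\<^sub>1\<close> of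
  \<open>s\<^sub>j x\<close> both equal \<open>x\<close> and cancel; the other ones are degeneracies
  of faces of \<open>x\<close>, hence trivial. For \<open>n = 0\<close> there are no other ones and
  the condition on \<open>x\<close> is void.\<close>

lemma bd_degen_cycle:
  assumes x: "x \<in> Hom C Q (sob S n)" and j: "j \<le> n"
    and z: "\<And>l i. n = Suc l \<Longrightarrow> i \<le> n \<Longrightarrow> face S l i \<cdot> x = zr Q (sob S l)"
  shows "bd n \<cdot> (degen S n j \<cdot> x) = zr Q (sob S n)"
proof -
  let ?G = "H Q (sob S n)"
  interpret comm_group ?G using comm_group_H[OF HomD(4)[OF x] sob_Ob] .
  note dx = degen_comp[OF j x]
  define a where "a i = face S n i \<cdot> (degen S n j \<cdot> x)" for i
  have a: "a i \<in> Hom C Q (sob S n)" if "i \<le> Suc n" for i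
    unfolding a_def using face_comp[OF that dx] .
  have assoc: "a i = (face S n i \<cdot> degen S n j) \<cdot> x" if "i \<le> Suc n" for i
    unfolding a_def using comp_assoc[OF x degen_Hom[OF j] face_Hom[OF that]] by simp
  have eq: "a j = x" "a (Suc j) = x"
    using assoc[of j] assoc[of "Suc j"] face_degen_eq[OF j] Idt_left[OF x] j by simp_all
  have lo: "a i = zr Q (sob S n)" if i: "i < j" for i
  proof -
    obtain l where l: "n = Suc l" using i j by (cases n) auto
    have "a i = degen S l (j - 1) \<cdot> face S l i \<cdot> x"
      using assoc[of i] face_degen_less[OF i, of l] i j l by simp
    also have "\<dots> = degen S l (j - 1) \<cdot> (face S l i \<cdot> x)"
      using comp_assoc[OF x[unfolded l] face_Hom[of i l] degen_Hom[of "j - 1" l]] i j l by simp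
    also have "\<dots> = zr Q (sob S n)"
      using z[OF l, of i] comp_zr[OF degen_Hom HomD(4)[OF x], of "j - 1" l] i j l by simp
    finally show ?thesis .
  qed
  have hi: "a (Suc i) = zr Q (sob S n)" if i: "j < i" "i \<le> n" for i
  proof -
    obtain l where l: "n = Suc l" using i by (cases n) auto
    have "a (Suc i) = degen S l j \<cdot> face S l i \<cdot> x"
      using assoc[of "Suc i"] face_degen_greater[of j "Suc i" l] i j l by simp
    also have "\<dots> = degen S l j \<cdot> (face S l i \<cdot> x)"
      using comp_assoc[OF x[unfolded l] face_Hom[of i l] degen_Hom[of j l]] i j l by simp
    also have "\<dots> = zr Q (sob S n)"
      using z[OF l, of i] comp_zr[OF degen_Hom HomD(4)[OF x], of j l] i j l by simp
    finally show ?thesis .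
  qed
  \<comment> \<open>The second sequence of \<open>altsum_homotopy\<close> is constantly trivial
    here, since the degeneracies of the faces of \<open>x\<close> vanish.\<close>
  have "altsum ?G a (Suc n) \<otimes>\<^bsub>?G\<^esub> altsum ?G (\<lambda>i. zr Q (sob S n)) n =
      sgn_pow Q (sob S n) j (zr Q (sob S n))"
    using a lo hi eq j zr_Hom[OF HomD(4)[OF x] sob_Ob] by (intro altsum_homotopy) auto
  then have "altsum ?G a (Suc n) = zr Q (sob S n)"
    using altsum_closed[of "Suc n" a] a by (simp add: altsum_one)
  then show ?thesis using bd_comp[OF dx] by (simp add: a_def[abs_def])
qed

text \<open>In \<open>d s\<^sub>j y + s\<^sub>j d y\<close> the terms from faces below
  \<open>j\<close> vanish, the two faces of \<open>s\<^sub>j y\<close> equal to \<open>y\<close>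
  cancel, and each later face of \<open>s\<^sub>j y\<close> is offset by a term of
  \<open>s\<^sub>j d y\<close> whose index is one lower. Only \<open>s\<^sub>j d\<^sub>j y\<close>
  is left.\<close>

lemma degen_homotopy:
  assumes y: "y \<in> Hom C Q (sob S (Suc l))" and j: "j \<le> l"
    and z: "\<And>i. i < j \<Longrightarrow> face S l i \<cdot> y = zr Q (sob S l)"
  shows "(bd (Suc l) \<cdot> (degen S (Suc l) j \<cdot> y)) \<otimes>\<^bsub>H Q (sob S (Suc l))\<^esub> (degen S l j \<cdot> (bd l \<cdot> y)) =
    sgn_pow Q (sob S (Suc l)) j (degen S l j \<cdot> (face S l j \<cdot> y))"
proof -
  let ?G = "H Q (sob S (Suc l))"
  interpret comm_group ?G using comm_group_H[OF HomD(4)[OF y] sob_Ob] .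
  have j': "j \<le> Suc l" using j by simp
  note dy = degen_comp[OF j' y]
  define a where "a i = face S (Suc l) i \<cdot> (degen S (Suc l) j \<cdot> y)" for i
  define b where "b i = degen S l j \<cdot> (face S l i \<cdot> y)" for i
  have a: "a i \<in> Hom C Q (sob S (Suc l))" if "i \<le> Suc (Suc l)" for i
    unfolding a_def using face_comp[OF that dy] .
  have b: "b i \<in> Hom C Q (sob S (Suc l))" if "i \<le> Suc l" for i
    unfolding b_def using degen_comp[OF j face_comp[OF that y]] .
  have assoc: "a i = (face S (Suc l) i \<cdot> degen S (Suc l) j) \<cdot> y" if "i \<le> Suc (Suc l)" for i
    unfolding a_def using comp_assoc[OF y degen_Hom[OF j'] face_Hom[OF that]] by simp
  have eq: "a j = y" "a (Suc j) = y"
    using assoc[of j] assoc[of "Suc j"] face_degen_eq[OF j'] Idt_left[OF y] j by simp_all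
  have lo: "a i = zr Q (sob S (Suc l))" if i: "i < j" for i
  proof -
    have "a i = degen S l (j - 1) \<cdot> face S l i \<cdot> y"
      using assoc[of i] face_degen_less[OF i j'] i j by simp
    also have "\<dots> = degen S l (j - 1) \<cdot> (face S l i \<cdot> y)"
      using comp_assoc[OF y face_Hom degen_Hom, of i "j - 1"] i j by simp
    also have "\<dots> = zr Q (sob S (Suc l))"
      using z[OF i] comp_zr[OF degen_Hom HomD(4)[OF y], of "j - 1" l] i j by simp
    finally show ?thesis .
  qed
  have lo': "b i = zr Q (sob S (Suc l))" if i: "i < j" for i
    using z[OF i] comp_zr[OF degen_Hom[OF j] HomD(4)[OF y]] by (simp add: b_def)
  have hi: "a (Suc i) = b i" if i: "j < i" "i \<le> Suc l" for i
    using assoc[of "Suc i"] face_degen_greater[of j "Suc i" l] i j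
      comp_assoc[OF y face_Hom[of i l] degen_Hom[OF j]] by (simp add: b_def)
  have "altsum ?G a (Suc (Suc l)) \<otimes>\<^bsub>?G\<^esub> altsum ?G b (Suc l) = sgn_pow Q (sob S (Suc l)) j (b j)"
    using a b lo lo' hi eq j' by (intro altsum_homotopy) auto
  moreover have "altsum ?G a (Suc (Suc l)) = bd (Suc l) \<cdot> (degen S (Suc l) j \<cdot> y)"
    using bd_comp[OF dy] by (simp add: a_def[abs_def])
  moreover have "altsum ?G b (Suc l) = degen S l j \<cdot> (bd l \<cdot> y)"
    unfolding bd_comp[OF y] b_def[abs_def] using face_comp[OF _ y]
    by (intro comp_altsum[symmetric] degen_Hom[OF j] HomD(4)[OF y])
  ultimately show ?thesis by (simp add: b_def)
qed

text \<open>Replacing \<open>y\<close> by \<open>y - s\<^sub>j d\<^sub>j y\<close> kills the face \<open>d\<^sub>j\<close> and, by \<open>degen_homotopy\<close>, changes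
  \<open>y\<close> by a boundary when \<open>y\<close> is a cycle. This moves chains into the Moore complex.\<close>

lemma normalize_chain:
  assumes y: "y \<in> Hom C Q (sob S (Suc l))" and x: "bd l \<cdot> y = x"
    and z: "\<And>k i. l = Suc k \<Longrightarrow> i \<le> l \<Longrightarrow> face S k i \<cdot> x = zr Q (sob S k)"
    and "j \<le> Suc l"
  shows "\<exists>y' \<in> Hom C Q (sob S (Suc l)). (\<forall>i < j. face S l i \<cdot> y' = zr Q (sob S l)) \<and> bd l \<cdot> y' = x \<and>
    (x = zr Q (sob S l) \<longrightarrow>
      (\<exists>w \<in> Hom C Q (sob S (Suc (Suc l))). y = y' \<otimes>\<^bsub>H Q (sob S (Suc l))\<^esub> (bd (Suc l) \<cdot> w)))"
  using assms(4)
proof (induction j)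
  case 0
  note ob = HomD(4)[OF y]
  interpret comm_group "H Q (sob S (Suc l))" using group_H[OF y] .
  have "y = y \<otimes>\<^bsub>H Q (sob S (Suc l))\<^esub> (bd (Suc l) \<cdot> zr Q (sob S (Suc (Suc l))))"
    using comp_zr[OF bd_Hom ob] y by simp
  then show ?case using x y zr_Hom[OF ob sob_Ob] by auto
next
  case (Suc j)
  let ?C1 = "sob S (Suc l)"
  let ?G = "H Q ?C1"
  have j: "j \<le> l" using Suc.prems by simp
  note ob = HomD(4)[OF y]
  interpret comm_group ?G using group_H[OF y] .
  obtain y1 where y1: "y1 \<in> Hom C Q ?C1" and z1: "\<And>i. i < j \<Longrightarrow> face S l i \<cdot> y1 = zr Q (sob S l)"
    and x1: "bd l \<cdot> y1 = x"
    and w1: "x = zr Q (sob S l) \<Longrightarrow>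
      \<exists>w \<in> Hom C Q (sob S (Suc (Suc l))). y = y1 \<otimes>\<^bsub>?G\<^esub> (bd (Suc l) \<cdot> w)"
    using Suc by auto
  have xH: "x \<in> Hom C Q (sob S l)" using comp_Hom[OF y bd_Hom] x by simp
  have fy: "face S l j \<cdot> y1 \<in> Hom C Q (sob S l)" using face_comp[OF _ y1] j by simp
  define s where "s = degen S l j \<cdot> (face S l j \<cdot> y1)"
  have s: "s \<in> Hom C Q ?C1" unfolding s_def using degen_comp[OF j fy] .
  define v where "v = degen S (Suc l) j \<cdot> y1"
  have v: "v \<in> Hom C Q (sob S (Suc (Suc l)))" unfolding v_def using degen_comp[OF _ y1] j by simp
  have sx: "degen S l j \<cdot> x \<in> Hom C Q ?C1" using degen_comp[OF j xH] .
  note bv = comp_Hom[OF v bd_Hom]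
  have "(bd (Suc l) \<cdot> v) \<otimes>\<^bsub>?G\<^esub> (degen S l j \<cdot> x) = sgn_pow Q ?C1 j s"
    using degen_homotopy[OF y1 j z1] x1 by (simp add: s_def v_def)
  then have s_eq: "s = sgn_pow Q ?C1 j ((bd (Suc l) \<cdot> v) \<otimes>\<^bsub>?G\<^esub> (degen S l j \<cdot> x))"
    using sgn_pow_sgn_pow[OF s, of j] by simp
  \<comment> \<open>Up to sign, \<open>s\<close> is the sum of a boundary and
    \<open>s\<^sub>j x\<close>. The condition on the faces of \<open>x\<close> makes the latter a
    cycle, so \<open>s\<close> is a cycle and subtracting it preserves the boundary \<open>x\<close>
    of the chain.\<close>
  have bx: "bd l \<cdot> (degen S l j \<cdot> x) = zr Q (sob S l)"
    by (rule bd_degen_cycle[OF xH j]) (rule z)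
  have bs: "bd l \<cdot> s = zr Q (sob S l)"
    unfolding s_eq comp_int_pow[OF bd_Hom mult_Hom[OF bv sx]] postcomp[OF bd_Hom bv sx]
      bd_bd_comp[OF v] bx
    using comm_groupE(5)[OF comm_group_H[OF ob sob_Ob]] zr_Hom[OF ob sob_Ob] sgn_pow_zr[OF ob sob_Ob]
    by simp
  define y2 where "y2 = y1 \<otimes>\<^bsub>?G\<^esub> inv\<^bsub>?G\<^esub> s"
  have y2: "y2 \<in> Hom C Q ?C1" unfolding y2_def using mult_Hom[OF y1 inv_Hom[OF s]] .
  have comp_y2: "u \<cdot> y2 = (u \<cdot> y1) \<otimes>\<^bsub>H Q B\<^esub> inv\<^bsub>H Q B\<^esub> (u \<cdot> s)" if "u \<in> Hom C ?C1 B" for u B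
    unfolding y2_def postcomp[OF that y1 inv_Hom[OF s]] comp_inv[OF that s] ..
  have y1_eq: "y1 = y2 \<otimes>\<^bsub>?G\<^esub> s"
    using y1 s inv_Hom[OF s] by (simp add: y2_def m_assoc)
  interpret L: comm_group "H Q (sob S l)" using group_H[OF xH] .
  have "face S l i \<cdot> y2 = zr Q (sob S l)" if i: "i < Suc j" for i
  proof (cases "i = j")
    case True
    have "face S l j \<cdot> s = face S l j \<cdot> y1"
      using comp_assoc[OF fy degen_Hom[OF j] face_Hom, of j] face_degen_eq(1)[OF j] Idt_left[OF fy] j
      by (simp add: s_def)
    then show ?thesis using comp_y2[OF face_Hom] True j fy L.r_inv by simp
  next
    case False
    then have i: "i < j" using i by simp
    then obtain k where k: "l = Suc k" using j by (cases l) auto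
    have hom: "face S k i \<in> Hom C (sob S l) (sob S k)" "degen S k (j - 1) \<in> Hom C (sob S k) (sob S l)"
      "face S k (j - 1) \<in> Hom C (sob S l) (sob S k)"
      using face_Hom degen_Hom i j k by auto
    have "face S l i \<cdot> s = (face S l i \<cdot> degen S l j) \<cdot> (face S l j \<cdot> y1)"
      using comp_assoc[OF fy degen_Hom[OF j] face_Hom, of i] i j by (simp add: s_def)
    also have "\<dots> = degen S k (j - 1) \<cdot> (face S k i \<cdot> (face S l j \<cdot> y1))"
      using face_degen_less[OF i, of k] comp_assoc[OF fy hom(1,2)] j k by simp
    \<comment> \<open>Commuting the faces brings \<open>d\<^sub>i\<close> next to \<open>y1\<close>,
      so faces killed earlier stay killed.\<close>
    also have "face S k i \<cdot> (face S l j \<cdot> y1) = face S k (j - 1) \<cdot> (face S l i \<cdot> y1)"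
      using comp_assoc[OF y1 face_Hom[of j l] hom(1)] comp_assoc[OF y1 face_Hom[of i l] hom(3)]
        face_face[OF i, of k] i j k by simp
    also have "\<dots> = zr Q (sob S k)" using z1[OF i] comp_zr[OF hom(3) ob] by simp
    also have "degen S k (j - 1) \<cdot> zr Q (sob S k) = zr Q (sob S l)" using comp_zr[OF hom(2) ob] .
    finally have "face S l i \<cdot> s = zr Q (sob S l)" .
    then show ?thesis using comp_y2[OF face_Hom, of i] i j z1[OF i] zr_Hom[OF ob sob_Ob] by simp
  qed
  moreover have "bd l \<cdot> y2 = x" using comp_y2[OF bd_Hom] bs x1 xH by simp
  moreover have "\<exists>w \<in> Hom C Q (sob S (Suc (Suc l))). y = y2 \<otimes>\<^bsub>?G\<^esub> (bd (Suc l) \<cdot> w)"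
    if x0: "x = zr Q (sob S l)"
  proof -
    obtain w where w: "w \<in> Hom C Q (sob S (Suc (Suc l)))" "y = y1 \<otimes>\<^bsub>?G\<^esub> (bd (Suc l) \<cdot> w)"
      using w1[OF x0] by blast
    let ?v = "sgn_pow Q (sob S (Suc (Suc l))) j v"
    have sv: "?v \<in> Hom C Q (sob S (Suc (Suc l)))" using int_pow_Hom[OF v] .
    \<comment> \<open>With \<open>x\<close> trivial, the homotopy formula exhibits \<open>s\<close>
      itself as a boundary, so \<open>y\<close> and \<open>y2\<close> are homologous.\<close>
    have "s = bd (Suc l) \<cdot> ?v"
      using s_eq comp_zr[OF degen_Hom[OF j] ob] bv comp_int_pow[OF bd_Hom v] by (simp add: x0)
    then have "y = y2 \<otimes>\<^bsub>?G\<^esub> (bd (Suc l) \<cdot> (?v \<otimes>\<^bsub>H Q (sob S (Suc (Suc l)))\<^esub> w))"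
      using w(2) y1_eq postcomp[OF bd_Hom sv w(1)] y2 comp_Hom[OF w(1) bd_Hom] comp_Hom[OF sv bd_Hom]
      by (simp add: m_assoc)
    then show ?thesis using mult_Hom[OF sv w(1)] by blast
  qed
  ultimately show ?case using y2 by blast
qed

end


section \<open>Moore homology, contractions and cohomology\<close>

context simplicial_abelian
begin

section \<open>The Moore complex on generalized elements\<close>

abbreviation "N n \<equiv> moore_ob C S n"
abbreviation "\<iota> n \<equiv> moore_incl C S n"
abbreviation "\<delta> n \<equiv> moore_diff C S n"
abbreviation "Z n \<equiv> Dom C (moore_cycles C S n)"
abbreviation "z n \<equiv> moore_cycles C S n"
abbreviation "b n \<equiv> moore_boundary C S n"

text \<open>In degree 0 the family of faces is empty, so the truncated index \<open>n - 1\<close>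
  does no harm there.\<close>

lemma moore_incl_joint_kernel: "joint_kernel C (sob S n) (face S (n - 1) ` {..<n}) (\<iota> n)"
proof -
  have "\<exists>k. joint_kernel C (sob S n) (face S (n - 1) ` {..<n}) k"
  proof (rule joint_kernel_exists)
    fix f assume "f \<in> face S (n - 1) ` {..<n}"
    then obtain i where i: "i < n" "f = face S (n - 1) i" by auto
    then obtain l where "n = Suc l" by (cases n) auto
    then show "f \<in> Ar C \<and> Dom C f = sob S n" using HomD[OF face_Hom, of i l] i by simp
  qed (simp_all add: sob_Ob)
  then show ?thesis unfolding moore_incl_def by (rule someI_ex)
qed

lemma moore_incl_Hom: "\<iota> n \<in> Hom C (N n) (sob S n)"
  using moore_incl_joint_kernel[of n] by (simp add: joint_kernel_def moore_ob_def Hom_def)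

lemma N_Ob: "N n \<in> Ob C"
  using HomD(4)[OF moore_incl_Hom] .

lemma moore_incl_ex1:
  assumes y: "y \<in> Hom C Q (sob S n)"
    and zero: "\<And>l i. n = Suc l \<Longrightarrow> i \<le> l \<Longrightarrow> face S l i \<cdot> y = zr Q (sob S l)"
  shows "\<exists>!h. h \<in> Hom C Q (N n) \<and> \<iota> n \<cdot> h = y"
proof -
  have "zero_arrow C (f \<cdot> y)" if f: "f \<in> face S (n - 1) ` {..<n}" for f
  proof -
    obtain i where i: "i < n" "f = face S (n - 1) i" using f by auto
    then obtain l where l: "n = Suc l" by (cases n) auto
    show ?thesis
      using zero_arrow_iff_zr[OF comp_Hom[OF y[unfolded l] face_Hom[of i l]]] zero[OF l, of i] i l by simp
  qed
  then have "\<exists>!h. h \<in> Hom C (Dom C y) (Dom C (\<iota> n)) \<and> \<iota> n \<cdot> h = y"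
    using moore_incl_joint_kernel[of n] HomD(1,3)[OF y] unfolding joint_kernel_def by blast
  then show ?thesis using HomD(2)[OF y] by (simp add: moore_ob_def)
qed

lemma face_moore_incl:
  assumes "i \<le> l"
  shows "face S l i \<cdot> \<iota> (Suc l) = zr (N (Suc l)) (sob S l)"
  using moore_incl_joint_kernel[of "Suc l"] assms
    zero_arrow_iff_zr[OF comp_Hom[OF moore_incl_Hom face_Hom], of i l]
  by (auto simp: joint_kernel_def)

lemma face_moore_incl_comp:
  assumes "i \<le> l" and h: "h \<in> Hom C Q (N (Suc l))"
  shows "face S l i \<cdot> (\<iota> (Suc l) \<cdot> h) = zr Q (sob S l)"
  using comp_assoc[OF h moore_incl_Hom face_Hom[of i l]] face_moore_incl assms zr_comp[OF h sob_Ob]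
  by simp

lemma moore_incl_cancel:
  assumes "h \<in> Hom C Q (N n)" "k \<in> Hom C Q (N n)" "\<iota> n \<cdot> h = \<iota> n \<cdot> k"
  shows "h = k"
proof -
  have "\<exists>!h'. h' \<in> Hom C Q (N n) \<and> \<iota> n \<cdot> h' = \<iota> n \<cdot> h"
    using comp_Hom[OF assms(1) moore_incl_Hom] face_moore_incl_comp assms(1)
    by (intro moore_incl_ex1) auto
  then show ?thesis using assms by auto
qed

lemma
  shows moore_diff_Suc_Hom: "\<delta> (Suc n) \<in> Hom C (N (Suc n)) (N n)"
    and moore_incl_diff: "\<iota> n \<cdot> \<delta> (Suc n) = face S n (Suc n) \<cdot> \<iota> (Suc n)"
proof -
  have "\<exists>!d. d \<in> Hom C (N (Suc n)) (N n) \<and> \<iota> n \<cdot> d = face S n (Suc n) \<cdot> \<iota> (Suc n)"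
  proof (rule moore_incl_ex1)
    show "face S n (Suc n) \<cdot> \<iota> (Suc n) \<in> Hom C (N (Suc n)) (sob S n)"
      using comp_Hom[OF moore_incl_Hom face_Hom] by simp
    fix l i assume n: "n = Suc l" and i: "i \<le> l"
    have f: "face S l i \<in> Hom C (sob S n) (sob S l)" "face S n (Suc n) \<in> Hom C (sob S (Suc n)) (sob S n)"
      "face S l n \<in> Hom C (sob S n) (sob S l)" "face S n i \<in> Hom C (sob S (Suc n)) (sob S n)"
      using face_Hom i n by auto
    \<comment> \<open>By the simplicial identity
      \<open>d\<^sub>i d\<^sub>n\<^sub>+\<^sub>1 = d\<^sub>n d\<^sub>i\<close>, and
      \<open>d\<^sub>i\<close> kills the Moore object.\<close>
    have "face S l i \<cdot> (face S n (Suc n) \<cdot> \<iota> (Suc n)) = face S l n \<cdot> (face S n i \<cdot> \<iota> (Suc n))"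
      using comp_assoc[OF moore_incl_Hom f(2,1)] comp_assoc[OF moore_incl_Hom f(4,3)]
        face_face[of i "Suc n" l] i n by simp
    also have "\<dots> = zr (N (Suc n)) (sob S l)"
      using face_moore_incl[of i n] i n comp_zr[OF f(3) N_Ob] by simp
    finally show "face S l i \<cdot> (face S n (Suc n) \<cdot> \<iota> (Suc n)) = zr (N (Suc n)) (sob S l)" .
  qed
  from theI'[OF this]
  show "\<delta> (Suc n) \<in> Hom C (N (Suc n)) (N n)" "\<iota> n \<cdot> \<delta> (Suc n) = face S n (Suc n) \<cdot> \<iota> (Suc n)"
    by simp_all
qed

lemma moore_diff_0: "\<delta> 0 \<in> Hom C (N 0) (Cod C (\<delta> 0))" "zero_object C (Cod C (\<delta> 0))"
proof -
  obtain W where W: "zero_object C W" using pointed by (auto simp: pointed_def)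
  obtain t where t: "t \<in> Hom C (N 0) W" using W N_Ob unfolding zero_object_def terminal_def by blast
  have "\<exists>z. z \<in> Ar C \<and> Dom C z = N 0 \<and> zero_object C (Cod C z)"
    using HomD[OF t] W by auto
  from someI_ex[OF this] show "\<delta> 0 \<in> Hom C (N 0) (Cod C (\<delta> 0))" "zero_object C (Cod C (\<delta> 0))"
    by (simp_all add: Hom_def)
qed

lemma moore_diff_Hom: "\<delta> n \<in> Hom C (N n) (Cod C (\<delta> n))"
  using moore_diff_0(1) moore_diff_Suc_Hom HomD(3)[OF moore_diff_Suc_Hom] by (cases n) simp_all

text \<open>Moore cycles are described inside \<open>S\<^sub>k\<close>, uniformly in the degree: for
  \<open>k = 0\<close> both sides hold, as the differential ends in a zero object; for
  \<open>k > 0\<close> one cancels the monic inclusion of the Moore object.\<close>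

lemma moore_diff_comp_eq_zr_iff:
  assumes h: "h \<in> Hom C Q (N k)"
  shows "\<delta> k \<cdot> h = zr Q (Cod C (\<delta> k)) \<longleftrightarrow>
    (\<forall>l. k = Suc l \<longrightarrow> face S l k \<cdot> (\<iota> k \<cdot> h) = zr Q (sob S l))"
proof (cases k)
  case 0
  then show ?thesis
    using zero_arrow_to[OF moore_diff_0(2)] comp_Hom[OF h moore_diff_Hom]
      zero_arrow_iff_zr[OF comp_Hom[OF h moore_diff_Hom]] by simp
next
  case (Suc l)
  note h' = h[unfolded Suc]
  note dh = comp_Hom[OF h' moore_diff_Suc_Hom]
  have "\<iota> l \<cdot> (\<delta> (Suc l) \<cdot> h) = face S l (Suc l) \<cdot> (\<iota> (Suc l) \<cdot> h)"
    using comp_assoc[OF h' moore_diff_Suc_Hom moore_incl_Hom] moore_incl_diff[of l]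
      comp_assoc[OF h' moore_incl_Hom face_Hom] by simp
  moreover have "\<iota> l \<cdot> (\<delta> (Suc l) \<cdot> h) = zr Q (sob S l) \<longleftrightarrow> \<delta> (Suc l) \<cdot> h = zr Q (N l)"
    using moore_incl_cancel[OF dh zr_Hom[OF HomD(4)[OF h] N_Ob]] comp_zr[OF moore_incl_Hom HomD(4)[OF h]]
    by auto
  ultimately show ?thesis using Suc HomD(3)[OF moore_diff_Suc_Hom] by simp
qed

lemma moore_cycles_kernel: "is_kernel C (\<delta> n) (z n)"
  unfolding moore_cycles_def using kernels[OF HomD(1)[OF moore_diff_Hom]] by (rule someI_ex)

lemmas moore_cycles = kernel[OF moore_cycles_kernel moore_diff_Hom]

lemma
  shows moore_boundary_Hom: "b n \<in> Hom C (N (Suc n)) (Z n)"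
    and moore_cycles_boundary: "z n \<cdot> b n = \<delta> (Suc n)"
proof -
  have "\<delta> n \<cdot> \<delta> (Suc n) = zr (N (Suc n)) (Cod C (\<delta> n))"
    unfolding moore_diff_comp_eq_zr_iff[OF moore_diff_Suc_Hom]
  proof (intro allI impI)
    fix l assume n: "n = Suc l"
    have f: "face S l n \<in> Hom C (sob S n) (sob S l)" "face S n (Suc n) \<in> Hom C (sob S (Suc n)) (sob S n)"
      "face S n n \<in> Hom C (sob S (Suc n)) (sob S n)"
      using face_Hom n by auto
    \<comment> \<open>Since
      \<open>d\<^sub>n d\<^sub>n\<^sub>+\<^sub>1 = d\<^sub>n d\<^sub>n\<close>, the composite passes
      through the face \<open>d\<^sub>n\<close>, which kills the Moore object of degree
      \<open>n + 1\<close>.\<close>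
    have "face S l n \<cdot> (\<iota> n \<cdot> \<delta> (Suc n)) = face S l n \<cdot> (face S n n \<cdot> \<iota> (Suc n))"
      unfolding moore_incl_diff
      using comp_assoc[OF moore_incl_Hom f(2,1)] comp_assoc[OF moore_incl_Hom f(3,1)]
        face_face[of n "Suc n" l] n by simp
    then show "face S l n \<cdot> (\<iota> n \<cdot> \<delta> (Suc n)) = zr (N (Suc n)) (sob S l)"
      using face_moore_incl[of n n] comp_zr[OF f(1) N_Ob] by simp
  qed
  from moore_cycles(3)[OF moore_diff_Suc_Hom this]
  have "\<exists>!b. b \<in> Hom C (N (Suc n)) (Z n) \<and> z n \<cdot> b = \<delta> (Suc n)"
    using monicD[OF moore_cycles(4,1)] by metis
  from theI'[OF this] show "b n \<in> Hom C (N (Suc n)) (Z n)" "z n \<cdot> b n = \<delta> (Suc n)"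
    by (simp_all add: moore_boundary_def)
qed

lemma moore_homology_cokernel:
  obtains q where "is_cokernel C (b n) q" "moore_homology C n S = Cod C q"
  using someI_ex[OF cokernels[OF HomD(1)[OF moore_boundary_Hom[of n]]]] by (auto simp: moore_homology_def)

lemma moore_incl_cycles_boundary:
  assumes g: "g \<in> Hom C Q (N (Suc n))"
  shows "\<iota> n \<cdot> (z n \<cdot> (b n \<cdot> g)) = face S n (Suc n) \<cdot> (\<iota> (Suc n) \<cdot> g)"
  using comp_assoc[OF g moore_boundary_Hom moore_cycles(1)] moore_cycles_boundary[of n]
    comp_assoc[OF g moore_diff_Suc_Hom moore_incl_Hom] moore_incl_diff[of n]
    comp_assoc[OF g moore_incl_Hom face_Hom] by simp

section \<open>Exactness tested by arrows, and contractions\<close>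

definition cycle :: "'o \<Rightarrow> nat \<Rightarrow> 'm \<Rightarrow> bool" where
  "cycle Q k x \<longleftrightarrow> x \<in> Hom C Q (sob S k) \<and> (\<forall>l. k = Suc l \<longrightarrow> bd l \<cdot> x = zr Q (sob S l))"

text \<open>Exactness in degree \<open>k\<close> of the complex of arrows from \<open>Q\<close> into
  the unnormalized complex; in degree 0 every arrow counts as a cycle.\<close>

definition exact_for :: "'o \<Rightarrow> nat \<Rightarrow> bool" where
  "exact_for Q k \<longleftrightarrow> (\<forall>x. cycle Q k x \<longrightarrow> (\<exists>y \<in> Hom C Q (sob S (Suc k)). bd k \<cdot> y = x))"

text \<open>Vanishing of the \<open>k\<close>-th cohomology of the cochain complex of arrows into
  \<open>M\<close>; in degree 0 there are no coboundaries but zero.\<close>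

definition coexact_for :: "'o \<Rightarrow> nat \<Rightarrow> bool" where
  "coexact_for M k \<longleftrightarrow> (\<forall>f \<in> Hom C (sob S k) M. f \<cdot> bd k = zr (sob S (Suc k)) M \<longrightarrow>
     (case k of 0 \<Rightarrow> f = zr (sob S 0) M | Suc l \<Rightarrow> \<exists>g \<in> Hom C (sob S l) M. f = g \<cdot> bd l))"

text \<open>The equation \<open>d h + h d = 1\<close> in degrees up to \<open>n\<close>, with the
  second summand trivial in degree 0. The values of \<open>h\<close> above \<open>n\<close> are
  arbitrary.\<close>

definition contraction :: "nat \<Rightarrow> (nat \<Rightarrow> 'm) \<Rightarrow> bool" where
  "contraction n h \<longleftrightarrow> (\<forall>k \<le> n. h k \<in> Hom C (sob S k) (sob S (Suc k)) \<and>
     (bd k \<cdot> h k) \<otimes>\<^bsub>H (sob S k) (sob S k)\<^esub>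
       (case k of 0 \<Rightarrow> zr (sob S 0) (sob S 0) | Suc l \<Rightarrow> h l \<cdot> bd l) = Idt C (sob S k))"

text \<open>A cycle is moved into the Moore cycles modulo a boundary and then lifted along
  \<open>b k\<close>, which is epic because its cokernel vanishes.\<close>

lemma exact_for_if_moore_zero:
  assumes zero: "zero_object C (moore_homology C k S)" and Q: "Q \<in> Ob C" "epi_projective Q"
  shows "exact_for Q k"
  unfolding exact_for_def
proof (intro allI impI)
  fix x assume x: "cycle Q k x"
  let ?G = "H Q (sob S k)"
  have xH: "x \<in> Hom C Q (sob S k)" using x by (simp add: cycle_def)
  interpret comm_group ?G using group_H[OF xH] .
  obtain x' w where x': "x' \<in> Hom C Q (sob S k)" and w: "w \<in> Hom C Q (sob S (Suc k))"
    and xw: "x = x' \<otimes>\<^bsub>?G\<^esub> (bd k \<cdot> w)"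
    and lo: "\<And>l i. k = Suc l \<Longrightarrow> i \<le> l \<Longrightarrow> face S l i \<cdot> x' = zr Q (sob S l)"
    and hi: "\<And>l. k = Suc l \<Longrightarrow> face S l k \<cdot> x' = zr Q (sob S l)"
  proof (cases k)
    case 0
    have "x = x \<otimes>\<^bsub>?G\<^esub> (bd k \<cdot> zr Q (sob S (Suc k)))"
      using comp_zr[OF bd_Hom Q(1)] xH by simp
    then show ?thesis using that[OF xH zr_Hom[OF Q(1) sob_Ob]] 0 by simp
  next
    case (Suc l)
    have "bd l \<cdot> x = zr Q (sob S l)" using x Suc by (simp add: cycle_def)
    then obtain x' where x': "x' \<in> Hom C Q (sob S (Suc l))"
      "\<And>i. i < Suc l \<Longrightarrow> face S l i \<cdot> x' = zr Q (sob S l)" "bd l \<cdot> x' = zr Q (sob S l)"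
      and w: "\<exists>w \<in> Hom C Q (sob S (Suc (Suc l))). x = x' \<otimes>\<^bsub>H Q (sob S (Suc l))\<^esub> (bd (Suc l) \<cdot> w)"
      using normalize_chain[OF xH[unfolded Suc], of "zr Q (sob S l)" "Suc l"]
        comp_zr[OF face_Hom Q(1)] by auto
    \<comment> \<open>After normalization only the last face contributes to the boundary, so the
      cycle condition kills that face as well.\<close>
    have "sgn_pow Q (sob S l) (Suc l) (face S l (Suc l) \<cdot> x') = zr Q (sob S l)"
      using bd_comp_last[OF x'(1)] x'(2,3) by simp
    then have "face S l (Suc l) \<cdot> x' = zr Q (sob S l)"
      using sgn_pow_eq_zr face_comp[OF _ x'(1)] by blast
    moreover obtain w where "w \<in> Hom C Q (sob S (Suc k))" "x = x' \<otimes>\<^bsub>?G\<^esub> (bd k \<cdot> w)"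
      using w Suc by auto
    ultimately show ?thesis using x' Suc by (intro that[of x' w]) auto
  qed
  obtain h where h: "h \<in> Hom C Q (N k)" "\<iota> k \<cdot> h = x'"
    using moore_incl_ex1[OF x' lo] by blast
  obtain h' where h': "h' \<in> Hom C Q (Z k)" "z k \<cdot> h' = h"
    using moore_cycles(3)[OF h(1)] moore_diff_comp_eq_zr_iff[OF h(1)] h(2) hi by blast
  obtain q where "is_cokernel C (b k) q" "moore_homology C k S = Cod C q"
    by (rule moore_homology_cokernel)
  then have "epic C (b k)" using epic_if_zero_cokernel[OF moore_boundary_Hom] zero by simp
  then obtain g where g: "g \<in> Hom C Q (N (Suc k))" "b k \<cdot> g = h'"
    using Q(2) moore_boundary_Hom h'(1) unfolding epi_projective_def by blast
  let ?y = "\<iota> (Suc k) \<cdot> g"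
  have y: "?y \<in> Hom C Q (sob S (Suc k))" using comp_Hom[OF g(1) moore_incl_Hom] .
  have "face S k (Suc k) \<cdot> ?y = x'"
    using moore_incl_cycles_boundary[OF g(1)] g(2) h'(2) h(2) by simp
  then have "bd k \<cdot> ?y = sgn_pow Q (sob S k) (Suc k) x'"
    using bd_comp_last[OF y] face_moore_incl_comp[OF _ g(1)] by simp
  \<comment> \<open>The lift has last face \<open>x'\<close>, so its boundary is \<open>x'\<close>
    up to the sign \<open>(-1) ^ Suc k\<close>; the sign is moved into the argument.\<close>
  then have x'_eq: "x' = bd k \<cdot> sgn_pow Q (sob S (Suc k)) (Suc k) ?y"
    using comp_int_pow[OF bd_Hom y] sgn_pow_sgn_pow[OF x'] by (simp del: power_Suc)
  note sy = int_pow_Hom[OF y]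
  show "\<exists>y \<in> Hom C Q (sob S (Suc k)). bd k \<cdot> y = x"
    using postcomp[OF bd_Hom sy w] mult_Hom[OF sy w] x'_eq xw by metis
qed

text \<open>The inclusion of the Moore cycles is the universal cycle to test. Writing it as the
  boundary of a normalized chain produces a section \<open>g\<close> of \<open>b k\<close>, so the
  cokernel of \<open>b k\<close> vanishes.\<close>

lemma moore_zero_if_exact_for:
  assumes ex: "exact_for (Z k) k"
  shows "zero_object C (moore_homology C k S)"
proof -
  let ?x = "\<iota> k \<cdot> z k"
  note zH = moore_cycles(1)[of k]
  note ob = HomD(4)[OF zH]
  have x: "?x \<in> Hom C (Z k) (sob S k)" using comp_Hom[OF zH moore_incl_Hom] .
  have zero: "face S l i \<cdot> ?x = zr (Z k) (sob S l)" if l: "k = Suc l" and i: "i \<le> k" for l i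
  proof (cases "i = k")
    case True
    then show ?thesis
      using moore_diff_comp_eq_zr_iff[OF zH] moore_cycles(2) l by blast
  next
    case False
    then show ?thesis using face_moore_incl_comp[of i l "z k"] zH l i by simp
  qed
  have "bd l \<cdot> ?x = zr (Z k) (sob S l)" if l: "k = Suc l" for l
  proof -
    interpret comm_group "H (Z k) (sob S l)" using comm_group_H[OF ob sob_Ob] .
    show ?thesis
      unfolding bd_comp[OF x[unfolded l], folded l] using zero[OF l] l by (intro altsum_one) simp
  qed
  then obtain y where y: "y \<in> Hom C (Z k) (sob S (Suc k))" "bd k \<cdot> y = ?x"
    using ex x unfolding exact_for_def cycle_def by blast
  obtain y' where y': "y' \<in> Hom C (Z k) (sob S (Suc k))"
    "\<And>i. i < Suc k \<Longrightarrow> face S k i \<cdot> y' = zr (Z k) (sob S k)" "bd k \<cdot> y' = ?x"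
    using normalize_chain[OF y, of "Suc k"] zero by auto
  \<comment> \<open>The sign turns the boundary of \<open>y'\<close> into its last face.\<close>
  define y'' where "y'' = sgn_pow (Z k) (sob S (Suc k)) (Suc k) y'"
  have y'': "y'' \<in> Hom C (Z k) (sob S (Suc k))" unfolding y''_def using int_pow_Hom[OF y'(1)] .
  have f: "face S k i \<cdot> y'' = sgn_pow (Z k) (sob S k) (Suc k) (face S k i \<cdot> y')" if "i \<le> Suc k" for i
    unfolding y''_def using comp_int_pow[OF face_Hom[OF that] y'(1)] .
  have "\<exists>!g. g \<in> Hom C (Z k) (N (Suc k)) \<and> \<iota> (Suc k) \<cdot> g = y''"
    using f y'(2) sgn_pow_zr[OF ob sob_Ob] by (intro moore_incl_ex1[OF y'']) (simp del: power_Suc)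
  then obtain g where g: "g \<in> Hom C (Z k) (N (Suc k))" "\<iota> (Suc k) \<cdot> g = y''" by blast
  have "face S k (Suc k) \<cdot> y'' = ?x"
    using f[of "Suc k"] bd_comp_last[OF y'(1)] y'(2,3) by simp
  then have "\<iota> k \<cdot> (z k \<cdot> (b k \<cdot> g)) = ?x"
    using moore_incl_cycles_boundary[OF g(1)] g(2) by simp
  note bg = comp_Hom[OF g(1) moore_boundary_Hom]
  from \<open>\<iota> k \<cdot> (z k \<cdot> (b k \<cdot> g)) = ?x\<close> have "z k \<cdot> (b k \<cdot> g) = z k"
    using moore_incl_cancel[OF comp_Hom[OF bg zH] zH] by simp
  then have "b k \<cdot> g = Idt C (Z k)"
    using monicD[OF moore_cycles(4,1) bg Idt_Hom[OF ob]] Idt_right[OF zH] by simp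
  moreover obtain q where "is_cokernel C (b k) q" "moore_homology C k S = Cod C q"
    by (rule moore_homology_cokernel)
  ultimately show ?thesis using zero_cokernel_if_split[OF moore_boundary_Hom _ g(1)] by simp
qed

text \<open>The next component of \<open>h\<close> lifts the universal cycle \<open>1 - h d\<close>
  on \<open>sob S (Suc n)\<close> along \<open>bd (Suc n)\<close>; this is why exactness in degree
  \<open>k\<close> is required only at the test object \<open>sob S k\<close>.\<close>

lemma contraction_exists:
  assumes "\<And>k. k \<le> n \<Longrightarrow> exact_for (sob S k) k"
  shows "\<exists>h. contraction n h"
  using assms
proof (induction n)
  case 0
  interpret comm_group "H (sob S 0) (sob S 0)" using comm_group_H[OF sob_Ob sob_Ob] .
  have "cycle (sob S 0) 0 (Idt C (sob S 0))" using Idt_Hom[OF sob_Ob] by (simp add: cycle_def)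
  then obtain y where "y \<in> Hom C (sob S 0) (sob S (Suc 0))" "bd 0 \<cdot> y = Idt C (sob S 0)"
    using 0[of 0] by (auto simp: exact_for_def)
  then have "contraction 0 (\<lambda>_. y)"
    using Idt_Hom[OF sob_Ob] by (simp add: contraction_def)
  then show ?case by blast
next
  case (Suc n)
  then obtain h where h: "contraction n h" by auto
  let ?C = "sob S (Suc n)" and ?D = "sob S n"
  let ?G = "H ?C ?C" and ?K = "H ?C ?D"
  have hn: "h n \<in> Hom C ?D ?C" using h by (simp add: contraction_def)
  note I = Idt_Hom[OF sob_Ob[of "Suc n"]]
  interpret G: comm_group ?G using comm_group_H[OF sob_Ob sob_Ob] .
  interpret K: comm_group ?K using comm_group_H[OF sob_Ob sob_Ob] .
  have hb: "h n \<cdot> bd n \<in> Hom C ?C ?C" using comp_Hom[OF bd_Hom hn] .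
  note bhb = comp_Hom[OF hb bd_Hom]
  \<comment> \<open>From \<open>d h + h d = 1\<close> one degree below and \<open>d d = 0\<close> it
    follows that \<open>d h d = d\<close>; this makes \<open>1 - h d\<close> a cycle.\<close>
  have bhb_eq: "bd n \<cdot> (h n \<cdot> bd n) = bd n"
  proof -
    note bh = comp_Hom[OF hn bd_Hom]
    define c where "c = (case n of 0 \<Rightarrow> zr (sob S 0) (sob S 0) | Suc l \<Rightarrow> h l \<cdot> bd l)"
    have eq: "(bd n \<cdot> h n) \<otimes>\<^bsub>H ?D ?D\<^esub> c = Idt C ?D"
      using h by (simp add: contraction_def c_def)
    have c: "c \<in> Hom C ?D ?D"
      using h comp_Hom[OF bd_Hom] zr_Hom[OF sob_Ob sob_Ob]
      by (auto simp: c_def contraction_def split: nat.split)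
    have "c \<cdot> bd n = zr ?C ?D"
    proof (cases n)
      case 0
      then show ?thesis using zr_comp[OF bd_Hom sob_Ob] by (simp add: c_def)
    next
      case (Suc l)
      have hl: "h l \<in> Hom C (sob S l) ?D" using h Suc by (auto simp: contraction_def)
      show ?thesis
        using comp_assoc[OF bd_Hom bd_Hom hl[unfolded Suc]] comp_zr[OF hl[unfolded Suc] sob_Ob]
        by (simp add: c_def Suc bd_bd)
    qed
    then have "bd n = (bd n \<cdot> h n) \<cdot> bd n"
      using precomp[OF bh c bd_Hom] eq Idt_left[OF bd_Hom] comp_Hom[OF bd_Hom bh] by simp
    then show ?thesis using comp_assoc[OF bd_Hom hn bd_Hom] by simp
  qed
  define x where "x = Idt C ?C \<otimes>\<^bsub>?G\<^esub> inv\<^bsub>?G\<^esub> (h n \<cdot> bd n)"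
  have x: "x \<in> Hom C ?C ?C" unfolding x_def using mult_Hom[OF I inv_Hom[OF hb]] .
  have "bd n \<cdot> x = zr ?C ?D"
    unfolding x_def postcomp[OF bd_Hom I inv_Hom[OF hb]] comp_inv[OF bd_Hom hb] bhb_eq Idt_right[OF bd_Hom]
    using K.r_inv bd_Hom by simp
  then have "cycle ?C (Suc n) x" using x by (simp add: cycle_def)
  then obtain y where y: "y \<in> Hom C ?C (sob S (Suc (Suc n)))" "bd (Suc n) \<cdot> y = x"
    using Suc.prems[of "Suc n"] by (auto simp: exact_for_def)
  have "x \<otimes>\<^bsub>?G\<^esub> (h n \<cdot> bd n) = Idt C ?C"
    using I hb inv_Hom[OF hb] by (simp add: x_def G.m_assoc)
  then have "contraction (Suc n) (h(Suc n := y))"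
    using h y by (auto simp: contraction_def le_Suc_eq split: nat.split)
  then show ?case by blast
qed

text \<open>A cycle satisfies \<open>x = d h x + h d x = d (h x)\<close>. No lifting occurs, so
  \<open>Q\<close> is arbitrary.\<close>

lemma exact_for_if_contraction:
  assumes h: "contraction n h" and k: "k \<le> n"
  shows "exact_for Q k"
  unfolding exact_for_def
proof (intro allI impI)
  fix x assume x: "cycle Q k x"
  then have xH: "x \<in> Hom C Q (sob S k)" by (simp add: cycle_def)
  interpret comm_group "H Q (sob S k)" using group_H[OF xH] .
  have hk: "h k \<in> Hom C (sob S k) (sob S (Suc k))" using h k by (simp add: contraction_def)
  define c where "c = (case k of 0 \<Rightarrow> zr (sob S 0) (sob S 0) | Suc l \<Rightarrow> h l \<cdot> bd l)"
  have eq: "(bd k \<cdot> h k) \<otimes>\<^bsub>H (sob S k) (sob S k)\<^esub> c = Idt C (sob S k)"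
    using h k by (simp add: contraction_def c_def)
  have c: "c \<in> Hom C (sob S k) (sob S k)"
    using h k comp_Hom[OF bd_Hom] zr_Hom[OF sob_Ob sob_Ob]
    by (auto simp: c_def contraction_def split: nat.split)
  have "c \<cdot> x = zr Q (sob S k)"
  proof (cases k)
    case 0
    then show ?thesis using zr_comp[OF xH sob_Ob] by (simp add: c_def)
  next
    case (Suc l)
    have hl: "h l \<in> Hom C (sob S l) (sob S k)" using h k Suc by (auto simp: contraction_def)
    have "bd l \<cdot> x = zr Q (sob S l)" using x Suc by (simp add: cycle_def)
    then show ?thesis
      using comp_assoc[OF xH[unfolded Suc] bd_Hom hl] comp_zr[OF hl HomD(4)[OF xH]]
      by (simp add: c_def Suc)
  qed
  then have "x = (bd k \<cdot> h k) \<cdot> x"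
    using precomp[OF comp_Hom[OF hk bd_Hom] c xH] eq Idt_left[OF xH]
      comp_Hom[OF xH comp_Hom[OF hk bd_Hom]] by simp
  then show "\<exists>y \<in> Hom C Q (sob S (Suc k)). bd k \<cdot> y = x"
    using comp_assoc[OF xH hk bd_Hom] comp_Hom[OF xH hk] by metis
qed

text \<open>Dually, a cocycle satisfies \<open>f = f d h + f h d = (f h) d\<close>, and
  \<open>f = 0\<close> in degree 0.\<close>

lemma coexact_for_if_contraction:
  assumes h: "contraction n h" and k: "k \<le> n"
  shows "coexact_for M k"
  unfolding coexact_for_def
proof (intro ballI impI)
  fix f assume f: "f \<in> Hom C (sob S k) M" and fb: "f \<cdot> bd k = zr (sob S (Suc k)) M"
  interpret comm_group "H (sob S k) M" using group_H[OF f] .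
  have hk: "h k \<in> Hom C (sob S k) (sob S (Suc k))" using h k by (simp add: contraction_def)
  define c where "c = (case k of 0 \<Rightarrow> zr (sob S 0) (sob S 0) | Suc l \<Rightarrow> h l \<cdot> bd l)"
  have eq: "(bd k \<cdot> h k) \<otimes>\<^bsub>H (sob S k) (sob S k)\<^esub> c = Idt C (sob S k)"
    using h k by (simp add: contraction_def c_def)
  have c: "c \<in> Hom C (sob S k) (sob S k)"
    using h k comp_Hom[OF bd_Hom] zr_Hom[OF sob_Ob sob_Ob]
    by (auto simp: c_def contraction_def split: nat.split)
  have "f \<cdot> (bd k \<cdot> h k) = zr (sob S k) M"
    using comp_assoc[OF hk bd_Hom f] fb zr_comp[OF hk HomD(5)[OF f]] by simp
  then have fc: "f = f \<cdot> c"
    using postcomp[OF f comp_Hom[OF hk bd_Hom] c] eq Idt_right[OF f] comp_Hom[OF c f] by simp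
  show "case k of 0 \<Rightarrow> f = zr (sob S 0) M | Suc l \<Rightarrow> \<exists>g \<in> Hom C (sob S l) M. f = g \<cdot> bd l"
  proof (cases k)
    case 0
    then show ?thesis using fc comp_zr[OF f sob_Ob[of 0]] by (simp add: c_def)
  next
    case (Suc l)
    have hl: "h l \<in> Hom C (sob S l) (sob S k)" using h k Suc by (auto simp: contraction_def)
    have "f = (f \<cdot> h l) \<cdot> bd l"
      using fc comp_assoc[OF bd_Hom hl[unfolded Suc] f[unfolded Suc]] Suc by (simp add: c_def)
    then show ?thesis using comp_Hom[OF hl f] Suc by auto
  qed
qed

text \<open>The cokernel \<open>q\<close> of \<open>bd k\<close> is itself a cocycle. Hence it is
  zero or factors through the differential out of degree \<open>k\<close>; in both cases it kills
  the cycle \<open>x\<close>, which therefore lifts along \<open>bd k\<close>.\<close>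

lemma exact_for_if_coexact_for:
  assumes co: "\<And>M. M \<in> Ob C \<Longrightarrow> coexact_for M k" and Q: "epi_projective Q"
  shows "exact_for Q k"
  unfolding exact_for_def
proof (intro allI impI)
  fix x assume x: "cycle Q k x"
  then have xH: "x \<in> Hom C Q (sob S k)" by (simp add: cycle_def)
  obtain q where q: "is_cokernel C (bd k) q" using cokernels HomD(1)[OF bd_Hom] by blast
  note qH = cokernel_Hom[OF q bd_Hom] and qb = cokernel_comp[OF q bd_Hom]
  have *: "case k of 0 \<Rightarrow> q = zr (sob S 0) (Cod C q) | Suc l \<Rightarrow> \<exists>g \<in> Hom C (sob S l) (Cod C q). q = g \<cdot> bd l"
    using co[OF HomD(5)[OF qH]] qH qb unfolding coexact_for_def by blast
  have "q \<cdot> x = zr Q (Cod C q)"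
  proof (cases k)
    case 0
    then show ?thesis using * zr_comp[OF xH HomD(5)[OF qH]] by simp
  next
    case (Suc l)
    then obtain g where g: "g \<in> Hom C (sob S l) (Cod C q)" "q = g \<cdot> bd l" using * by auto
    have "bd l \<cdot> x = zr Q (sob S l)" using x Suc by (simp add: cycle_def)
    then show ?thesis
      using comp_assoc[OF xH[unfolded Suc] bd_Hom g(1)] g(2) comp_zr[OF g(1) HomD(4)[OF xH]] by simp
  qed
  from lift_into_image[OF Q bd_Hom q xH this]
  show "\<exists>y \<in> Hom C Q (sob S (Suc k)). bd k \<cdot> y = x" by blast
qed

theorem moore_zero_iff_coexact_for:
  assumes Q: "\<And>k. epi_projective (sob S k)"
  shows "(\<forall>k \<le> n. zero_object C (moore_homology C k S)) \<longleftrightarrow> (\<forall>M \<in> Ob C. \<forall>k \<le> n. coexact_for M k)"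
proof
  assume "\<forall>k \<le> n. zero_object C (moore_homology C k S)"
  then obtain h where "contraction n h"
    using contraction_exists[of n] exact_for_if_moore_zero[OF _ sob_Ob Q] by blast
  then show "\<forall>M \<in> Ob C. \<forall>k \<le> n. coexact_for M k" using coexact_for_if_contraction by blast
next
  assume "\<forall>M \<in> Ob C. \<forall>k \<le> n. coexact_for M k"
  then obtain h where "contraction n h"
    using contraction_exists[of n] exact_for_if_coexact_for[OF _ Q] by blast
  then show "\<forall>k \<le> n. zero_object C (moore_homology C k S)"
    using moore_zero_if_exact_for exact_for_if_contraction by blast
qed

end


section \<open>Reflective abelian subcategories of the abelian core\<close>

lemma is_functor_map_simplicial:
  assumes C: "category C" and F: "is_functor C D F" and S: "simplicial_object C S"
  shows "simplicial_object D (map_simplicial F S)"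
proof -
  interpret C: cat_axioms C by unfold_locales (rule C)
  have hom: "FAr F f \<in> Hom D (FOb F A) (FOb F B)" if "f \<in> Hom C A B" for f A B
    using F C.HomD[OF that] by (auto simp: is_functor_def)
  have comp: "FAr F g \<cdot>\<^bsub>D\<^esub> FAr F f = FAr F (g \<cdot>\<^bsub>C\<^esub> f)" if "f \<in> Hom C A B" "g \<in> Hom C B E" for f g A B E
    using F C.HomD[OF that(1)] C.HomD[OF that(2)] by (auto simp: is_functor_def)
  have idt: "FAr F (Idt C A) = Idt D (FOb F A)" "FOb F A \<in> Ob D" if "A \<in> Ob C" for A
    using F that by (auto simp: is_functor_def)
  note d = simplicial_objectD(2)[OF S] and s = simplicial_objectD(3)[OF S]
    and dd = simplicial_objectD(4)[OF S] and ss = simplicial_objectD(5)[OF S]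
    and ds1 = simplicial_objectD(6)[OF S] and ds2 = simplicial_objectD(7,8)[OF S]
    and ds3 = simplicial_objectD(9)[OF S] and ob = simplicial_objectD(1)[OF S]
  show ?thesis
    unfolding simplicial_object_def map_simplicial_def simplicial.simps
  proof (intro conjI allI impI)
    fix n i j :: nat
    show "FOb F (sob S n) \<in> Ob D" using idt ob by blast
    show "i \<le> Suc n \<Longrightarrow> FAr F (face S n i) \<in> Hom D (FOb F (sob S (Suc n))) (FOb F (sob S n))"
      using hom d by blast
    show "i \<le> n \<Longrightarrow> FAr F (degen S n i) \<in> Hom D (FOb F (sob S n)) (FOb F (sob S (Suc n)))"
      using hom s by blast
    show "FAr F (face S n i) \<cdot>\<^bsub>D\<^esub> FAr F (face S (Suc n) j) =
        FAr F (face S n (j - 1)) \<cdot>\<^bsub>D\<^esub> FAr F (face S (Suc n) i)" if "i < j" "j \<le> n + 2"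
      using comp[OF d[of j "Suc n"] d[of i n]] comp[OF d[of i "Suc n"] d[of "j - 1" n]] dd[OF that] that
      by simp
    show "FAr F (degen S (Suc n) i) \<cdot>\<^bsub>D\<^esub> FAr F (degen S n j) =
        FAr F (degen S (Suc n) (Suc j)) \<cdot>\<^bsub>D\<^esub> FAr F (degen S n i)" if "i \<le> j" "j \<le> n"
      using comp[OF s[of j n] s[of i "Suc n"]] comp[OF s[of i n] s[of "Suc j" "Suc n"]] ss[OF that] that
      by simp
    show "FAr F (face S (Suc n) i) \<cdot>\<^bsub>D\<^esub> FAr F (degen S (Suc n) j) =
        FAr F (degen S n (j - 1)) \<cdot>\<^bsub>D\<^esub> FAr F (face S n i)" if "i < j" "j \<le> Suc n"
      using comp[OF s[of j "Suc n"] d[of i "Suc n"]] comp[OF d[of i n] s[of "j - 1" n]] ds1[OF that] that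
      by simp
    show "FAr F (face S n j) \<cdot>\<^bsub>D\<^esub> FAr F (degen S n j) = Idt D (FOb F (sob S n))"
      "FAr F (face S n (Suc j)) \<cdot>\<^bsub>D\<^esub> FAr F (degen S n j) = Idt D (FOb F (sob S n))" if "j \<le> n"
      using comp[OF s[of j n] d[of j n]] comp[OF s[of j n] d[of "Suc j" n]] ds2[OF that] idt(1)[OF ob] that
      by simp_all
    show "FAr F (face S (Suc n) i) \<cdot>\<^bsub>D\<^esub> FAr F (degen S (Suc n) j) =
        FAr F (degen S n j) \<cdot>\<^bsub>D\<^esub> FAr F (face S n (i - 1))" if "Suc j < i" "i \<le> n + 2"
      using comp[OF s[of j "Suc n"] d[of i "Suc n"]] comp[OF d[of "i - 1" n] s[of j n]] ds3[OF that] that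
      by simp
  qed
qed

text \<open>For \<open>x\<close> in \<open>K\<close> the coset of \<open>x\<close> contains
  \<open>x\<close>, as \<open>B\<close> contains the unit; if all cosets equal \<open>B\<close>,
  then \<open>x\<close> lies in \<open>B\<close>. Conversely \<open>B = K\<close>, and there is a
  single coset.\<close>

lemma (in group) trivial_group_FactGroup_iff:
  assumes K: "subgroup K G" and B: "B \<subseteq> K" "\<one> \<in> B"
  shows "trivial_group (G\<lparr>carrier := K\<rparr> Mod B) \<longleftrightarrow> K \<subseteq> B"
proof
  assume "trivial_group (G\<lparr>carrier := K\<rparr> Mod B)"
  then have *: "(\<lambda>x. B #>\<^bsub>G\<lparr>carrier := K\<rparr>\<^esub> x) ` K = {B}"
    using carrier_FactGroup[of "G\<lparr>carrier := K\<rparr>" B] by (simp add: trivial_group_def)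
  show "K \<subseteq> B"
  proof
    fix x assume x: "x \<in> K"
    then have "B #>\<^bsub>G\<lparr>carrier := K\<rparr>\<^esub> x = B" using * by blast
    moreover have "\<one> \<otimes> x \<in> B #>\<^bsub>G\<lparr>carrier := K\<rparr>\<^esub> x" using B(2) by (auto simp: r_coset_def)
    ultimately show "x \<in> B" using subgroup.mem_carrier[OF K x] by simp
  qed
next
  assume "K \<subseteq> B"
  then have BK: "B = K" using B by blast
  let ?K = "G\<lparr>carrier := K\<rparr>"
  interpret K: group ?K using subgroup_imp_group[OF K] .
  have sub: "subgroup K ?K" using K.subgroup_self by simp
  have n: "normal K ?K"
    unfolding K.normal_inv_iff using sub K.m_closed K.inv_closed by simp
  have "(\<lambda>x. K #>\<^bsub>?K\<^esub> x) ` K = {K}"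
    using K.coset_join2[OF _ sub] subgroup.one_closed[OF K] by (auto simp: image_def)
  then show "trivial_group (?K Mod B)"
    using normal.factorgroup_is_group[OF n] carrier_FactGroup[of ?K K]
    by (simp add: trivial_group_def BK)
qed

locale reflective_in_core = protomodular_cat C for C :: "('o, 'm) cat" (structure) +
  fixes R :: "'o set" and T :: "('o, 'm, 'o, 'm) ftor" and \<eta> :: "'o \<Rightarrow> 'm"
  assumes R_core: "R \<subseteq> abelian_core C"
    and abelian: "abelian_category (full_subcategory C R)"
    and right_exact: "sequentially_right_exact (full_subcategory C R) C inclusion_functor"
    and T_functor: "is_functor C (full_subcategory C R) T"
    and \<eta>_Hom: "A \<in> Ob C \<Longrightarrow> \<eta> A \<in> Hom C A (FOb T A)"
    and \<eta>_natural: "f \<in> Ar C \<Longrightarrow> \<eta> (Cod C f) \<cdot> f = FAr T f \<cdot> \<eta> (Dom C f)"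
    and \<eta>_universal: "A \<in> Ob C \<Longrightarrow> M \<in> R \<Longrightarrow> f \<in> Hom C A M \<Longrightarrow>
      \<exists>!g. g \<in> Hom C (FOb T A) M \<and> g \<cdot> \<eta> A = f"
begin

abbreviation "D \<equiv> full_subcategory C R"

lemma D_simps [simp]:
  "Ob D = R" "Dom D = Dom C" "Cod D = Cod C" "Idt D = Idt C" "Cmp D = Cmp C"
  by (simp_all add: full_subcategory_def)

lemma Hom_D_iff: "f \<in> Hom D A B \<longleftrightarrow> f \<in> Hom C A B \<and> A \<in> R \<and> B \<in> R"
  by (auto simp: Hom_def full_subcategory_def)

lemma Hom_D: "A \<in> R \<Longrightarrow> B \<in> R \<Longrightarrow> Hom D A B = Hom C A B"
  using Hom_D_iff by blast

lemma R_Ob: "A \<in> R \<Longrightarrow> A \<in> Ob C"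
  using R_core by (auto simp: abelian_core_def)

text \<open>Cutting the carrier down makes it \<open>Hom D A B\<close> even if \<open>A\<close> or \<open>B\<close> is not in \<open>R\<close>.\<close>

definition HD :: "'o \<Rightarrow> 'o \<Rightarrow> 'm monoid" where
  "HD A B = (hom_group C A B)\<lparr>carrier := Hom D A B\<rparr>"

lemma HD_eq: "A \<in> R \<Longrightarrow> B \<in> R \<Longrightarrow> HD A B = hom_group C A B"
  unfolding HD_def using Hom_D[of A B] carrier_hom_group[of A B] by simp

text \<open>Kernels and cokernels are those of the full subcategory itself; what comes from the
  ambient category is the addition of arrows, which composition respects on both sides by the
  results on the abelian core.\<close>

sublocale D: abelian_cat D HD
proof (intro abelian_cat.intro abelian_cat_axioms.intro pointed_cat.intro pointed_cat_axioms.intro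
    cat_axioms.intro)
  show "category D" "pointed D" using abelian by (simp_all add: abelian_category_def)
  fix A B assume "A \<in> Ob D" "B \<in> Ob D"
  then show "comm_group (HD A B)"
    using comm_group_hom_group R_core R_Ob by (auto simp: HD_eq)
next
  fix A B show "carrier (HD A B) = Hom D A B" by (simp add: HD_def)
next
  fix f g h A B E assume "f \<in> Hom D B E" "g \<in> Hom D B E" "h \<in> Hom D A B"
  then show "(f \<otimes>\<^bsub>HD B E\<^esub> g) \<cdot>\<^bsub>D\<^esub> h = (f \<cdot>\<^bsub>D\<^esub> h) \<otimes>\<^bsub>HD A E\<^esub> (g \<cdot>\<^bsub>D\<^esub> h)"
    using hom_group_precomp R_core by (auto simp: HD_eq Hom_D_iff)
next
  fix u f g A B E assume "u \<in> Hom D B E" "f \<in> Hom D A B" "g \<in> Hom D A B"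
  then show "u \<cdot>\<^bsub>D\<^esub> (f \<otimes>\<^bsub>HD A B\<^esub> g) = (u \<cdot>\<^bsub>D\<^esub> f) \<otimes>\<^bsub>HD A E\<^esub> (u \<cdot>\<^bsub>D\<^esub> g)"
    using hom_group_postcomp[of B E u f A g] subsetD[OF R_core] by (auto simp: HD_eq Hom_D_iff)
qed (use abelian in \<open>simp_all add: abelian_category_def\<close>)

section \<open>Transposition along the reflection\<close>

lemma T_R: "A \<in> Ob C \<Longrightarrow> FOb T A \<in> R"
  using T_functor by (simp add: is_functor_def)

lemma T_Hom: "f \<in> Hom C A B \<Longrightarrow> FAr T f \<in> Hom C (FOb T A) (FOb T B)"
  using T_functor HomD[of f A B] Hom_D_iff by (auto simp: is_functor_def)

lemma \<eta>_cancel: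
  assumes "A \<in> Ob C" "M \<in> R" "f \<in> Hom C (FOb T A) M" "g \<in> Hom C (FOb T A) M" "f \<cdot> \<eta> A = g \<cdot> \<eta> A"
  shows "f = g"
  using \<eta>_universal[OF assms(1,2) comp_Hom[OF \<eta>_Hom[OF assms(1)] assms(3)]] assms(3-5) by auto

lemma \<eta>_factor:
  assumes "A \<in> Ob C" "M \<in> R" "f \<in> Hom C A M"
  obtains g where "g \<in> Hom C (FOb T A) M" "f = g \<cdot> \<eta> A"
  using \<eta>_universal[OF assms] by blast

lemma Hom_eq_image_\<eta>:
  assumes "A \<in> Ob C" "M \<in> R"
  shows "Hom C A M = (\<lambda>g. g \<cdot> \<eta> A) ` Hom C (FOb T A) M"
proof
  show "Hom C A M \<subseteq> (\<lambda>g. g \<cdot> \<eta> A) ` Hom C (FOb T A) M"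
    using \<eta>_universal[OF assms] by blast
  show "(\<lambda>g. g \<cdot> \<eta> A) ` Hom C (FOb T A) M \<subseteq> Hom C A M"
    using comp_Hom[OF \<eta>_Hom[OF assms(1)]] by blast
qed

text \<open>The lifting problem for \<open>FOb T Q\<close> is transposed along the unit to one for
  \<open>Q\<close>, solved in the ambient category, and transposed back. It can be solved there
  because \<open>e\<close> becomes a regular epimorphism followed by a split
  \<open>m\<close>.\<close>

lemma epi_projective_T:
  assumes Q: "projective C Q"
  shows "D.epi_projective (FOb T Q)"
  unfolding D.epi_projective_def
proof (intro allI impI)
  fix A B e f
  assume ep: "epic D e" and e: "e \<in> Hom D A B" and f: "f \<in> Hom D (FOb T Q) B"
  have obQ: "Q \<in> Ob C" using Q by (simp add: projective_def)
  have eC: "e \<in> Hom C A B" and AB: "A \<in> R" "B \<in> R" and fC: "f \<in> Hom C (FOb T Q) B"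
    using e f by (auto simp: Hom_D_iff)
  obtain k where "is_kernel D e k" using D.kernels D.HomD(1)[OF e] by blast
  then have "right_exact_sequence D k e" using D.right_exact_sequence_kernel[OF ep] by blast
  then have "right_exact_sequence C k e"
    using right_exact by (auto simp: sequentially_right_exact_def inclusion_functor_def)
  then obtain W t where W: "zero_object C W" and t: "t \<in> Hom C B W" and ex: "exact_at C e t"
    using HomD(3)[OF eC] unfolding right_exact_sequence_def by auto
  then obtain m e' where mono: "monic C m" and re: "regular_epi C e'" and cod: "Cod C e' = Dom C m"
    and em: "e = m \<cdot> e'" and km: "is_kernel C t m"
    unfolding exact_at_def is_image_def by auto
  have m: "m \<in> Hom C (Dom C m) B"
    using km HomD(2)[OF t] by (simp add: is_kernel_def joint_kernel_def Hom_def)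
  have e': "e' \<in> Hom C (Dom C e') (Dom C m)"
    using re cod by (auto simp: regular_epi_def is_coequalizer_def Hom_def)
  have domA: "Dom C e' = A" using HomD(2)[OF comp_Hom[OF e' m]] HomD(2)[OF eC] em by simp
  note I = Idt_Hom[OF HomD(5)[OF eC]]
  have "zero_arrow C (t \<cdot> Idt C B)" using Idt_right[OF t] zero_arrow_to[OF W t] by simp
  \<comment> \<open>Exactness at \<open>B\<close> says that the image \<open>m\<close> of
    \<open>e\<close> is a kernel of \<open>t\<close>. As \<open>t\<close> ends in a zero object, the
    identity of \<open>B\<close> factors through \<open>m\<close>.\<close>
  then obtain h where h: "h \<in> Hom C B (Dom C m)" "m \<cdot> h = Idt C B"
  proof -
    have "\<forall>g \<in> Ar C. Cod C g = B \<longrightarrow> zero_arrow C (t \<cdot> g) \<longrightarrow>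
        (\<exists>!h. h \<in> Hom C (Dom C g) (Dom C m) \<and> m \<cdot> h = g)"
      using km HomD(2)[OF t] unfolding is_kernel_def joint_kernel_def by auto
    from this[rule_format, OF HomD(1,3)[OF I] \<open>zero_arrow C (t \<cdot> Idt C B)\<close>]
    show ?thesis using that HomD(2)[OF I] by auto
  qed
  note \<eta>Q = \<eta>_Hom[OF obQ]
  note f\<eta> = comp_Hom[OF \<eta>Q fC]
  have "h \<cdot> (f \<cdot> \<eta> Q) \<in> Hom C Q (Cod C e')" using comp_Hom[OF f\<eta> h(1)] cod by simp
  then obtain g0 where g0: "g0 \<in> Hom C Q A" "e' \<cdot> g0 = h \<cdot> (f \<cdot> \<eta> Q)"
    using Q re domA unfolding projective_def by blast
  have eg0: "e \<cdot> g0 = f \<cdot> \<eta> Q"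
    using comp_assoc[OF g0(1) e'[unfolded domA] m] comp_assoc[OF f\<eta> h(1) m] g0(2) h(2) em Idt_left[OF f\<eta>]
    by simp
  obtain g where g: "g \<in> Hom C (FOb T Q) A" "g0 = g \<cdot> \<eta> Q"
    by (rule \<eta>_factor[OF obQ AB(1) g0(1)])
  have "e \<cdot> g = f"
    using \<eta>_cancel[OF obQ AB(2) comp_Hom[OF g(1) eC] fC] comp_assoc[OF \<eta>Q g(1) eC] eg0 g(2) by simp
  then show "\<exists>g \<in> Hom D (FOb T Q) A. e \<cdot>\<^bsub>D\<^esub> g = f"
    using g(1) AB(1) T_R[OF obQ] by (auto simp: Hom_D_iff)
qed

text \<open>Composition with the unit is an additive bijection from arrows
  \<open>T(P\<^sub>k) \<rightarrow> M\<close> to arrows \<open>P\<^sub>k \<rightarrow> M\<close>. By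
  naturality it commutes with the coboundaries, so cocycles and coboundaries correspond.\<close>

lemma trivial_Ext_iff_coexact_for:
  assumes P: "simplicial_object C P" and M: "M \<in> R"
  shows "trivial_group (Ext_group C k P M) \<longleftrightarrow>
    simplicial_abelian.coexact_for D HD (map_simplicial T P) M k"
proof -
  let ?S = "map_simplicial T P"
  interpret S: simplicial_abelian D HD ?S
    using is_functor_map_simplicial[OF category T_functor P] by unfold_locales
  have core: "M \<in> abelian_core C" using M R_core by blast
  have obP: "sob P n \<in> Ob C" for n using P by (simp add: simplicial_object_def)
  have faceP: "face P n i \<in> Hom C (sob P (Suc n)) (sob P n)" if "i \<le> Suc n" for n i
    using P that by (simp add: simplicial_object_def)
  have S: "sob ?S n = FOb T (sob P n)" "face ?S n i = FAr T (face P n i)" for n i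
    by (simp_all add: map_simplicial_def)
  have TR: "FOb T (sob P n) \<in> R" for n using T_R[OF obP] .
  define G where "G n = hom_group C (sob P n) M" for n
  have G: "comm_group (G n)" for n unfolding G_def using comm_group_hom_group[OF core obP] .
  have carG: "carrier (G n) = Hom C (sob P n) M" for n by (simp add: G_def)
  have HDG: "HD (FOb T (sob P n)) M = hom_group C (FOb T (sob P n)) M" for n using HD_eq[OF TR M] .
  have \<eta>P: "\<eta> (sob P n) \<in> Hom C (sob P n) (FOb T (sob P n))" for n using \<eta>_Hom[OF obP] .
  have pre: "(\<lambda>f. f \<cdot> h) \<in> hom (hom_group C B M) (hom_group C A M)" if h: "h \<in> Hom C A B" for h A B
    using hom_group_precomp[OF core] comp_Hom[OF h] h by (intro homI) simp_all
  have cob: "coboundary C P M n f = altsum (G (Suc n)) (\<lambda>i. f \<cdot> face P n i) (Suc n)" for n f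
    by (simp add: coboundary_def altsum_def G_def Let_def)
  have bd: "S.bd n \<in> Hom C (FOb T (sob P (Suc n))) (FOb T (sob P n))" for n
    using S.bd_Hom[of n] by (simp add: Hom_D_iff S)
  \<comment> \<open>Naturality of the unit at each face turns the coboundary on \<open>P\<close>
    into composition with the differential of \<open>T(P)\<close>.\<close>
  have cob_\<eta>: "coboundary C P M n (f \<cdot> \<eta> (sob P n)) = (f \<cdot> S.bd n) \<cdot> \<eta> (sob P (Suc n))"
    if f: "f \<in> Hom C (FOb T (sob P n)) M" for f n
  proof -
    let ?K = "hom_group C (FOb T (sob P (Suc n))) M"
    interpret K: comm_group ?K using comm_group_hom_group[OF core R_Ob[OF TR]] .
    interpret Gn: comm_group "G (Suc n)" by (rule G)
    have fT: "f \<cdot> FAr T (face P n i) \<in> Hom C (FOb T (sob P (Suc n))) M" if "i \<le> Suc n" for i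
      using comp_Hom[OF T_Hom[OF faceP[OF that]] f] .
    have eq: "(f \<cdot> \<eta> (sob P n)) \<cdot> face P n i = (f \<cdot> FAr T (face P n i)) \<cdot> \<eta> (sob P (Suc n))"
      if i: "i \<le> Suc n" for i
      using comp_assoc[OF faceP[OF i] \<eta>P f] comp_assoc[OF \<eta>P T_Hom[OF faceP[OF i]] f]
        \<eta>_natural[OF HomD(1)[OF faceP[OF i]]] HomD(2,3)[OF faceP[OF i]] by simp
    have "f \<cdot> S.bd n = altsum ?K (\<lambda>i. f \<cdot> FAr T (face P n i)) (Suc n)"
      using S.comp_bd[of f n M] f TR M by (simp add: Hom_D_iff S HDG)
    then have "(f \<cdot> S.bd n) \<cdot> \<eta> (sob P (Suc n)) =
        altsum (G (Suc n)) (\<lambda>i. (f \<cdot> FAr T (face P n i)) \<cdot> \<eta> (sob P (Suc n))) (Suc n)"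
      using K.hom_altsum[OF pre[OF \<eta>P] G[unfolded G_def]] fT by (simp add: G_def)
    also have "\<dots> = altsum (G (Suc n)) (\<lambda>i. (f \<cdot> \<eta> (sob P n)) \<cdot> face P n i) (Suc n)"
      using eq comp_Hom[OF faceP comp_Hom[OF \<eta>P f]] by (intro Gn.altsum_cong) (simp_all add: carG)
    finally show ?thesis by (simp add: cob)
  qed
  have one_\<eta>: "\<one>\<^bsub>hom_group C (FOb T (sob P n)) M\<^esub> \<cdot> \<eta> (sob P n) = \<one>\<^bsub>G n\<^esub>" for n
  proof -
    have "group_hom (hom_group C (FOb T (sob P n)) M) (G n) (\<lambda>f. f \<cdot> \<eta> (sob P n))"
      using pre[OF \<eta>P] G comm_group_hom_group[OF core R_Ob[OF TR]]
      by (simp add: group_hom_def group_hom_axioms_def comm_group.axioms(2) G_def)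
    then show ?thesis by (rule group_hom.hom_one)
  qed
  have one_Hom: "\<one>\<^bsub>hom_group C (FOb T (sob P n)) M\<^esub> \<in> Hom C (FOb T (sob P n)) M" for n
    using one_hom_group_Hom[OF core R_Ob[OF TR]] .
  have eq_one_iff: "f \<cdot> \<eta> (sob P n) = \<one>\<^bsub>G n\<^esub> \<longleftrightarrow> f = \<one>\<^bsub>hom_group C (FOb T (sob P n)) M\<^esub>"
    if "f \<in> Hom C (FOb T (sob P n)) M" for f n
    using \<eta>_cancel[OF obP M that one_Hom] one_\<eta> by auto
  have cob_hom: "group_hom (G n) (G (Suc n)) (coboundary C P M n)" for n
  proof -
    interpret Gn: comm_group "G (Suc n)" by (rule G)
    have fd: "f \<cdot> face P n i \<in> carrier (G (Suc n))" if "f \<in> carrier (G n)" "i \<le> Suc n" for f i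
      using comp_Hom[OF faceP] that by (simp add: carG)
    have "coboundary C P M n (f \<otimes>\<^bsub>G n\<^esub> g) = coboundary C P M n f \<otimes>\<^bsub>G (Suc n)\<^esub> coboundary C P M n g"
      if fg: "f \<in> carrier (G n)" "g \<in> carrier (G n)" for f g
    proof -
      have "coboundary C P M n (f \<otimes>\<^bsub>G n\<^esub> g) =
          altsum (G (Suc n)) (\<lambda>i. (f \<cdot> face P n i) \<otimes>\<^bsub>G (Suc n)\<^esub> (g \<cdot> face P n i)) (Suc n)"
        unfolding cob
      proof (rule Gn.altsum_cong)
        fix i assume "i \<le> Suc n"
        then show "(f \<otimes>\<^bsub>G n\<^esub> g) \<cdot> face P n i = (f \<cdot> face P n i) \<otimes>\<^bsub>G (Suc n)\<^esub> (g \<cdot> face P n i)"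
          "(f \<cdot> face P n i) \<otimes>\<^bsub>G (Suc n)\<^esub> (g \<cdot> face P n i) \<in> carrier (G (Suc n))"
          using fg hom_group_precomp[OF core _ _ faceP] Gn.m_closed[OF fd fd] by (simp_all add: G_def)
      qed
      also have "\<dots> = coboundary C P M n f \<otimes>\<^bsub>G (Suc n)\<^esub> coboundary C P M n g"
        unfolding cob using fd fg by (intro Gn.altsum_mult)
      finally show ?thesis .
    qed
    moreover have "coboundary C P M n f \<in> carrier (G (Suc n))" if "f \<in> carrier (G n)" for f
      unfolding cob using fd that by (intro Gn.altsum_closed)
    ultimately show ?thesis
      using G by (auto simp: group_hom_def group_hom_axioms_def comm_group.axioms(2) intro!: homI)
  qed
  interpret Gk: comm_group "G k" by (rule G)
  let ?Z = "cocycles C P M k" and ?B = "coboundaries C P M k"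
  have Z: "?Z = kernel (G k) (G (Suc k)) (coboundary C P M k)"
    by (simp add: cocycles_def G_def)
  have Z_iff: "f \<cdot> \<eta> (sob P k) \<in> ?Z \<longleftrightarrow> f \<cdot> S.bd k = \<one>\<^bsub>hom_group C (FOb T (sob P (Suc k))) M\<^esub>"
    if f: "f \<in> Hom C (FOb T (sob P k)) M" for f
    using cob_\<eta>[OF f] eq_one_iff[OF comp_Hom[OF bd f]] comp_Hom[OF \<eta>P f]
    by (simp add: Z kernel_def carG)
  have B0: "?B = {\<one>\<^bsub>G 0\<^esub>}" if "k = 0" using that by (simp add: coboundaries_def G_def)
  have BS: "?B = coboundary C P M l ` carrier (G l)" if "k = Suc l" for l
    using that by (simp add: coboundaries_def G_def)
  have B_iff: "f \<cdot> \<eta> (sob P k) \<in> ?B \<longleftrightarrow>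
      (case k of 0 \<Rightarrow> f = \<one>\<^bsub>hom_group C (FOb T (sob P 0)) M\<^esub>
       | Suc l \<Rightarrow> \<exists>g \<in> Hom C (FOb T (sob P l)) M. f = g \<cdot> S.bd l)"
    if f: "f \<in> Hom C (FOb T (sob P k)) M" for f
  proof (cases k)
    case 0
    then show ?thesis using eq_one_iff[of f 0] f B0 by simp
  next
    case (Suc l)
    have "f \<cdot> \<eta> (sob P (Suc l)) = coboundary C P M l (g \<cdot> \<eta> (sob P l)) \<longleftrightarrow> f = g \<cdot> S.bd l"
      if g: "g \<in> Hom C (FOb T (sob P l)) M" for g
      using cob_\<eta>[OF g] \<eta>_cancel[OF obP M f[unfolded Suc] comp_Hom[OF bd g]] by auto
    moreover have "carrier (G l) = (\<lambda>g. g \<cdot> \<eta> (sob P l)) ` Hom C (FOb T (sob P l)) M"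
      using Hom_eq_image_\<eta>[OF obP M] by (simp add: carG)
    ultimately show ?thesis using BS[OF Suc] Suc by auto
  qed
  have one_B: "\<one>\<^bsub>G k\<^esub> \<in> ?B"
  proof (cases k)
    case (Suc l)
    have "\<one>\<^bsub>G (Suc l)\<^esub> = coboundary C P M l \<one>\<^bsub>G l\<^esub>"
      using group_hom.hom_one[OF cob_hom[of l]] by simp
    then show ?thesis using BS[OF Suc] Suc comm_groupE(2)[OF G[of l]] by simp
  qed (use B0 in simp)
  \<comment> \<open>For \<open>k > 0\<close>, a coboundary is transposed to \<open>T(P)\<close>,
    where it is a cocycle because \<open>bd\<close> composed with itself is zero.\<close>
  have BZ: "?B \<subseteq> ?Z"
  proof (cases k)
    case 0
    then show ?thesis
      unfolding Z using B0 group_hom.hom_one[OF cob_hom[of 0]] comm_groupE(2)[OF G[of 0]]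
      by (simp add: kernel_def)
  next
    case (Suc l)
    show ?thesis
    proof
      fix x assume "x \<in> ?B"
      then obtain f where "f \<in> Hom C (sob P l) M" and x: "x = coboundary C P M l f"
        using BS[OF Suc] by (auto simp: carG)
      then obtain g where g: "g \<in> Hom C (FOb T (sob P l)) M" "f = g \<cdot> \<eta> (sob P l)"
        using \<eta>_factor[OF obP M] by metis
      have gD: "g \<in> Hom D (sob ?S l) M" using g(1) TR M by (simp add: Hom_D_iff S)
      have "(g \<cdot> S.bd l) \<cdot> S.bd (Suc l) = \<one>\<^bsub>hom_group C (FOb T (sob P (Suc (Suc l)))) M\<^esub>"
        using D.comp_assoc[OF S.bd_Hom S.bd_Hom gD] S.bd_bd[of l] D.comp_zr[OF gD S.sob_Ob]
        by (simp add: S HDG)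
      then show "x \<in> ?Z"
        using Z_iff[unfolded Suc, OF comp_Hom[OF bd g(1)]] x cob_\<eta>[OF g(1)] g(2) Suc by simp
    qed
  qed
  have "trivial_group (Ext_group C k P M) \<longleftrightarrow> ?Z \<subseteq> ?B"
    unfolding Ext_group_def G_def[symmetric]
    using group_hom.subgroup_kernel[OF cob_hom[of k]] BZ one_B
    by (intro Gk.trivial_group_FactGroup_iff) (simp_all add: Z)
  also have "\<dots> \<longleftrightarrow> (\<forall>f \<in> Hom C (FOb T (sob P k)) M. f \<cdot> \<eta> (sob P k) \<in> ?Z \<longrightarrow> f \<cdot> \<eta> (sob P k) \<in> ?B)"
  proof -
    have "?Z \<subseteq> (\<lambda>f. f \<cdot> \<eta> (sob P k)) ` Hom C (FOb T (sob P k)) M"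
      using Hom_eq_image_\<eta>[OF obP M, of k] by (auto simp: Z kernel_def carG)
    then show ?thesis by blast
  qed
  also have "\<dots> \<longleftrightarrow> S.coexact_for M k"
    using TR M Z_iff B_iff by (simp add: S.coexact_for_def S HDG Hom_D cong: nat.case_cong)
  finally show ?thesis .
qed

theorem left_derived_zero_iff_Ext_trivial:
  assumes P: "simplicial_projective_resolution C P X"
  shows "(\<forall>k \<le> n. zero_object D (left_derived D T k P)) \<longleftrightarrow>
    (\<forall>M \<in> R. \<forall>k \<le> n. trivial_group (Ext_group C k P M))"
proof -
  have simp: "simplicial_object C P" and proj: "\<And>k. projective C (sob P k)"
    using P by (auto simp: simplicial_projective_resolution_def aug_simplicial_object_def)
  interpret S: simplicial_abelian D HD "map_simplicial T P"
    using is_functor_map_simplicial[OF category T_functor simp] by unfold_locales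
  have "D.epi_projective (sob (map_simplicial T P) k)" for k
    using epi_projective_T[OF proj] by (simp add: map_simplicial_def)
  then show ?thesis
    using S.moore_zero_iff_coexact_for[of n] trivial_Ext_iff_coexact_for[OF simp]
    by (simp add: left_derived_def)
qed

end

theorem theorem6p4:
  fixes \<U> :: "'u set set"
    and ar :: "'f \<Rightarrow> nat"
    and E :: "('f trm \<times> 'f trm) set"
    and \<X> :: "(('f, 'u) algebra, ('f, 'u) algebra \<times> ('u \<Rightarrow> 'u) \<times> ('f, 'u) algebra) cat"
    and R :: "('f, 'u) algebra set"
    and T :: "(('f, 'u) algebra, ('f, 'u) algebra \<times> ('u \<Rightarrow> 'u) \<times> ('f, 'u) algebra,
               ('f, 'u) algebra, ('f, 'u) algebra \<times> ('u \<Rightarrow> 'u) \<times> ('f, 'u) algebra) ftor"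
    and X :: "('f, 'u) algebra"
    and P :: "(('f, 'u) algebra, ('f, 'u) algebra \<times> ('u \<Rightarrow> 'u) \<times> ('f, 'u) algebra) aug_simplicial"
    and n :: nat
  assumes "universe \<U> (UNIV :: 'f set)"
    and "\<forall>(s, t) \<in> E. wf_trm ar s \<and> wf_trm ar t"
    and "\<X> = variety \<U> ar E"
    and "semiabelian \<X>"
    and "R \<subseteq> abelian_core \<X>"
    and "replete \<X> R"
    and "reflector \<X> R T"
    and "abelian_category (full_subcategory \<X> R)"
    and "sequentially_right_exact \<X> (full_subcategory \<X> R) T"
    and "sequentially_right_exact (full_subcategory \<X> R) \<X> inclusion_functor"
    and "X \<in> Ob \<X>"
    and "simplicial_projective_resolution \<X> P X"
  shows "(\<forall>k \<le> n. zero_object (full_subcategory \<X> R) (left_derived (full_subcategory \<X> R) T k P))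
     \<longleftrightarrow> (\<forall>M \<in> R. \<forall>k \<le> n. trivial_group (Ext_group \<X> k P M))"
proof -
  \<comment> \<open>The unit is hidden in an existential of \<open>reflector\<close>; it is fixed
    here to instantiate the locale.\<close>
  obtain \<eta> where \<eta>: "\<forall>A \<in> Ob \<X>. \<eta> A \<in> Hom \<X> A (FOb T A)"
    "\<forall>f \<in> Ar \<X>. \<eta> (Cod \<X> f) \<cdot>\<^bsub>\<X>\<^esub> f = FAr T f \<cdot>\<^bsub>\<X>\<^esub> \<eta> (Dom \<X> f)"
    "\<forall>A \<in> Ob \<X>. \<forall>M \<in> R. \<forall>f \<in> Hom \<X> A M. \<exists>!g. g \<in> Hom \<X> (FOb T A) M \<and> g \<cdot>\<^bsub>\<X>\<^esub> \<eta> A = f"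
    and T: "is_functor \<X> (full_subcategory \<X> R) T"
    using assms(7) unfolding reflector_def by blast
  interpret reflective_in_core \<X> R T \<eta>
    using assms(4,5,8,10) \<eta> T
    by unfold_locales (auto simp: semiabelian_def Barr_exact_def regular_category_def)
  show ?thesis using left_derived_zero_iff_Ext_trivial[OF assms(12)] .
qed

end
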